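(* There exists a dense set $\mathcal{A}\subset(0,1)$ such that for each $\alpha\in\mathcal{A}$ there exists a function $u\in C^\alpha(\mathbb{T})$, $u:\mathbb{T}\to\mathbb{R}$, which is sharply $\alpha$-Hölder, with the following properties. For $\nu\in[0,1]$ consider solutions $f=f(t,x,y)$, $(t,x,y)\in[0,\infty)\times\mathbb{T}^2$, of $$\partial_t f+u(y)\,\partial_x f=\nu\Delta f,\qquad f(0)=f^{in},\qquad \int_{\mathbb{T}} f^{in}(x,y)\,dx=0. \qquad (\ast)$$ (1) (Inviscid mixing, $\nu=0$.) There exist constants $C=C(u)>0$ and $c=c(u)>0$ such that: (a) for every solution $f$ of $(\ast)$ with $\nu=0$ and all $t>0$, $$\|f(t)\|_{L^2_xH^{-1}_y}\le C\,t^{-1}\,\|f^{in}\|_{H^{-1}_xH^1_y};$$ (b) there exists a monotone sequence of times $(t_m)_{m\in\mathbb{N}}$ with $t_m\to\infty$ as $m\to\infty$ such that for every solution $f$ of $(\ast)$ with $\nu=0$ and all $m\in\mathbb{N}$, $$\|f(t_m)\|_{L^2_xH^{-1}_y}\le C\,t_m^{-\frac1\alpha}\,\|f^{in}\|_{L^2_xH^1_y};$$ (c) there exist a nonzero initial datum $f^{in}_\star$ with $\int_{\mathbb{T}}f^{in}_\star\,dx=0$ and a monotone sequence of times $(t'_m)_{m\in\mathbb{N}}$ with $t'_m\to\infty$ as $m\to\infty$ such that the corresponding solution $f_\star$ of $(\ast)$ with $\nu=0$ satisfies, for all $m\in\mathbb{N}$, $$\|f_\star(t'_m)\|_{L^2_xH^{-1}_y}\ge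 c\,(t'_m)^{-1}\,\|f^{in}_\star\|_{L^2_xH^1_y}.$$ (2) (Enhanced dissipation, $\nu>0$.) There exist $\varepsilon>0$ and $C>0$, depending on $u$ but not on $\nu$, $t$ or $f^{in}$, such that for every $\nu\in(0,1]$, every solution $f$ of $(\ast)$ and every $t\ge0$, $$\|f(t)\|_{L^2}\le C\,e^{-\varepsilon\,\nu^{\frac{\alpha}{\alpha+2}}\,t}\,\|f^{in}\|_{L^2}.$$
   Context: $\mathbb{T}=\mathbb{R}/2\pi\mathbb{Z}$, and $\mathbb{T}^2$ is the square torus with coordinates $(x,y)$. For $r,s\ge-1$, $H^r_xH^s_y$ is the Sobolev space on $\mathbb{T}^2$ with norm $\|\varphi\|_{H^r_xH^s_y}=\big(\sum_{(k,n)\in\mathbb{Z}^2}\langle k\rangle^{2r}\langle n\rangle^{2s}|\widehat\varphi(k,n)|^2\big)^{1/2}$, where $\langle k\rangle=(1+k^2)^{1/2}$ and $\widehat\varphi(k,n)$ are the Fourier coefficients; $L^2_x=H^0_x$. "Sharply $\alpha$-Hölder" means that, for $\beta\in(0,1)$, $u\in C^\beta(\mathbb{T})$ if and only if $\beta\le\alpha$ (the paper obtains this from the lower Hölder bound: there is $c_0>0$ with $\sup_I u-\inf_I u\ge c_0|I|^\alpha$ for every interval $I\subset\mathbb{T}$ with $0<|I|\le1$). In each estimate $f^{in}$ ranges over the data (with zero $x$-average for a.e. $y$) for which the norm on the right-hand side is finite. For $\nu=0$ the equation decouples into Fourier modes in $x$ and the solution is given by $f_k(t,y)=e^{-itku(y)}f^{in}_k(y)$,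 where $f_k$ is the $k$-th Fourier coefficient of $f$ in $x$. *)

theory Defs
  imports "HOL-Analysis.Analysis"
begin

text \<open>Functions on the torus \<open>\<real> / 2\<pi>\<int>\<close> are functions on \<open>\<real>\<close> or on \<open>\<real> \<times> \<real>\<close>. Where
  pointwise values matter (the velocity, test functions) they are required to be
  \<open>2\<pi>\<close>-periodic; where only almost-everywhere classes matter, only the values on the
  fundamental domain are used.\<close>

definition torus :: "real measure" where
  "torus = restrict_space lborel {0..<2 * pi}"

definition torus2 :: "(real \<times> real) measure" where
  "torus2 = torus \<Otimes>\<^sub>M torus"


subsection \<open>Hoelder continuous functions\<close>

text \<open>For a periodic function, the bound with \<open>\<bar>x - y\<bar>\<close> for all real \<open>x\<close>, \<open>y\<close> is the bound
  with the distance of the torus, since representatives of two points can be chosen that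
  realise this distance.\<close>

definition holder_torus :: "real \<Rightarrow> (real \<Rightarrow> real) \<Rightarrow> bool" where
  "holder_torus \<beta> u \<longleftrightarrow>
     (\<forall>y. u (y + 2 * pi) = u y) \<and>
     (\<exists>M. \<forall>x y. \<bar>u x - u y\<bar> \<le> M * \<bar>x - y\<bar> powr \<beta>)"

definition sharply_holder :: "real \<Rightarrow> (real \<Rightarrow> real) \<Rightarrow> bool" where
  "sharply_holder \<alpha> u \<longleftrightarrow> (\<forall>\<beta>\<in>{0<..<1}. holder_torus \<beta> u \<longleftrightarrow> \<beta> \<le> \<alpha>)"


subsection \<open>Anisotropic Sobolev spaces\<close>

text \<open>An element \<open>\<phi>\<close> of \<open>H\<^sup>r\<^sub>x H\<^sup>s\<^sub>y\<close> with \<open>r < 0\<close> need not be a function of \<open>(x, y)\<close>. It is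
  represented by the family of its Fourier coefficients in \<open>x\<close>: formally,
  \<open>\<phi>(x, y) = \<Sum>k. \<phi> k y * exp (\<i> k x)\<close>. If \<open>s \<ge> 0\<close>, then each \<open>\<phi> k\<close> is a
  square-integrable function of \<open>y\<close>, so that nothing is lost by requiring this. For \<open>s < 0\<close>
  the predicate below selects those elements whose coefficients are square-integrable in
  \<open>y\<close>; the norm with \<open>s = -1\<close> is only applied to inviscid solutions with data in
  \<open>H\<^sup>r\<^sub>x H\<^sup>1\<^sub>y\<close>, and these are of this kind.\<close>

type_synonym xmodes = "int \<Rightarrow> real \<Rightarrow> complex"

definition fourier_coeff :: "xmodes \<Rightarrow> int \<Rightarrow> int \<Rightarrow> complex" where
  "fourier_coeff \<phi> k n =
     (LINT y|torus. \<phi> k y * cis (- of_int n * y)) / of_real (2 * pi)"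

definition japanese_bracket :: "int \<Rightarrow> real" where
  "japanese_bracket k = sqrt (1 + (of_int k)\<^sup>2)"

definition sobolev_term :: "real \<Rightarrow> real \<Rightarrow> xmodes \<Rightarrow> int \<times> int \<Rightarrow> real" where
  "sobolev_term r s \<phi> = (\<lambda>(k, n).
     japanese_bracket k powr (2 * r) * japanese_bracket n powr (2 * s) *
     (cmod (fourier_coeff \<phi> k n))\<^sup>2)"

definition sobolev_space :: "real \<Rightarrow> real \<Rightarrow> xmodes set" where
  "sobolev_space r s = {\<phi>.
     (\<forall>k. \<phi> k \<in> borel_measurable torus \<and> integrable torus (\<lambda>y. (cmod (\<phi> k y))\<^sup>2)) \<and>
     sobolev_term r s \<phi> summable_on UNIV}"

definition sobolev_norm :: "real \<Rightarrow> real \<Rightarrow> xmodes \<Rightarrow> real" where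
  "sobolev_norm r s \<phi> = sqrt (infsum (sobolev_term r s \<phi>) UNIV)"

text \<open>The coefficient with index \<open>0\<close> is the \<open>x\<close>-average.\<close>

definition zero_xmean_modes :: "xmodes \<Rightarrow> bool" where
  "zero_xmean_modes \<phi> \<longleftrightarrow> (AE y in torus. \<phi> 0 y = 0)"

definition inviscid_solution :: "(real \<Rightarrow> real) \<Rightarrow> xmodes \<Rightarrow> real \<Rightarrow> xmodes" where
  "inviscid_solution u f_in t = (\<lambda>k y. cis (- t * of_int k * u y) * f_in k y)"


subsection \<open>The advection-diffusion equation\<close>

definition L2_torus2 :: "(real \<times> real \<Rightarrow> complex) set" where
  "L2_torus2 = {g. g \<in> borel_measurable torus2 \<and> integrable torus2 (\<lambda>z. (cmod (g z))\<^sup>2)}"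

definition L2_norm :: "(real \<times> real \<Rightarrow> complex) \<Rightarrow> real" where
  "L2_norm g = sqrt (LINT z|torus2. (cmod (g z))\<^sup>2)"

definition zero_xmean :: "(real \<times> real \<Rightarrow> complex) \<Rightarrow> bool" where
  "zero_xmean g \<longleftrightarrow> (AE y in torus. (LINT x|torus. g (x, y)) = 0)"

definition partial_x :: "(real \<times> real \<Rightarrow> complex) \<Rightarrow> real \<times> real \<Rightarrow> complex" where
  "partial_x \<phi> = (\<lambda>(x, y). vector_derivative (\<lambda>\<xi>. \<phi> (\<xi>, y)) (at x))"

definition partial_y :: "(real \<times> real \<Rightarrow> complex) \<Rightarrow> real \<times> real \<Rightarrow> complex" where
  "partial_y \<phi> = (\<lambda>(x, y). vector_derivative (\<lambda>\<eta>. \<phi> (x, \<eta>)) (at y))"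

definition laplacian :: "(real \<times> real \<Rightarrow> complex) \<Rightarrow> real \<times> real \<Rightarrow> complex" where
  "laplacian \<phi> = (\<lambda>z. partial_x (partial_x \<phi>) z + partial_y (partial_y \<phi>) z)"

text \<open>The smooth functions on the two-dimensional torus: the largest class of continuous
  periodic functions that have both partial derivatives everywhere and that is closed under
  taking them.\<close>

coinductive smooth_torus2 :: "(real \<times> real \<Rightarrow> complex) \<Rightarrow> bool" where
  "smooth_torus2 \<phi>"
  if "continuous_on UNIV \<phi>"
    and "\<And>x y. \<phi> (x + 2 * pi, y) = \<phi> (x, y)"
    and "\<And>x y. \<phi> (x, y + 2 * pi) = \<phi> (x, y)"
    and "\<And>x y. (\<lambda>\<xi>. \<phi> (\<xi>, y)) differentiable (at x)"
    and "\<And>x y. (\<lambda>\<eta>. \<phi> (x, \<eta>)) differentiable (at y)"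
    and "smooth_torus2 (partial_x \<phi>)"
    and "smooth_torus2 (partial_y \<phi>)"

text \<open>Weak solutions of \<open>\<partial>\<^sub>t f + u(y) \<partial>\<^sub>x f = \<nu> \<Delta> f\<close> in \<open>C([0,\<infinity>); L\<^sup>2)\<close>: the equation is
  multiplied by a smooth function of \<open>(x, y)\<close>, all \<open>x\<close>- and \<open>y\<close>-derivatives are moved to that
  function, and the result is integrated in time. For \<open>\<nu> > 0\<close> and bounded measurable \<open>u\<close>
  there is exactly one such solution for every datum in \<open>L\<^sup>2\<close>.\<close>

definition weak_solution ::
  "real \<Rightarrow> (real \<Rightarrow> real) \<Rightarrow> (real \<times> real \<Rightarrow> complex) \<Rightarrow> (real \<Rightarrow> real \<times> real \<Rightarrow> complex) \<Rightarrow> bool"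
where
  "weak_solution \<nu> u f_in f \<longleftrightarrow>
     (\<forall>t\<ge>0. f t \<in> L2_torus2) \<and>
     (\<forall>t\<ge>0. ((\<lambda>s. L2_norm (\<lambda>z. f s z - f t z)) \<longlongrightarrow> 0) (at t within {0..})) \<and>
     (AE z in torus2. f 0 z = f_in z) \<and>
     (\<forall>\<phi> t. smooth_torus2 \<phi> \<longrightarrow> 0 \<le> t \<longrightarrow>
        ((\<lambda>s. LINT z|torus2.
            f s z * (of_real (u (snd z)) * partial_x \<phi> z + of_real \<nu> * laplacian \<phi> z))
         has_integral
         ((LINT z|torus2. f t z * \<phi> z) - (LINT z|torus2. f_in z * \<phi> z))) {0..t})"

end

theory Submission
  imports Defs
begin

text \<open>The velocity is \<open>u y = E (y / pi)\<close>, where \<open>E\<close> is the even 2-periodic extension of a self-affine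
  function \<open>V\<close> from \<open>[0, 1]\<close> onto itself: on each of the \<open>b = q * r\<close> cells of length \<open>1 / b\<close>, \<open>V\<close> is a
  scaled, possibly reflected, copy of itself with values in one of the intervals
  \<open>[j / q, (j + 1) / q]\<close>, and each of these intervals is crossed \<open>r\<close> times, back and forth (\<open>r\<close> is
  odd). The Hoelder exponent \<open>\<alpha>\<close> is given by \<open>b powr \<alpha> = q\<close>; powers of 3 for \<open>q\<close> and \<open>r\<close> give all
  rational exponents.

  Mixing. On every cell of level \<open>m\<close> the values of \<open>V\<close> are uniformly distributed in an interval of
  length \<open>1 / q ^ m\<close>. Hence the integral of \<open>cis (l * V)\<close> over such a cell is explicit, of size
  \<open>(q / b) ^ m / \<bar>l\<bar>\<close>, and it vanishes if \<open>l\<close> is a nonzero integer multiple of \<open>2 * pi * q ^ m\<close>. Cutting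
  \<open>[0, y]\<close> into cells bounds the primitive of \<open>cis (l * u)\<close> by \<open>C / \<bar>l\<bar>\<close> in general and by
  \<open>C / b ^ m\<close> at the resonant values of \<open>l\<close>; duality and integration by parts turn this into bounds
  in \<open>H\<^sup>-\<^sup>1\<close>. The lower bound holds for the datum \<open>cis x\<close>, since its mean value in \<open>y\<close> is explicit.

  Dissipation. For the \<open>k\<close>-th mode \<open>g\<close> the functional
  \<open>\<parallel>g\<parallel>\<^sup>2 + \<gamma> sgn k Im (\<integral> w y * g (y + h) * cnj (g y))\<close> decays exponentially. Here \<open>w\<close> is supported on
  the first subcell of each cell of level \<open>m\<close>, and the shift by \<open>h\<close> leads to the last subcell, so that
  \<open>w y * (u (y + h) - u y)\<close> is a constant multiple of \<open>\<bar>w y\<bar>\<close>. The time derivative of the integral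
  therefore controls \<open>\<bar>k\<bar> q\<^sup>-\<^sup>m \<parallel>g\<parallel>\<^sup>2\<close> up to terms that the diffusion absorbs when the cells have width
  about \<open>\<nu> powr (1 / (\<alpha> + 2))\<close>. The computation is done for Fourier truncations of \<open>g\<close>; the
  truncation error of \<open>u * g\<close> tends to \<open>0\<close>.\<close>

subsection \<open>Square-integrable functions\<close>

text \<open>Folding separates roughness from distribution: \<open>u\<close> has increments
  \<open>1 / q ^ m\<close> at scale \<open>1 / b ^ m\<close>, yet its values are distributed like
  those of a linear function. Complete cells therefore average out only like
  \<open>1 / \<bar>l\<bar>\<close>, whatever the exponent. The roughness shows only where their
  contributions cancel: what is left is one partial cell of width \<open>1 / b ^ m\<close>, and
  since \<open>b powr alpha = q\<close> this is \<open>\<bar>l\<bar> powr (- (1 / alpha))\<close>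
  for \<open>\<bar>l\<bar>\<close> about \<open>q ^ m\<close>. For the dissipation, the usual
  hypocoercive functional pairs a mode with its y-derivative and needs the derivative of
  \<open>u\<close>, which does not exist. The finite shift inside a cell replaces it, at the price
  of fixing a scale \<open>\<delta>\<close>: transport separates the two subcells at a rate of order
  \<open>\<delta> powr alpha\<close>, diffusion erases structure of width \<open>\<delta>\<close> at
  rate \<open>\<nu> / \<delta>\<^sup>2\<close>, and equality of the two gives the exponent of the
  theorem. The sign in the weight compensates for descending cells. Truncation is forced because a
  weak solution comes without the derivatives that differentiating the functional requires.\<close>

definition L2 :: "'a measure \<Rightarrow> ('a \<Rightarrow> complex) set" where
  "L2 M = {g. g \<in> borel_measurable M \<and> integrable M (\<lambda>z. (cmod (g z))\<^sup>2)}"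

text \<open>Only a seminorm, since elements of \<open>L2\<close> are functions and not classes. The
  measure is a parameter because the same inequalities serve \<open>torus\<close> and
  \<open>torus2\<close>.\<close>

definition L2nrm :: "'a measure \<Rightarrow> ('a \<Rightarrow> complex) \<Rightarrow> real" where
  "L2nrm M g = sqrt (LINT z|M. (cmod (g z))\<^sup>2)"

lemma L2_integrable_square: "g \<in> L2 M \<Longrightarrow> integrable M (\<lambda>z. (cmod (g z))\<^sup>2)"
  by (simp add: L2_def)

lemma L2nrm_nonneg [simp]: "0 \<le> L2nrm M g"
  by (simp add: L2nrm_def)

lemma L2nrm_square: "(L2nrm M g)\<^sup>2 = (LINT z|M. (cmod (g z))\<^sup>2)"
  by (simp add: L2nrm_def)

lemma L2_integrable_mult_cmod:
  assumes "f \<in> L2 M" "g \<in> L2 M"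
  shows "integrable M (\<lambda>z. cmod (f z) * cmod (g z))"
proof (rule Bochner_Integration.integrable_bound)
  show "integrable M (\<lambda>z. (cmod (f z))\<^sup>2 + (cmod (g z))\<^sup>2)"
    using assms by (auto simp: L2_def)
  show "(\<lambda>z. cmod (f z) * cmod (g z)) \<in> borel_measurable M"
    using assms by (auto simp: L2_def)
  have "a * b \<le> a\<^sup>2 + b\<^sup>2" if "0 \<le> a" "0 \<le> b" for a b :: real
    using sum_squares_bound[of a b] mult_nonneg_nonneg[OF that] by linarith
  then show "AE z in M. norm (cmod (f z) * cmod (g z)) \<le> norm ((cmod (f z))\<^sup>2 + (cmod (g z))\<^sup>2)"
    by simp
qed

lemma L2_integrable_mult:
  assumes "f \<in> L2 M" "g \<in> L2 M"
  shows "integrable M (\<lambda>z. f z * g z)"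
  by (rule Bochner_Integration.integrable_bound[OF L2_integrable_mult_cmod[OF assms]])
    (use assms in \<open>auto simp: L2_def norm_mult\<close>)

lemma L2_bounded_mult:
  assumes "f \<in> L2 M" "w \<in> borel_measurable M" "\<And>z. cmod (w z) \<le> B"
  shows "(\<lambda>z. w z * f z) \<in> L2 M"
proof -
  have "integrable M (\<lambda>z. (cmod (w z * f z))\<^sup>2)"
  proof (rule Bochner_Integration.integrable_bound)
    show "integrable M (\<lambda>z. B\<^sup>2 * (cmod (f z))\<^sup>2)"
      using assms by (auto simp: L2_def)
    show "(\<lambda>z. (cmod (w z * f z))\<^sup>2) \<in> borel_measurable M"
      using assms by (auto simp: L2_def)
    show "AE z in M. norm ((cmod (w z * f z))\<^sup>2) \<le> norm (B\<^sup>2 * (cmod (f z))\<^sup>2)"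
      using assms(3) by (auto simp: norm_mult power_mult_distrib intro!: mult_right_mono power_mono)
  qed
  then show ?thesis using assms by (auto simp: L2_def)
qed

lemma L2_add:
  assumes "f \<in> L2 M" "g \<in> L2 M"
  shows "(\<lambda>z. f z + g z) \<in> L2 M"
proof -
  have "integrable M (\<lambda>z. (cmod (f z + g z))\<^sup>2)"
  proof (rule Bochner_Integration.integrable_bound)
    show "integrable M (\<lambda>z. 2 * ((cmod (f z))\<^sup>2 + (cmod (g z))\<^sup>2))"
      using assms by (auto simp: L2_def)
    show "(\<lambda>z. (cmod (f z + g z))\<^sup>2) \<in> borel_measurable M"
      using assms by (auto simp: L2_def)
    have "(cmod (a + b))\<^sup>2 \<le> 2 * ((cmod a)\<^sup>2 + (cmod b)\<^sup>2)" for a b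
    proof -
      have "(cmod (a + b))\<^sup>2 \<le> (cmod a + cmod b)\<^sup>2"
        by (intro power_mono norm_triangle_ineq) auto
      then show ?thesis using sum_squares_bound[of "cmod a" "cmod b"] by (simp add: power2_sum)
    qed
    then show "AE z in M. norm ((cmod (f z + g z))\<^sup>2) \<le> norm (2 * ((cmod (f z))\<^sup>2 + (cmod (g z))\<^sup>2))"
      by simp
  qed
  then show ?thesis using assms by (auto simp: L2_def)
qed

lemma L2_cmult: "f \<in> L2 M \<Longrightarrow> (\<lambda>z. c * f z) \<in> L2 M"
  by (rule L2_bounded_mult[where B = "cmod c"]) auto

lemma L2_diff:
  assumes "f \<in> L2 M" "g \<in> L2 M"
  shows "(\<lambda>z. f z - g z) \<in> L2 M"
  using L2_add[OF assms(1) L2_cmult[OF assms(2), of "-1"]] by simp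

lemma L2_zero: "(\<lambda>z. 0) \<in> L2 M"
  by (simp add: L2_def)

lemma L2_sum:
  assumes "\<And>i. i \<in> I \<Longrightarrow> f i \<in> L2 M"
  shows "(\<lambda>z. \<Sum>i\<in>I. f i z) \<in> L2 M"
  using assms by (induction I rule: infinite_finite_induct) (auto intro: L2_zero L2_add)

text \<open>Discriminant argument: the integral of the square of
  \<open>s * cmod (f z) - cmod (g z)\<close> is a nonnegative quadratic in \<open>s\<close>.\<close>

lemma L2_Cauchy_Schwarz_cmod:
  assumes f: "f \<in> L2 M" and g: "g \<in> L2 M"
  shows "(LINT z|M. cmod (f z) * cmod (g z)) \<le> L2nrm M f * L2nrm M g"
proof -
  define A B X where "A = (LINT z|M. (cmod (f z))\<^sup>2)" and "B = (LINT z|M. (cmod (g z))\<^sup>2)"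
    and "X = (LINT z|M. cmod (f z) * cmod (g z))"
  have nn: "0 \<le> s\<^sup>2 * A - 2 * s * X + B" for s
  proof -
    have "0 \<le> (LINT z|M. (s * cmod (f z) - cmod (g z))\<^sup>2)"
      by (rule integral_nonneg_AE) auto
    also have "\<dots> = (LINT z|M. s\<^sup>2 * (cmod (f z))\<^sup>2 - 2 * s * (cmod (f z) * cmod (g z)) + (cmod (g z))\<^sup>2)"
      by (intro Bochner_Integration.integral_cong) (auto simp: power2_eq_square algebra_simps)
    also have "\<dots> = s\<^sup>2 * A - 2 * s * X + B"
      unfolding A_def B_def X_def
      using L2_integrable_mult_cmod[OF f g] L2_integrable_square[OF f] L2_integrable_square[OF g]
      by simp
    finally show ?thesis .
  qed
  have "0 \<le> A" "0 \<le> B" "0 \<le> X" unfolding A_def B_def X_def by auto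
  have "X\<^sup>2 \<le> A * B"
  proof (cases "A = 0")
    case True
    have "X = 0"
    proof (rule ccontr)
      assume "X \<noteq> 0"
      \<comment> \<open>For \<open>A = 0\<close> the polynomial in \<open>s\<close> is linear and
        takes the value -1 at this \<open>s\<close>.\<close>
      then show False using nn[of "(B + 1) / (2 * X)"] True by simp
    qed
    then show ?thesis using True by simp
  next
    case False
    with \<open>0 \<le> A\<close> have "0 < A" by simp
    \<comment> \<open>The minimiser of the quadratic.\<close>
    with nn[of "X / A"] have "0 \<le> B - X\<^sup>2 / A"
      by (simp add: power2_eq_square)
    then show ?thesis using \<open>0 < A\<close> by (simp add: field_simps)
  qed
  then have "sqrt (X\<^sup>2) \<le> sqrt (A * B)" by (rule real_sqrt_le_mono)
  then show ?thesis using \<open>0 \<le> X\<close> by (simp add: real_sqrt_mult L2nrm_def A_def B_def X_def)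
qed

lemma L2_Cauchy_Schwarz:
  assumes "f \<in> L2 M" "g \<in> L2 M"
  shows "cmod (LINT z|M. f z * g z) \<le> L2nrm M f * L2nrm M g"
proof -
  have "cmod (LINT z|M. f z * g z) \<le> (LINT z|M. cmod (f z * g z))" by (rule integral_norm_bound)
  then show ?thesis using L2_Cauchy_Schwarz_cmod[OF assms] by (simp add: norm_mult)
qed

lemma L2nrm_mono:
  assumes "f \<in> L2 M" "g \<in> L2 M" "\<And>z. cmod (f z) \<le> cmod (g z)"
  shows "L2nrm M f \<le> L2nrm M g"
  unfolding L2nrm_def using assms
  by (intro real_sqrt_le_mono integral_mono) (auto simp: L2_def intro: power_mono)

lemma L2nrm_cmult: "L2nrm M (\<lambda>z. c * f z) = cmod c * L2nrm M f"
  by (simp add: L2nrm_def norm_mult power_mult_distrib real_sqrt_mult)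

lemma L2nrm_triangle:
  assumes f: "f \<in> L2 M" and g: "g \<in> L2 M"
  shows "L2nrm M (\<lambda>z. f z + g z) \<le> L2nrm M f + L2nrm M g"
proof -
  have "(L2nrm M (\<lambda>z. f z + g z))\<^sup>2 \<le> (LINT z|M. (cmod (f z))\<^sup>2 + 2 * (cmod (f z) * cmod (g z)) + (cmod (g z))\<^sup>2)"
    unfolding L2nrm_square
  proof (rule integral_mono)
    show "integrable M (\<lambda>z. (cmod (f z + g z))\<^sup>2)"
      by (rule L2_integrable_square[OF L2_add[OF f g]])
    show "integrable M (\<lambda>z. (cmod (f z))\<^sup>2 + 2 * (cmod (f z) * cmod (g z)) + (cmod (g z))\<^sup>2)"
      using L2_integrable_mult_cmod[OF f g] L2_integrable_square[OF f] L2_integrable_square[OF g] by simp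
    fix z
    have "(cmod (f z + g z))\<^sup>2 \<le> (cmod (f z) + cmod (g z))\<^sup>2"
      by (intro power_mono norm_triangle_ineq) auto
    then show "(cmod (f z + g z))\<^sup>2 \<le> (cmod (f z))\<^sup>2 + 2 * (cmod (f z) * cmod (g z)) + (cmod (g z))\<^sup>2"
      by (simp add: power2_sum algebra_simps)
  qed
  also have "\<dots> = (L2nrm M f)\<^sup>2 + 2 * (LINT z|M. cmod (f z) * cmod (g z)) + (L2nrm M g)\<^sup>2"
    unfolding L2nrm_square
    using L2_integrable_mult_cmod[OF f g] L2_integrable_square[OF f] L2_integrable_square[OF g]
    by simp
  also have "\<dots> \<le> (L2nrm M f + L2nrm M g)\<^sup>2"
    using L2_Cauchy_Schwarz_cmod[OF f g] by (simp add: power2_sum)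
  finally show ?thesis by (rule power2_le_imp_le) simp
qed

lemma L2nrm_triangle_diff:
  assumes "f \<in> L2 M" "g \<in> L2 M"
  shows "L2nrm M (\<lambda>z. f z - g z) \<le> L2nrm M f + L2nrm M g"
  using L2nrm_triangle[OF assms(1) L2_cmult[OF assms(2), of "-1"]] L2nrm_cmult[of M "-1" g] by simp

lemma (in finite_measure) bounded_L2:
  assumes "f \<in> borel_measurable M" "\<And>z. z \<in> space M \<Longrightarrow> cmod (f z) \<le> B"
  shows "f \<in> L2 M"
proof -
  have "integrable M (\<lambda>z. (cmod (f z))\<^sup>2)"
    by (rule integrable_const_bound[where B = "B\<^sup>2"]) (use assms in \<open>auto intro!: AE_I2 power_mono\<close>)
  then show ?thesis using assms by (simp add: L2_def)
qed

lemma (in finite_measure) L2_integrable: "f \<in> L2 M \<Longrightarrow> integrable M f"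
  using L2_integrable_mult[of f M "\<lambda>_. 1"] bounded_L2[of "\<lambda>_. 1" 1] by simp

subsection \<open>Fourier series on the torus\<close>

lemma space_torus [simp]: "space torus = {0..<2 * pi}"
  by (simp add: torus_def space_restrict_space)

lemma sets_torus: "sets torus = (\<inter>) {0..<2 * pi} ` sets borel"
  by (simp add: torus_def sets_restrict_space)

lemma measurable_torus: "f \<in> borel_measurable borel \<Longrightarrow> f \<in> borel_measurable torus"
  unfolding torus_def by (intro measurable_restrict_space1) simp

lemma continuous_measurable_torus:
  fixes f :: "real \<Rightarrow> 'a::real_normed_vector"
  shows "continuous_on UNIV f \<Longrightarrow> f \<in> borel_measurable torus"
  by (intro measurable_torus borel_measurable_continuous_onI)

lemma finite_measure_torus: "finite_measure torus"
proof
  show "emeasure torus (space torus) \<noteq> \<infinity>"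
    unfolding torus_def by (subst emeasure_restrict_space) (auto simp: space_restrict_space)
qed

interpretation torus: finite_measure torus
  by (rule finite_measure_torus)

text \<open>Links the two integrals in use: \<open>torus\<close> carries the Lebesgue integral,
  while the fundamental theorem of calculus is applied to the gauge integral. The half-open period
  lacks only a null set, its end point.\<close>

lemma torus_integral_eq:
  fixes f :: "real \<Rightarrow> 'a::euclidean_space"
  assumes "continuous_on {0..2 * pi} f"
  shows "(LINT y|torus. f y) = integral {0..2 * pi} f"
proof -
  have "(LINT y|torus. f y) = (LINT y:{0..<2 * pi}|lborel. f y)"
    unfolding torus_def by (subst integral_restrict_space) (auto simp: set_lebesgue_integral_def)
  also have "\<dots> = (LINT y:{0..2 * pi}|lborel. f y)"
  proof (rule set_integral_cong_set)
    have i: "set_integrable lborel {0..2 * pi} f"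
      using assms by (rule borel_integrable_atLeastAtMost')
    then have "set_integrable lborel {0..<2 * pi} f"
      by (rule set_integrable_subset) auto
    with i show "set_borel_measurable lborel {0..<2 * pi} f" "set_borel_measurable lborel {0..2 * pi} f"
      by (auto simp: set_borel_measurable_def set_integrable_def)
    have "AE x in lborel. x \<noteq> 2 * pi" by (rule AE_lborel_singleton)
    then show "AE x in lborel. (x \<in> {0..2 * pi}) = (x \<in> {0..<2 * pi})"
      by eventually_elim auto
  qed
  also have "\<dots> = integral {0..2 * pi} f"
    using assms by (intro set_borel_integral_eq_integral borel_integrable_atLeastAtMost')
  finally show ?thesis .
qed

lemma continuous_on_cis_mult [continuous_intros]:
  "continuous_on A f \<Longrightarrow> continuous_on A (\<lambda>y. cis (f y))"
  by (simp add: cis_conv_exp continuous_intros)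

lemma measurable_cis [measurable]: "cis \<in> borel_measurable borel"
  by (intro borel_measurable_continuous_onI continuous_intros)

lemma L2_cnj:
  assumes "f \<in> L2 M"
  shows "(\<lambda>z. cnj (f z)) \<in> L2 M"
proof -
  have "cnj \<in> borel_measurable borel"
    by (intro borel_measurable_continuous_onI continuous_intros)
  with assms show ?thesis by (auto simp: L2_def)
qed

definition fc :: "(real \<Rightarrow> complex) \<Rightarrow> int \<Rightarrow> complex" where
  "fc g n = (LINT y|torus. g y * cis (- of_int n * y)) / of_real (2 * pi)"

text \<open>A trigonometric polynomial with coefficients given on all integers, so that
  \<open>tp N (fc g)\<close> is a partial Fourier sum and \<open>N\<close> can vary for fixed
  \<open>c\<close>.\<close>

definition tp :: "nat \<Rightarrow> (int \<Rightarrow> complex) \<Rightarrow> real \<Rightarrow> complex" where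
  "tp N c y = (\<Sum>n\<in>{- int N..int N}. c n * cis (of_int n * y))"

lemma continuous_on_tp [continuous_intros]: "continuous_on A (tp N c)"
  unfolding tp_def by (intro continuous_intros)

lemma cis_int_2pi: "cis (of_int n * (y + 2 * pi)) = cis (of_int n * y)"
proof -
  have "cis (of_int n * (y + 2 * pi)) = cis (of_int n * y) * cis (of_int n * (2 * pi))"
    by (simp add: cis_mult algebra_simps)
  also have "cis (of_int n * (2 * pi)) = 1"
    using cis_multiple_2pi[of "of_int n"] by (simp add: mult_ac)
  finally show ?thesis by simp
qed

lemma tp_periodic: "tp N c (y + 2 * pi) = tp N c y"
  unfolding tp_def by (simp only: cis_int_2pi)

lemma cis_L2: "(\<lambda>y. cis (of_int n * y)) \<in> L2 torus"
  by (rule torus.bounded_L2[where B = 1])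
    (auto intro!: continuous_measurable_torus continuous_intros)

lemma tp_L2: "tp N c \<in> L2 torus"
  unfolding tp_def[abs_def] by (intro L2_sum L2_cmult cis_L2)

lemma has_vector_derivative_cis_mult:
  "((\<lambda>y. cis (a * y)) has_vector_derivative \<i> * of_real a * cis (a * y)) (at y within A)"
proof -
  have "((\<lambda>z. exp (\<i> * of_real a * z)) has_field_derivative \<i> * of_real a * exp (\<i> * of_real a * of_real y))
      (at (of_real y))"
    by (auto intro!: derivative_eq_intros)
  from has_vector_derivative_real_field[OF this] show ?thesis
    by (simp add: cis_conv_exp mult_ac)
qed

lemma cis_integral_torus: "(LINT y|torus. cis (of_int n * y)) = (if n = 0 then of_real (2 * pi) else 0)"
proof (cases "n = 0")
  case True
  have "(LINT y|torus. cis (of_int n * y)) = integral {0..2 * pi} (\<lambda>y. 1)"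
    using True by (subst torus_integral_eq) (auto intro!: continuous_intros)
  then show ?thesis using True by (simp add: scaleR_conv_of_real)
next
  case False
  let ?F = "\<lambda>y. cis (of_int n * y) / (\<i> * of_int n)"
  have "((\<lambda>y. cis (of_int n * y)) has_integral ?F (2 * pi) - ?F 0) {0..2 * pi}"
  proof (rule fundamental_theorem_of_calculus)
    fix y :: real
    show "(?F has_vector_derivative cis (of_int n * y)) (at y within {0..2 * pi})"
      using has_vector_derivative_divide[OF has_vector_derivative_cis_mult[of "of_int n" y "{0..2 * pi}"], of "\<i> * of_int n"] False
      by simp
  qed auto
  moreover have "?F (2 * pi) - ?F 0 = 0"
    using cis_int_2pi[of n 0] by simp
  ultimately have "integral {0..2 * pi} (\<lambda>y. cis (of_int n * y)) = 0"
    by (simp add: integral_unique)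
  then show ?thesis using False
    by (subst torus_integral_eq) (auto intro!: continuous_intros)
qed

lemma L2_fc_integrable: "g \<in> L2 torus \<Longrightarrow> integrable torus (\<lambda>y. g y * cis (- of_int n * y))"
  using L2_integrable_mult[OF _ cis_L2[of "-n"]] by simp

lemma L2_mult_cnj_tp:
  assumes "g \<in> L2 torus"
  shows "(LINT y|torus. g y * cnj (tp N c y)) = of_real (2 * pi) * (\<Sum>n\<in>{-int N..int N}. fc g n * cnj (c n))"
proof -
  have "(LINT y|torus. g y * cnj (tp N c y)) =
      (LINT y|torus. (\<Sum>n\<in>{-int N..int N}. cnj (c n) * (g y * cis (- of_int n * y))))"
    by (intro Bochner_Integration.integral_cong) (auto simp: tp_def cis_cnj sum_distrib_left mult_ac)
  also have "\<dots> = (\<Sum>n\<in>{-int N..int N}. cnj (c n) * (LINT y|torus. g y * cis (- of_int n * y)))"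
    using L2_fc_integrable[OF assms] by (subst Bochner_Integration.integral_sum) simp_all
  also have "\<dots> = of_real (2 * pi) * (\<Sum>n\<in>{-int N..int N}. fc g n * cnj (c n))"
    unfolding sum_distrib_left by (intro sum.cong) (auto simp: fc_def)
  finally show ?thesis .
qed

lemma fc_tp: "fc (tp N c) n = (if n \<in> {-int N..int N} then c n else 0)"
proof -
  have "(LINT y|torus. tp N c y * cis (- of_int n * y)) =
      (LINT y|torus. (\<Sum>m\<in>{-int N..int N}. c m * cis (of_int (m - n) * y)))"
    by (intro Bochner_Integration.integral_cong)
      (auto simp: tp_def cis_mult sum_distrib_right left_diff_distrib mult.assoc intro!: sum.cong)
  also have "\<dots> = (\<Sum>m\<in>{-int N..int N}. c m * (LINT y|torus. cis (of_int (m - n) * y)))"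
    using torus.L2_integrable[OF cis_L2] by (subst Bochner_Integration.integral_sum) (simp_all del: of_int_diff)
  also have "\<dots> = (\<Sum>m\<in>{-int N..int N}. if m = n then c m * of_real (2 * pi) else 0)"
    unfolding cis_integral_torus by (intro sum.cong) auto
  finally show ?thesis by (simp add: fc_def)
qed

lemma L2nrm_complex_square: "of_real ((L2nrm M g)\<^sup>2) = (LINT z|M. g z * cnj (g z))"
  unfolding L2nrm_square integral_complex_of_real[symmetric]
  by (simp add: complex_norm_square del: of_real_power)

lemma L2nrm_tp: "(L2nrm torus (tp N c))\<^sup>2 = 2 * pi * (\<Sum>n\<in>{-int N..int N}. (cmod (c n))\<^sup>2)"
proof -
  have "complex_of_real ((L2nrm torus (tp N c))\<^sup>2) = of_real (2 * pi * (\<Sum>n\<in>{-int N..int N}. (cmod (c n))\<^sup>2))"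
    unfolding L2nrm_complex_square L2_mult_cnj_tp[OF tp_L2] fc_tp of_real_mult of_real_sum
    by (intro arg_cong2[where f = "(*)"] sum.cong refl) (auto simp: complex_norm_square[symmetric])
  then show ?thesis by (simp only: of_real_eq_iff)
qed

text \<open>Completing the square. Only the last sum depends on \<open>c\<close>, and it vanishes
  for \<open>c = fc g\<close>: partial Fourier sums are best approximations, and Bessel's inequality
  and Parseval's identity follow.\<close>

lemma L2nrm_diff_tp:
  assumes "g \<in> L2 torus"
  shows "(L2nrm torus (\<lambda>y. g y - tp N c y))\<^sup>2 =
    (L2nrm torus g)\<^sup>2 - 2 * pi * (\<Sum>n\<in>{-int N..int N}. (cmod (fc g n))\<^sup>2)
      + 2 * pi * (\<Sum>n\<in>{-int N..int N}. (cmod (fc g n - c n))\<^sup>2)"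
proof -
  have i: "integrable torus (\<lambda>y. g y * cnj (g y))" "integrable torus (\<lambda>y. g y * cnj (tp N c y))"
     "integrable torus (\<lambda>y. cnj (g y) * tp N c y)" "integrable torus (\<lambda>y. tp N c y * cnj (tp N c y))"
    using L2_integrable_mult[OF assms, of "\<lambda>y. cnj (g y)"] L2_integrable_mult[OF assms, of "\<lambda>y. cnj (tp N c y)"]
      L2_integrable_mult[OF tp_L2, of "\<lambda>y. cnj (tp N c y)"] L2_integrable_mult[OF tp_L2, of "\<lambda>y. cnj (g y)"] L2_cnj[OF assms] L2_cnj[OF tp_L2[of N c]]
    by (simp_all add: mult.commute)
  have "complex_of_real ((L2nrm torus (\<lambda>y. g y - tp N c y))\<^sup>2) =
     (LINT y|torus. g y * cnj (g y) - g y * cnj (tp N c y) - cnj (g y) * tp N c y + tp N c y * cnj (tp N c y))"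
    unfolding L2nrm_complex_square by (intro Bochner_Integration.integral_cong) (auto simp: algebra_simps)
  also have "\<dots> = (LINT y|torus. g y * cnj (g y)) - (LINT y|torus. g y * cnj (tp N c y))
      - (LINT y|torus. cnj (g y) * tp N c y) + (LINT y|torus. tp N c y * cnj (tp N c y))"
    using i by simp
  also have "(LINT y|torus. cnj (g y) * tp N c y) = cnj (LINT y|torus. g y * cnj (tp N c y))"
    by (subst Bochner_Integration.integral_cnj[symmetric]) simp
  also have "(LINT y|torus. g y * cnj (g y)) - (LINT y|torus. g y * cnj (tp N c y))
      - cnj (LINT y|torus. g y * cnj (tp N c y)) + (LINT y|torus. tp N c y * cnj (tp N c y)) =
      of_real ((L2nrm torus g)\<^sup>2) - of_real (2 * pi) * (\<Sum>n\<in>{-int N..int N}. fc g n * cnj (c n) + cnj (fc g n) * c n - c n * cnj (c n))"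
    unfolding L2nrm_complex_square L2_mult_cnj_tp[OF assms] L2_mult_cnj_tp[OF tp_L2] fc_tp
    by (simp add: sum.distrib sum_subtractf algebra_simps)
  also have "(\<Sum>n\<in>{-int N..int N}. fc g n * cnj (c n) + cnj (fc g n) * c n - c n * cnj (c n)) =
     (\<Sum>n\<in>{-int N..int N}. of_real ((cmod (fc g n))\<^sup>2) - of_real ((cmod (fc g n - c n))\<^sup>2))"
    by (intro sum.cong refl) (simp only: complex_norm_square, simp add: algebra_simps)
  also have "of_real ((L2nrm torus g)\<^sup>2) - of_real (2 * pi) * \<dots> =
     complex_of_real ((L2nrm torus g)\<^sup>2 - 2 * pi * (\<Sum>n\<in>{-int N..int N}. (cmod (fc g n))\<^sup>2)
      + 2 * pi * (\<Sum>n\<in>{-int N..int N}. (cmod (fc g n - c n))\<^sup>2))"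
    by (simp add: sum_subtractf algebra_simps)
  finally show ?thesis by (simp only: of_real_eq_iff)
qed

lemma Bessel:
  assumes "g \<in> L2 torus"
  shows "2 * pi * (\<Sum>n\<in>{-int N..int N}. (cmod (fc g n))\<^sup>2) \<le> (L2nrm torus g)\<^sup>2"
  using L2nrm_diff_tp[OF assms, of N "fc g"] zero_le_power2[of "L2nrm torus (\<lambda>y. g y - tp N (fc g) y)"] by simp

section \<open>Completeness of the trigonometric system in L2\<close>

definition trig :: "(real \<Rightarrow> complex) set" where
  "trig = {g. \<exists>N c. g = tp N c}"

lemma tp_pad:
  assumes "N \<le> M"
  shows "tp N c = tp M (\<lambda>n. if n \<in> {-int N..int N} then c n else 0)"
  unfolding tp_def using assms by (intro ext sum.mono_neutral_cong_left) auto

lemma trig_cmult: "g \<in> trig \<Longrightarrow> (\<lambda>y. a * g y) \<in> trig"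
proof -
  have "(\<lambda>y. a * tp N c y) = tp N (\<lambda>n. a * c n)" for N c
    by (auto simp: tp_def sum_distrib_left mult.assoc)
  then show "g \<in> trig \<Longrightarrow> (\<lambda>y. a * g y) \<in> trig" unfolding trig_def by blast
qed

lemma trig_add:
  assumes "f \<in> trig" "g \<in> trig"
  shows "(\<lambda>y. f y + g y) \<in> trig"
proof -
  have add: "(\<lambda>y. tp N c y + tp N d y) = tp N (\<lambda>n. c n + d n)" for N c d
    by (auto simp: tp_def sum.distrib distrib_right)
  obtain N c M d where fg: "f = tp N c" "g = tp M d" using assms unfolding trig_def by blast
  have "(\<lambda>y. f y + g y) = tp (max N M) (\<lambda>n. (if n \<in> {-int N..int N} then c n else 0) +
      (if n \<in> {-int M..int M} then d n else 0))"
    unfolding fg add[symmetric] using tp_pad[of N "max N M" c] tp_pad[of M "max N M" d] by simp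
  then show ?thesis unfolding trig_def by blast
qed

lemma trig_cis: "(\<lambda>y. cis (of_int n * y)) \<in> trig"
proof -
  have "(\<lambda>y. cis (of_int n * y)) = tp (nat \<bar>n\<bar>) (\<lambda>m. if m = n then 1 else 0)"
  proof
    fix y
    have "tp (nat \<bar>n\<bar>) (\<lambda>m. if m = n then 1 else 0) y = (\<Sum>m\<in>{-int (nat \<bar>n\<bar>)..int (nat \<bar>n\<bar>)}. if m = n then cis (of_int m * y) else 0)"
      unfolding tp_def by (intro sum.cong) auto
    then show "cis (of_int n * y) = tp (nat \<bar>n\<bar>) (\<lambda>m. if m = n then 1 else 0) y"
      by (subst (asm) sum.delta) (auto split: if_splits)
  qed
  then show ?thesis unfolding trig_def by blast
qed

lemma trig_zero: "(\<lambda>y. 0) \<in> trig"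
  using trig_cmult[OF trig_cis, of 0 0] by simp

lemma trig_const: "(\<lambda>y. a) \<in> trig"
  using trig_cmult[OF trig_cis, of a 0] by simp

lemma trig_sum: "(\<And>i. i \<in> I \<Longrightarrow> f i \<in> trig) \<Longrightarrow> (\<lambda>y. \<Sum>i\<in>I. f i y) \<in> trig"
  by (induction I rule: infinite_finite_induct) (auto intro: trig_zero trig_add)

lemma trig_mult:
  assumes "f \<in> trig" "g \<in> trig"
  shows "(\<lambda>y. f y * g y) \<in> trig"
proof -
  obtain N c M d where "f = tp N c" "g = tp M d" using assms unfolding trig_def by blast
  then have "(\<lambda>y. f y * g y) =
      (\<lambda>y. \<Sum>n\<in>{-int N..int N}. \<Sum>m\<in>{-int M..int M}. (c n * d m) * cis (of_int (n + m) * y))"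
    by (auto simp: tp_def sum_product cis_mult algebra_simps intro!: sum.cong ext)
  then show ?thesis by (simp only:) (intro trig_sum trig_cmult trig_cis)
qed

lemma trig_L2: "g \<in> trig \<Longrightarrow> g \<in> L2 torus"
  unfolding trig_def using tp_L2 by blast

text \<open>Turns the polynomials that Stone-Weierstrass yields on the circle into trigonometric
  polynomials.\<close>

lemma trig_polynomial:
  fixes p :: "complex \<Rightarrow> real"
  assumes "real_polynomial_function p"
  shows "(\<lambda>y. complex_of_real (p (cis y))) \<in> trig"
  using assms
proof induction
  \<comment> \<open>A linear functional is determined by its values at 1 and \<open>\<i>\<close>;
    Euler's formulas for cosine and sine then give two exponentials.\<close>
  case (linear h)
  then interpret bounded_linear h .
  have h: "h (cis y) = cos y * h 1 + sin y * h \<i>" for y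
  proof -
    have "cis y = cos y *\<^sub>R 1 + sin y *\<^sub>R \<i>" by (simp add: complex_eq_iff)
    then show ?thesis by (metis add scaleR real_scaleR_def)
  qed
  have "complex_of_real (h (cis y)) = (of_real (h 1) / 2 + of_real (h \<i>) / (2 * \<i>)) * cis (of_int 1 * y)
     + (of_real (h 1) / 2 - of_real (h \<i>) / (2 * \<i>)) * cis (of_int (-1) * y)" for y
    unfolding h by (simp add: complex_eq_iff Re_divide Im_divide field_simps)
  then show ?case by (simp only:) (intro trig_add trig_cmult trig_cis)
qed (auto intro: trig_const trig_add trig_mult)

text \<open>The closure of the trigonometric polynomials in L2. It is shown to be everything by
  enlarging the class of known members: continuous functions on the circle, indicators of closed
  sets, of half-lines, of Borel sets, and finally all of L2.\<close>

definition approx :: "(real \<Rightarrow> complex) set" where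
  "approx = {g \<in> L2 torus. \<forall>e>0. \<exists>p\<in>trig. L2nrm torus (\<lambda>y. g y - p y) < e}"

lemma approx_L2: "g \<in> approx \<Longrightarrow> g \<in> L2 torus"
  by (simp add: approx_def)

lemma approxE:
  assumes "g \<in> approx" "e > 0"
  obtains p where "p \<in> trig" "L2nrm torus (\<lambda>y. g y - p y) < e"
  using assms unfolding approx_def by blast

lemma trig_approx: "g \<in> trig \<Longrightarrow> g \<in> approx"
  unfolding approx_def using trig_L2 by (force simp: L2nrm_def)

lemma approx_lim:
  assumes "g \<in> L2 torus" "\<And>e. e > 0 \<Longrightarrow> \<exists>h\<in>approx. L2nrm torus (\<lambda>y. g y - h y) < e"
  shows "g \<in> approx"
proof -
  have "\<exists>p\<in>trig. L2nrm torus (\<lambda>y. g y - p y) < e" if "e > 0" for e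
  proof -
    obtain h where h: "h \<in> approx" "L2nrm torus (\<lambda>y. g y - h y) < e / 2"
      using assms(2)[of "e / 2"] \<open>e > 0\<close> by auto
    then obtain p where p: "p \<in> trig" "L2nrm torus (\<lambda>y. h y - p y) < e / 2"
      using approxE[of h "e / 2"] \<open>e > 0\<close> by auto
    have "L2nrm torus (\<lambda>y. (g y - h y) + (h y - p y)) \<le> L2nrm torus (\<lambda>y. g y - h y) + L2nrm torus (\<lambda>y. h y - p y)"
      using assms(1) h p by (intro L2nrm_triangle L2_diff) (auto intro: approx_L2 trig_L2)
    with h p show ?thesis by (intro bexI[of _ p]) auto
  qed
  then show ?thesis using assms(1) by (simp add: approx_def)
qed

lemma approx_add:
  assumes "f \<in> approx" "g \<in> approx"
  shows "(\<lambda>y. f y + g y) \<in> approx"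
proof -
  have "\<exists>p\<in>trig. L2nrm torus (\<lambda>y. f y + g y - p y) < e" if "e > 0" for e
  proof -
    obtain p where p: "p \<in> trig" "L2nrm torus (\<lambda>y. f y - p y) < e / 2"
      by (rule approxE[OF assms(1), of "e / 2"]) (use \<open>e > 0\<close> in simp)
    obtain q where q: "q \<in> trig" "L2nrm torus (\<lambda>y. g y - q y) < e / 2"
      by (rule approxE[OF assms(2), of "e / 2"]) (use \<open>e > 0\<close> in simp)
    have "L2nrm torus (\<lambda>y. (f y - p y) + (g y - q y)) \<le> L2nrm torus (\<lambda>y. f y - p y) + L2nrm torus (\<lambda>y. g y - q y)"
      using assms p q by (intro L2nrm_triangle L2_diff) (auto intro: approx_L2 trig_L2)
    with p q show ?thesis
      by (intro bexI[of _ "\<lambda>y. p y + q y"]) (auto intro: trig_add simp: algebra_simps)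
  qed
  then show ?thesis using assms by (simp add: approx_def L2_add)
qed

lemma approx_cmult:
  assumes "f \<in> approx"
  shows "(\<lambda>y. a * f y) \<in> approx"
proof -
  have "\<exists>p\<in>trig. L2nrm torus (\<lambda>y. a * f y - p y) < e" if "e > 0" for e
  proof -
    have "e / (cmod a + 1) > 0" using \<open>e > 0\<close> by (simp add: add_nonneg_pos)
    then obtain p where p: "p \<in> trig" "L2nrm torus (\<lambda>y. f y - p y) < e / (cmod a + 1)"
      using assms unfolding approx_def by blast
    have "L2nrm torus (\<lambda>y. a * f y - a * p y) = cmod a * L2nrm torus (\<lambda>y. f y - p y)"
      unfolding L2nrm_cmult[symmetric] by (simp add: right_diff_distrib)
    also have "\<dots> \<le> cmod a * (e / (cmod a + 1))" using p by (intro mult_left_mono) auto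
    also have "\<dots> = e * (cmod a / (cmod a + 1))" by simp
    also have "\<dots> < e * 1" using \<open>e > 0\<close> by (intro mult_strict_left_mono) (auto simp: add_nonneg_pos)
    also have "e * 1 = e" by simp
    finally show ?thesis using p by (intro bexI[of _ "\<lambda>y. a * p y"]) (auto intro: trig_cmult)
  qed
  then show ?thesis using assms by (simp add: approx_def L2_cmult)
qed

lemma approx_sum: "(\<And>i. i \<in> I \<Longrightarrow> f i \<in> approx) \<Longrightarrow> (\<lambda>y. \<Sum>i\<in>I. f i y) \<in> approx"
  by (induction I rule: infinite_finite_induct) (auto intro: trig_approx trig_zero approx_add)

text \<open>The closure principle behind each enlargement: pointwise convergence with a
  square-integrable majorant implies convergence in L2.\<close>

lemma approx_dominated_limit:
  assumes s: "\<And>j. s j \<in> approx" and g: "g \<in> borel_measurable torus"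
    and lim: "\<And>y. y \<in> space torus \<Longrightarrow> (\<lambda>j. s j y) \<longlonglongrightarrow> g y"
    and w: "integrable torus (\<lambda>y. (w y)\<^sup>2)" "\<And>j y. y \<in> space torus \<Longrightarrow> cmod (s j y) \<le> w y"
  shows "g \<in> approx"
proof (rule approx_lim)
  have gw: "cmod (g y) \<le> w y" if "y \<in> space torus" for y
    by (rule LIMSEQ_le_const2[OF tendsto_norm[OF lim[OF that]]]) (use w(2) that in auto)
  have "integrable torus (\<lambda>y. (cmod (g y))\<^sup>2)"
    by (rule Bochner_Integration.integrable_bound[OF w(1)])
      (use g gw in \<open>auto intro!: AE_I2 power_mono\<close>)
  then show gL: "g \<in> L2 torus" using g by (simp add: L2_def)
  have "(\<lambda>j. LINT y|torus. (cmod (g y - s j y))\<^sup>2) \<longlonglongrightarrow> (LINT y|torus. 0)"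
  proof (rule integral_dominated_convergence)
    show "integrable torus (\<lambda>y. 4 * (w y)\<^sup>2)" using w(1) by simp
    show "(\<lambda>y. (cmod (g y - s j y))\<^sup>2) \<in> borel_measurable torus" for j
      using g approx_L2[OF s[of j]] by (auto simp: L2_def)
    show "AE y in torus. (\<lambda>j. (cmod (g y - s j y))\<^sup>2) \<longlonglongrightarrow> 0"
    proof (rule AE_I2)
      fix y assume "y \<in> space torus"
      have "(\<lambda>j. (cmod (g y - s j y))\<^sup>2) \<longlonglongrightarrow> (cmod (g y - g y))\<^sup>2"
        by (intro tendsto_intros lim \<open>y \<in> space torus\<close>)
      then show "(\<lambda>j. (cmod (g y - s j y))\<^sup>2) \<longlonglongrightarrow> 0" by simp
    qed
    show "AE y in torus. norm ((cmod (g y - s j y))\<^sup>2) \<le> 4 * (w y)\<^sup>2" for j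
    proof (rule AE_I2)
      fix y assume y: "y \<in> space torus"
      have "cmod (g y - s j y) \<le> 2 * w y"
        using norm_triangle_ineq4[of "g y" "s j y"] gw[OF y] w(2)[OF y, of j] by linarith
      then have "(cmod (g y - s j y))\<^sup>2 \<le> (2 * w y)\<^sup>2" by (intro power_mono) auto
      then show "norm ((cmod (g y - s j y))\<^sup>2) \<le> 4 * (w y)\<^sup>2" by simp
    qed
  qed simp
  then have "(\<lambda>j. sqrt (LINT y|torus. (cmod (g y - s j y))\<^sup>2)) \<longlonglongrightarrow> sqrt 0"
    by (intro tendsto_real_sqrt) simp
  then have lim0: "(\<lambda>j. L2nrm torus (\<lambda>y. g y - s j y)) \<longlonglongrightarrow> 0"
    by (simp add: L2nrm_def)
  fix e :: real assume "e > 0"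
  with order_tendstoD(2)[OF lim0] obtain j where "L2nrm torus (\<lambda>y. g y - s j y) < e"
    unfolding eventually_sequentially by blast
  then show "\<exists>h\<in>approx. L2nrm torus (\<lambda>y. g y - h y) < e" using s by blast
qed

lemma approx_cong_space:
  assumes "g \<in> approx" "\<And>y. y \<in> space torus \<Longrightarrow> f y = g y"
  shows "f \<in> approx"
proof (rule approx_lim)
  have "f \<in> borel_measurable torus"
    using approx_L2[OF assms(1)] assms(2) measurable_cong[of torus f g borel] by (auto simp: L2_def)
  moreover have "integrable torus (\<lambda>y. (cmod (f y))\<^sup>2)"
    using approx_L2[OF assms(1)] assms(2)
    by (subst Bochner_Integration.integrable_cong[of torus torus _ "\<lambda>y. (cmod (g y))\<^sup>2"]) (auto simp: L2_def)
  ultimately show "f \<in> L2 torus" by (simp add: L2_def)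
  have "(LINT y|torus. (cmod (f y - g y))\<^sup>2) = (LINT y|torus. 0)"
    using assms(2) by (intro Bochner_Integration.integral_cong) auto
  then have "L2nrm torus (\<lambda>y. f y - g y) = 0" by (simp add: L2nrm_def)
  then show "\<exists>h\<in>approx. L2nrm torus (\<lambda>y. f y - h y) < e" if "e > 0" for e
    using that assms(1) by force
qed

text \<open>Composition with \<open>cis\<close> makes periodicity automatic and moves the problem to
  a compact set, where Stone-Weierstrass applies.\<close>

lemma approx_continuous_circle:
  fixes F :: "complex \<Rightarrow> real"
  assumes "continuous_on (sphere 0 1) F"
  shows "(\<lambda>y. complex_of_real (F (cis y))) \<in> approx"
proof -
  have cont: "continuous_on UNIV (\<lambda>y. complex_of_real (F (cis y)))"
    by (intro continuous_intros continuous_on_compose2[OF assms]) auto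
  have "\<forall>j::nat. \<exists>p. real_polynomial_function p \<and> (\<forall>z\<in>sphere 0 1. \<bar>F z - p z\<bar> < 1 / Suc j)"
  proof
    fix j :: nat
    obtain p where "real_polynomial_function p" "\<And>z. z \<in> sphere 0 1 \<Longrightarrow> \<bar>F z - p z\<bar> < 1 / Suc j"
      by (rule Stone_Weierstrass_real_polynomial_function[OF compact_sphere assms, of "1 / Suc j"]) auto
    then show "\<exists>p. real_polynomial_function p \<and> (\<forall>z\<in>sphere 0 1. \<bar>F z - p z\<bar> < 1 / Suc j)" by blast
  qed
  then obtain p where p: "\<And>j::nat. real_polynomial_function (p j)"
      "\<And>j z. z \<in> sphere 0 1 \<Longrightarrow> \<bar>F z - p j z\<bar> < 1 / Suc j" by metis
  have "bounded (F ` sphere 0 1)"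
    by (intro compact_imp_bounded compact_continuous_image assms compact_sphere)
  then obtain B where B: "\<And>z. z \<in> sphere 0 1 \<Longrightarrow> \<bar>F z\<bar> \<le> B"
    unfolding bounded_iff by (metis image_eqI real_norm_def)
  show ?thesis
  proof (rule approx_dominated_limit)
    show "(\<lambda>y. complex_of_real (p j (cis y))) \<in> approx" for j
      by (intro trig_approx trig_polynomial p)
    show "(\<lambda>y. complex_of_real (F (cis y))) \<in> borel_measurable torus"
      by (rule continuous_measurable_torus[OF cont])
    fix y :: real
    have "(\<lambda>j. F (cis y) - p j (cis y)) \<longlonglongrightarrow> 0"
    proof (rule tendsto_rabs_zero_cancel, rule tendsto_sandwich[OF _ _ tendsto_const])
      show "(\<lambda>j. 1 / Suc j) \<longlonglongrightarrow> 0" by (rule lim_1_over_n[THEN LIMSEQ_Suc])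
    qed (use p(2)[of "cis y"] in \<open>auto intro!: always_eventually less_imp_le\<close>)
    then have "(\<lambda>j. F (cis y) - (F (cis y) - p j (cis y))) \<longlonglongrightarrow> F (cis y) - 0"
      by (intro tendsto_intros)
    then show "(\<lambda>j. complex_of_real (p j (cis y))) \<longlonglongrightarrow> complex_of_real (F (cis y))"
      by (intro tendsto_of_real) simp
    show "cmod (complex_of_real (p j (cis y))) \<le> B + 1" for j
    proof -
      have "1 / real (Suc j) \<le> 1" by simp
      moreover have "\<bar>F (cis y) - p j (cis y)\<bar> < 1 / Suc j" "\<bar>F (cis y)\<bar> \<le> B"
        by (intro p(2) B; simp)+
      ultimately show ?thesis unfolding norm_of_real by linarith
    qed
    show "integrable torus (\<lambda>y. (B + 1)\<^sup>2)" by simp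
  qed
qed

lemma approx_closed_circle:
  fixes K :: "complex set"
  assumes "closed K"
  shows "(\<lambda>y. indicator K (cis y)) \<in> approx"
proof (cases "K = {}")
  case True
  then show ?thesis using trig_approx[OF trig_zero] by simp
next
  case False
  \<comment> \<open>Continuous functions that decrease to the indicator of \<open>K\<close> as the
    slope \<open>j\<close> grows, because \<open>K\<close> is closed.\<close>
  let ?F = "\<lambda>j z. max 0 (1 - real j * infdist z K)"
  show ?thesis
  proof (rule approx_dominated_limit)
    show "(\<lambda>y. complex_of_real (?F j (cis y))) \<in> approx" for j
      by (rule approx_continuous_circle) (intro continuous_intros)
    have "K \<in> sets borel" using assms by (rule borel_closed)
    then have "(\<lambda>y. indicator K (cis y) :: complex) \<in> borel_measurable borel" by measurable
    then show "(\<lambda>y. indicator K (cis y) :: complex) \<in> borel_measurable torus" by (rule measurable_torus)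
    show "cmod (complex_of_real (?F j (cis y))) \<le> 1" for j y
      by (auto simp: infdist_nonneg)
    show "integrable torus (\<lambda>y. 1\<^sup>2)" by simp
    fix y :: real
    show "(\<lambda>j. complex_of_real (?F j (cis y))) \<longlonglongrightarrow> indicator K (cis y)"
    proof (cases "cis y \<in> K")
      case True
      then show ?thesis by simp
    next
      case F: False
      then have pos: "infdist (cis y) K > 0"
        using assms False by (metis in_closed_iff_infdist_zero infdist_nonneg less_eq_real_def)
      obtain j0 :: nat where j0: "1 / infdist (cis y) K < real j0" using reals_Archimedean2 by blast
      have "?F j (cis y) = 0" if "j \<ge> j0" for j
      proof -
        have "1 / infdist (cis y) K \<le> real j" using j0 that by linarith
        then show ?thesis using pos by (simp add: field_simps)
      qed
      then have "\<forall>\<^sub>F j in sequentially. complex_of_real (?F j (cis y)) = 0"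
        unfolding eventually_sequentially by (intro exI[of _ j0]) auto
      then show ?thesis using F by (simp add: tendsto_eventually)
    qed
  qed
qed

text \<open>The nontrivial half-lines cut a closed arc out of the circle: \<open>cis\<close> is
  injective on one period, with inverse \<open>Arg2pi\<close>.\<close>

lemma approx_atMost: "(\<lambda>y. indicator {..a} y) \<in> approx"
proof -
  consider "a < 0" | "0 \<le> a" "a < 2 * pi" | "2 * pi \<le> a" by linarith
  then show ?thesis
  proof cases
    case 1
    then show ?thesis by (intro approx_cong_space[OF trig_approx[OF trig_zero]]) auto
  next
    case 3
    then show ?thesis by (intro approx_cong_space[OF trig_approx[OF trig_const[of 1]]]) auto
  next
    case 2
    show ?thesis
    proof (rule approx_cong_space[OF approx_closed_circle])
      show "closed (cis ` {0..a})"
        by (intro compact_imp_closed compact_continuous_image continuous_intros) auto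
      fix y assume y: "y \<in> space torus"
      have Arg: "Arg2pi (cis x) = x" if "0 \<le> x" "x < 2 * pi" for x
        using that Arg2pi_unique[of 1 x "cis x"] by (simp add: cis_conv_exp)
      have "cis y \<in> cis ` {0..a} \<longleftrightarrow> y \<le> a"
      proof
        assume "cis y \<in> cis ` {0..a}"
        then obtain x where x: "0 \<le> x" "x \<le> a" "cis y = cis x" by auto
        then have "Arg2pi (cis y) = x" using Arg[of x] 2 by simp
        then show "y \<le> a" using Arg[of y] y x by simp
      next
        assume "y \<le> a"
        then show "cis y \<in> cis ` {0..a}" using y by (intro imageI) simp
      qed
      then show "indicator {..a} y = (indicator (cis ` {0..a}) (cis y) :: complex)"
        unfolding indicator_def by simp
    qed
  qed
qed

text \<open>Dynkin's argument: half-lines are closed under intersection and generate the Borel sets,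
  and the sets with indicator in \<open>approx\<close> are closed under complements and countable
  disjoint unions.\<close>

lemma approx_indicator:
  assumes "A \<in> sets borel"
  shows "(\<lambda>y. indicator A y) \<in> approx"
proof -
  have "Int_stable (range (\<lambda>a::real. {..a}))"
    by (auto simp: Int_stable_def)
  moreover have "range (\<lambda>a::real. {..a}) \<subseteq> Pow UNIV" by simp
  moreover have "A \<in> sigma_sets UNIV (range (\<lambda>a::real. {..a}))"
    using assms by (simp add: borel_eq_atMost)
  ultimately show ?thesis
  proof (induction rule: sigma_sets_induct_disjoint)
    case (basic A)
    then show ?case using approx_atMost by auto
  next
    case empty
    then show ?case using trig_approx[OF trig_zero] by simp
  next
    case (compl A)
    have "(\<lambda>y. 1 + (-1) * indicator A y) \<in> approx"
      using compl by (intro approx_add approx_cmult) (auto intro: trig_approx trig_const)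
    then show ?case by (rule approx_cong_space) (auto simp: indicator_def)
  next
    case (union A)
    have mA: "A i \<in> sets borel" for i using union(2) by (auto simp: borel_eq_atMost)
    show ?case
    proof (rule approx_dominated_limit)
      show "(\<lambda>y. \<Sum>i<n. indicator (A i) y) \<in> approx" for n
        using union by (intro approx_sum)
      have "(\<Union>i. A i) \<in> sets borel" using mA by auto
      then show "(\<lambda>y. indicator (\<Union>i. A i) y :: complex) \<in> borel_measurable torus"
        by (intro measurable_torus borel_measurable_indicator)
      show "integrable torus (\<lambda>y. 1\<^sup>2)" by simp
      have eq: "(\<Sum>i<n. indicator (A i) y) = (indicator (\<Union>i<n. A i) y :: complex)" for n y
        using union(1) by (intro indicator_UN_disjoint[symmetric]) (auto simp: disjoint_family_on_def)
      show "cmod (\<Sum>i<n. indicator (A i) y) \<le> 1" for n y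
        unfolding eq by (auto simp: indicator_def)
      show "(\<lambda>n. \<Sum>i<n. indicator (A i) y) \<longlonglongrightarrow> (indicator (\<Union>i. A i) y :: complex)" for y
        unfolding eq by (rule LIMSEQ_indicator_UN)
    qed
  qed
qed

lemma L2_approx:
  assumes g: "g \<in> L2 torus"
  shows "g \<in> approx"
proof -
  have gm: "g \<in> borel_measurable torus" using g by (simp add: L2_def)
  obtain F where F: "\<And>i. simple_function torus (F i)"
      "\<And>y. y \<in> space torus \<Longrightarrow> (\<lambda>i. F i y) \<longlonglongrightarrow> g y"
      "\<And>i y. y \<in> space torus \<Longrightarrow> dist (F i y) 0 \<le> 2 * dist (g y) 0"
    using borel_measurable_implies_sequence_metric[OF gm, of 0] by blast
  show ?thesis
  proof (rule approx_dominated_limit[OF _ gm F(2)])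
    show "integrable torus (\<lambda>y. (2 * cmod (g y))\<^sup>2)"
      using L2_integrable_square[OF g] by (simp add: power_mult_distrib)
    show "cmod (F i y) \<le> 2 * cmod (g y)" if "y \<in> space torus" for i y
      using F(3)[OF that] by simp
    fix i
    have fin: "finite (F i ` space torus)" using F(1)[of i] by (simp add: simple_function_def)
    have "(\<lambda>y. \<Sum>z\<in>F i ` space torus. z * indicator (F i -` {z} \<inter> space torus) y) \<in> approx"
    proof (intro approx_sum approx_cmult)
      fix z assume "z \<in> F i ` space torus"
      then have "F i -` {z} \<inter> space torus \<in> sets torus"
        using F(1)[of i] unfolding simple_function_def by blast
      then obtain A where A: "A \<in> sets borel" "F i -` {z} \<inter> space torus = {0..<2 * pi} \<inter> A"
        unfolding sets_torus by blast
      then show "indicator (F i -` {z} \<inter> space torus) \<in> approx"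
        by (intro approx_indicator) auto
    qed
    then show "F i \<in> approx"
    proof (rule approx_cong_space)
      fix y assume y: "y \<in> space torus"
      then have "(\<Sum>z\<in>F i ` space torus. z * indicator (F i -` {z} \<inter> space torus) y) =
          (\<Sum>z\<in>F i ` space torus. if z = F i y then z else 0)"
        by (intro sum.cong) (auto simp: indicator_def)
      also have "\<dots> = F i y" using fin y by (simp add: sum.delta)
      finally show "F i y = (\<Sum>z\<in>F i ` space torus. z * indicator (F i -` {z} \<inter> space torus) y)" by simp
    qed
  qed auto
qed

text \<open>By completeness some trigonometric polynomial of degree \<open>N0\<close> is close to
  \<open>g\<close>. Padded with zeros it competes with every later partial sum, which is at least as
  good.\<close>

theorem L2_fourier_convergence:
  assumes "g \<in> L2 torus"
  shows "(\<lambda>N. L2nrm torus (\<lambda>y. g y - tp N (fc g) y)) \<longlonglongrightarrow> 0"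
proof (rule LIMSEQ_I)
  fix e :: real assume "e > 0"
  then obtain N0 c where c: "L2nrm torus (\<lambda>y. g y - tp N0 c y) < e"
    using L2_approx[OF assms] unfolding approx_def trig_def by blast
  have "norm (L2nrm torus (\<lambda>y. g y - tp N (fc g) y) - 0) < e" if "N \<ge> N0" for N
  proof -
    let ?c = "\<lambda>n. if n \<in> {-int N0..int N0} then c n else 0"
    have "(L2nrm torus (\<lambda>y. g y - tp N (fc g) y))\<^sup>2 \<le> (L2nrm torus (\<lambda>y. g y - tp N ?c y))\<^sup>2"
      unfolding L2nrm_diff_tp[OF assms] by (simp add: sum_nonneg)
    then have "L2nrm torus (\<lambda>y. g y - tp N (fc g) y) \<le> L2nrm torus (\<lambda>y. g y - tp N ?c y)"
      by (rule power2_le_imp_le) simp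
    also have "\<dots> < e" using c tp_pad[OF that, of c] by simp
    finally show ?thesis by simp
  qed
  then show "\<exists>no. \<forall>N\<ge>no. norm (L2nrm torus (\<lambda>y. g y - tp N (fc g) y) - 0) < e" by blast
qed

theorem Parseval:
  assumes "g \<in> L2 torus"
  shows "(\<lambda>N. 2 * pi * (\<Sum>n\<in>{-int N..int N}. (cmod (fc g n))\<^sup>2)) \<longlonglongrightarrow> (L2nrm torus g)\<^sup>2"
proof -
  have "(\<lambda>N. (L2nrm torus g)\<^sup>2 - (L2nrm torus (\<lambda>y. g y - tp N (fc g) y))\<^sup>2) \<longlonglongrightarrow> (L2nrm torus g)\<^sup>2 - 0\<^sup>2"
    by (intro tendsto_intros L2_fourier_convergence assms)
  then show ?thesis by (simp add: L2nrm_diff_tp[OF assms])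
qed

subsection \<open>The velocity field\<close>

text \<open>The triangle wave of period 2, the distance to the nearest even integer.\<close>

definition tri :: "real \<Rightarrow> real" where
  "tri x = (if even \<lfloor>x\<rfloor> then frac x else 1 - frac x)"

lemma tri_int_add:
  assumes "0 \<le> s" "s \<le> 1"
  shows "tri (of_int n + s) = (if even n then s else 1 - s)"
proof (cases "s = 1")
  case True
  have "\<lfloor>of_int n + (1::real)\<rfloor> = n + 1" "frac (of_int n + (1::real)) = 0"
    by (simp_all add: frac_def)
  then show ?thesis using True by (simp add: tri_def)
next
  case False
  with assms have "\<lfloor>of_int n + s\<rfloor> = n" by (intro floor_unique) auto
  then show ?thesis by (simp add: tri_def frac_def)
qed

lemma tri_range: "0 \<le> tri x" "tri x \<le> 1"
  using frac_ge_0[of x] frac_lt_1[of x] by (auto simp: tri_def)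

lemma tri_id: "0 \<le> x \<Longrightarrow> x \<le> 1 \<Longrightarrow> tri x = x"
  using tri_int_add[of x 0] by simp

lemma tri_periodic: "tri (x + 2) = tri x"
proof -
  have "\<lfloor>x + 2\<rfloor> = \<lfloor>x\<rfloor> + 2" using floor_add_int[of x 2] by simp
  then show ?thesis by (simp add: tri_def frac_def)
qed

text \<open>\<open>odd r\<close> makes the first and the last crossing of each strip ascend, so that
  consecutive strips join continuously. \<open>3 \<le> r\<close> closes the induction for
  \<open>K_bound\<close>, and \<open>3 \<le> q\<close> gives the factor 2/3 in
  \<open>exists_level\<close>.\<close>

locale zigzag =
  fixes q r :: nat
  assumes q3: "3 \<le> q" and r3: "3 \<le> r" and odd_r: "odd r"
begin

definition b :: nat where "b = q * r"

text \<open>A point of \<open>[0, 1]\<close> has a first digit to base \<open>q\<close>, and its position in the corresponding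
  interval of length \<open>1 / q\<close> is folded \<open>r\<close> times by the triangle wave; \<open>V\<close> reads off the digits
  along this orbit. The minimum in \<open>dig\<close> only matters at the end point \<open>1\<close>.\<close>

definition dig :: "real \<Rightarrow> int" where
  "dig x = min \<lfloor>of_nat q * x\<rfloor> (int q - 1)"

definition T :: "real \<Rightarrow> real" where
  "T x = tri (of_nat r * (of_nat q * x - of_int (dig x)))"

definition V :: "real \<Rightarrow> real" where
  "V x = (\<Sum>m. of_int (dig ((T ^^ m) x)) / of_nat q ^ Suc m)"

definition E :: "real \<Rightarrow> real" where
  "E x = V (tri x)"

lemma b_ge: "9 \<le> b"
  unfolding b_def using mult_le_mono[OF q3 r3] by simp

lemma q_gt1: "1 < real q" and b_gt1: "1 < real b"
  using q3 b_ge by auto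

lemma T_range: "0 \<le> T x" "T x \<le> 1"
  unfolding T_def by (rule tri_range)+

lemma T_pow_range: "0 \<le> x \<Longrightarrow> x \<le> 1 \<Longrightarrow> 0 \<le> (T ^^ m) x \<and> (T ^^ m) x \<le> 1"
  by (cases m) (auto simp: T_range)

lemma dig_range:
  assumes "0 \<le> x" "x \<le> 1"
  shows "0 \<le> dig x" "dig x \<le> int q - 1"
  using assms q3 by (auto simp: dig_def)

lemma sum_digits: "(\<lambda>m. (real q - 1) / real q ^ Suc m) sums 1"
proof -
  have "(\<lambda>m. (real q - 1) / real q * (1 / real q) ^ m) sums ((real q - 1) / real q * (1 / (1 - 1 / real q)))"
    using q_gt1 by (intro sums_mult geometric_sums) auto
  also have "(real q - 1) / real q * (1 / (1 - 1 / real q)) = 1"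
    using q_gt1 by (simp add: field_simps)
  finally show ?thesis by (simp add: power_one_over field_simps)
qed

lemma V_term_bounds:
  assumes "0 \<le> x" "x \<le> 1"
  shows "0 \<le> of_int (dig ((T ^^ m) x)) / real q ^ Suc m"
    "of_int (dig ((T ^^ m) x)) / real q ^ Suc m \<le> (real q - 1) / real q ^ Suc m"
proof -
  from T_pow_range[OF assms] have "0 \<le> dig ((T ^^ m) x)" "dig ((T ^^ m) x) \<le> int q - 1"
    using dig_range by auto
  then have "0 \<le> real_of_int (dig ((T ^^ m) x))" "real_of_int (dig ((T ^^ m) x)) \<le> real q - 1"
    by linarith+
  then show "0 \<le> of_int (dig ((T ^^ m) x)) / real q ^ Suc m"
    "of_int (dig ((T ^^ m) x)) / real q ^ Suc m \<le> (real q - 1) / real q ^ Suc m"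
    using q_gt1 by (auto intro!: divide_right_mono)
qed

lemma V_summable:
  assumes "0 \<le> x" "x \<le> 1"
  shows "summable (\<lambda>m. of_int (dig ((T ^^ m) x)) / real q ^ Suc m)"
proof (rule summable_comparison_test'[OF sums_summable[OF sum_digits]])
  fix m
  show "norm (of_int (dig ((T ^^ m) x)) / real q ^ Suc m) \<le> (real q - 1) / real q ^ Suc m"
    using V_term_bounds[OF assms, of m] by (simp only: real_norm_def abs_of_nonneg)
qed

lemma V_range:
  assumes "0 \<le> x" "x \<le> 1"
  shows "0 \<le> V x" "V x \<le> 1"
proof -
  show "0 \<le> V x" unfolding V_def
    using V_summable[OF assms] V_term_bounds(1)[OF assms] by (intro suminf_nonneg) auto
  have "V x \<le> (\<Sum>m. (real q - 1) / real q ^ Suc m)" unfolding V_def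
    using V_summable[OF assms] V_term_bounds(2)[OF assms] sums_summable[OF sum_digits] by (intro suminf_le) auto
  then show "V x \<le> 1" using sums_unique[OF sum_digits] by simp
qed

lemma V_eq:
  assumes "0 \<le> x" "x \<le> 1"
  shows "V x = (of_int (dig x) + V (T x)) / real q"
proof -
  have "V x = of_int (dig ((T ^^ 0) x)) / real q ^ Suc 0 + (\<Sum>m. of_int (dig ((T ^^ Suc m) x)) / real q ^ Suc (Suc m))"
    unfolding V_def using suminf_split_head[OF V_summable[OF assms]] by linarith
  also have "(\<Sum>m. of_int (dig ((T ^^ Suc m) x)) / real q ^ Suc (Suc m)) =
      (\<Sum>m. of_int (dig ((T ^^ m) (T x))) / real q ^ Suc m / real q)"
    by (simp add: funpow_swap1 mult_ac)
  also have "\<dots> = V (T x) / real q"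
    unfolding V_def using V_summable[OF T_range[of x]] by (rule suminf_divide)
  finally show ?thesis by (simp add: add_divide_distrib)
qed

text \<open>Both points are fixed by \<open>T\<close>, so \<open>V_eq\<close> becomes a linear
  equation for the value there. For the point 1 this needs \<open>tri (real r) = 1\<close>, hence
  \<open>r\<close> odd.\<close>

lemma V_0: "V 0 = 0" and V_1: "V 1 = 1"
proof -
  have "dig 0 = 0" using q3 by (simp add: dig_def)
  then have "T 0 = 0" using tri_id[of 0] by (simp add: T_def)
  with V_eq[of 0] \<open>dig 0 = 0\<close> have "V 0 * (real q - 1) = 0" using q_gt1 by (simp add: field_simps)
  then show "V 0 = 0" using q_gt1 by simp
  have "dig 1 = int q - 1" by (simp add: dig_def)
  moreover have "tri (real r) = 1" using tri_int_add[of 0 "int r"] odd_r by simp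
  ultimately have "T 1 = 1" by (simp add: T_def)
  with V_eq[of 1] \<open>dig 1 = int q - 1\<close> have "(V 1 - 1) * (real q - 1) = 0" using q_gt1 by (simp add: field_simps)
  then show "V 1 = 1" using q_gt1 by simp
qed

text \<open>Here \<open>j\<close> is the first digit and \<open>l\<close> the number of folds before
  the cell, so the parity of \<open>l\<close> decides the direction. Closed cells are covered so
  that neighbouring formulas agree at common end points, which is what makes \<open>V\<close>
  continuous.\<close>

lemma V_cell:
  assumes "j < q" "l < r" "0 \<le> s" "s \<le> 1"
  shows "V ((real (j * r + l) + s) / real b) = (real j + V (if even l then s else 1 - s)) / real q"
proof -
  define x where "x = (real (j * r + l) + s) / real b"
  have r: "0 < real r" and q: "0 < real q" using r3 q3 by auto
  have qx: "real q * x = real j + (real l + s) / real r"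
    using r q by (simp add: x_def b_def field_simps)
  have ls: "(real l + s) / real r \<le> 1" using assms r by (simp add: field_simps)
  have ls0: "0 \<le> (real l + s) / real r" using assms by simp
  have x0: "0 \<le> x" using assms by (simp add: x_def)
  have "real q * x \<le> real q" using qx ls assms(1) by linarith
  then have x1: "x \<le> 1" using q by simp
  show ?thesis
  proof (cases "(real l + s) / real r = 1 \<and> j < q - 1")
    case False
    have "dig x = int j"
    proof (cases "(real l + s) / real r = 1")
      case True
      with False assms have "j = q - 1" by auto
      moreover have "real q * x = real (q - 1) + 1" using qx True \<open>j = q - 1\<close> by simp
      ultimately have "real q * x = real q" using q3 by simp
      then show ?thesis using \<open>j = q - 1\<close> q3 by (simp add: dig_def)
    next
      case False
      then have "\<lfloor>real q * x\<rfloor> = int j" unfolding qx using le_neq_trans[OF ls False] ls0 by (intro floor_unique) auto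
      then show ?thesis using assms by (simp add: dig_def)
    qed
    then have "T x = tri (of_int (int l) + s)" using r unfolding T_def qx by simp
    also have "\<dots> = (if even l then s else 1 - s)" using tri_int_add[OF assms(3,4), of "int l"] by simp
    finally show ?thesis using V_eq[OF x0 x1] \<open>dig x = int j\<close> by (simp add: x_def)
  next
    \<comment> \<open>At the right end of a strip the digit already belongs to the next strip and
      the orbit restarts at 0. The two readings \<open>(j + 1 + V 0) / q\<close> and
      \<open>(j + V 1) / q\<close> agree, and the second one is correct because \<open>l\<close> is
      even.\<close>
    case True
    then have "real l + s = real r" using r by simp
    with assms(2,4) have l: "l = r - 1" "s = 1" by linarith+
    then have "even l" using odd_r by simp
    have "real q * x = of_int (int j + 1)" using qx True by simp
    then have "\<lfloor>real q * x\<rfloor> = int j + 1" by (simp only: floor_of_int)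
    then have d: "dig x = int j + 1" using True q3 by (auto simp: dig_def min_def)
    then have "T x = 0" unfolding T_def using \<open>real q * x = of_int (int j + 1)\<close> tri_id[of 0] by simp
    then show ?thesis using V_eq[OF x0 x1] d \<open>even l\<close> l V_0 V_1 by (simp add: x_def)
  qed
qed

lemma V_subcell:
  assumes "0 \<le> i" "i < int b"
  obtains e where "\<And>s. 0 \<le> s \<Longrightarrow> s \<le> 1 \<Longrightarrow> V ((of_int i + s) / real b) = e + V s / real q"
  | e where "\<And>s. 0 \<le> s \<Longrightarrow> s \<le> 1 \<Longrightarrow> V ((of_int i + s) / real b) = e + V (1 - s) / real q"
proof -
  define j l where "j = nat i div r" and "l = nat i mod r"
  have i: "nat i = j * r + l" by (simp add: j_def l_def)
  have "nat i < q * r" using assms by (simp add: b_def nat_less_iff)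
  then have "j < q" unfolding j_def using less_mult_imp_div_less by blast
  have "l < r" using r3 by (simp add: l_def)
  have ri: "of_int i = real (j * r + l)" using assms i by (metis int_nat_eq of_int_of_nat_eq)
  note V = V_cell[OF \<open>j < q\<close> \<open>l < r\<close>, folded ri]
  show ?thesis
    by (cases "even l"; rule that[of "real j / real q"]) (use V in \<open>auto simp: add_divide_distrib\<close>)
qed

text \<open>Reflection of the unit interval maps subcell \<open>i\<close> to subcell
  \<open>b - 1 - i\<close> and reverses its direction; needed where the enclosing cell
  descends.\<close>

lemma V_subcell_symmetric:
  assumes "0 \<le> i" "i < int b"
  obtains e where "\<And>s. 0 \<le> s \<Longrightarrow> s \<le> 1 \<Longrightarrow> V (1 - (of_int i + s) / real b) = e + V s / real q"
  | e where "\<And>s. 0 \<le> s \<Longrightarrow> s \<le> 1 \<Longrightarrow> V (1 - (of_int i + s) / real b) = e + V (1 - s) / real q"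
proof -
  have eq: "1 - (of_int i + s) / real b = (of_int (int b - 1 - i) + (1 - s)) / real b" for s
    using b_gt1 by (simp add: field_simps)
  have "0 \<le> int b - 1 - i" "int b - 1 - i < int b" using assms by auto
  then show ?thesis
  proof (cases rule: V_subcell)
    case (1 e)
    have "V (1 - (of_int i + s) / real b) = e + V (1 - s) / real q" if "0 \<le> s" "s \<le> 1" for s
      unfolding eq using 1[of "1 - s"] that by simp
    then show ?thesis by (rule that(2))
  next
    case (2 e)
    have "V (1 - (of_int i + s) / real b) = e + V s / real q" if "0 \<le> s" "s \<le> 1" for s
      unfolding eq using 2[of "1 - s"] that by simp
    then show ?thesis by (rule that(1))
  qed
qed

text \<open>Induction on the level, splitting the index of a cell of level \<open>m + 1\<close> into
  its parent \<open>i0\<close> and its position \<open>i1\<close> there. The offset \<open>e\<close>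
  stays anonymous: it cancels in differences and becomes a phase of modulus 1 in oscillatory
  integrals.\<close>

lemma E_cell:
  obtains e where "\<And>s. 0 \<le> s \<Longrightarrow> s \<le> 1 \<Longrightarrow> E ((of_int i + s) / real b ^ m) = e + V s / real q ^ m"
  | e where "\<And>s. 0 \<le> s \<Longrightarrow> s \<le> 1 \<Longrightarrow> E ((of_int i + s) / real b ^ m) = e + V (1 - s) / real q ^ m"
proof (induction m arbitrary: i thesis)
  case 0
  show ?case
    by (cases "even i"; rule "0"(1)[of 0] "0"(2)[of 0]) (auto simp: E_def tri_int_add)
next
  case (Suc m)
  define i0 i1 where "i0 = i div int b" and "i1 = i mod int b"
  have i1: "0 \<le> i1" "i1 < int b" using b_ge by (auto simp: i1_def)
  have ri: "real_of_int i = of_int i0 * real b + of_int i1"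
    unfolding i0_def i1_def by (metis div_mult_mod_eq of_int_add of_int_mult of_int_of_nat_eq)
  have eq: "(of_int i + s) / real b ^ Suc m = (of_int i0 + (of_int i1 + s) / real b) / real b ^ m" for s
    using b_gt1 unfolding ri by (simp add: field_simps)
  have rg: "0 \<le> (of_int i1 + s) / real b" "(of_int i1 + s) / real b \<le> 1" if "0 \<le> s" "s \<le> 1" for s
  proof -
    have "of_int i1 + 1 \<le> real b" using i1 by linarith
    then show "(of_int i1 + s) / real b \<le> 1" using that b_gt1 by (simp add: field_simps)
  qed (use that i1 in auto)
  have mul: "e + (e' + v / real q) / real q ^ m = (e + e' / real q ^ m) + v / real q ^ Suc m" for e e' v
    using q_gt1 by (simp add: field_simps)
  show ?case
  proof (rule Suc.IH[of i0])
    fix e assume e: "\<And>s. 0 \<le> s \<Longrightarrow> s \<le> 1 \<Longrightarrow> E ((of_int i0 + s) / real b ^ m) = e + V s / real q ^ m"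
    show ?case
      using i1
    proof (cases rule: V_subcell)
      case (1 e')
      show ?thesis by (rule Suc.prems(1)[of "e + e' / real q ^ m"]) (simp only: eq e rg 1 mul)
    next
      case (2 e')
      show ?thesis by (rule Suc.prems(2)[of "e + e' / real q ^ m"]) (simp only: eq e rg 2 mul)
    qed
  next
    fix e assume e: "\<And>s. 0 \<le> s \<Longrightarrow> s \<le> 1 \<Longrightarrow> E ((of_int i0 + s) / real b ^ m) = e + V (1 - s) / real q ^ m"
    show ?case
      using i1
    proof (cases rule: V_subcell_symmetric)
      case (1 e')
      show ?thesis by (rule Suc.prems(1)[of "e + e' / real q ^ m"]) (simp only: eq e rg 1 mul)
    next
      case (2 e')
      show ?thesis by (rule Suc.prems(2)[of "e + e' / real q ^ m"]) (simp only: eq e rg 2 mul)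
    qed
  qed
qed

lemma E_range: "0 \<le> E x" "E x \<le> 1"
  unfolding E_def by (auto intro: V_range tri_range)

lemma E_periodic: "E (x + 2) = E x"
  by (simp add: E_def tri_periodic)

lemma E_id: "0 \<le> x \<Longrightarrow> x \<le> 1 \<Longrightarrow> E x = V x"
  by (simp add: E_def tri_id)

lemma E_same_cell:
  assumes "0 \<le> s" "s \<le> 1" "0 \<le> s'" "s' \<le> 1"
  shows "\<bar>E ((of_int i + s) / real b ^ m) - E ((of_int i + s') / real b ^ m)\<bar> \<le> 1 / real q ^ m"
proof -
  have d: "\<bar>V x / real q ^ m - V y / real q ^ m\<bar> \<le> 1 / real q ^ m"
    if "0 \<le> x" "x \<le> 1" "0 \<le> y" "y \<le> 1" for x y
  proof -
    have "\<bar>V x - V y\<bar> \<le> 1" using V_range[of x] V_range[of y] that by auto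
    then have "\<bar>V x - V y\<bar> / real q ^ m \<le> 1 / real q ^ m" by (intro divide_right_mono) auto
    then show ?thesis by (simp add: diff_divide_distrib[symmetric] abs_divide)
  qed
  show ?thesis
  proof (rule E_cell[of i m])
    fix e assume "\<And>s. 0 \<le> s \<Longrightarrow> s \<le> 1 \<Longrightarrow> E ((of_int i + s) / real b ^ m) = e + V s / real q ^ m"
    then show ?thesis using assms d by simp
  next
    fix e assume "\<And>s. 0 \<le> s \<Longrightarrow> s \<le> 1 \<Longrightarrow> E ((of_int i + s) / real b ^ m) = e + V (1 - s) / real q ^ m"
    then show ?thesis using assms d by simp
  qed
qed

text \<open>Exact, and not only a bound, because \<open>V\<close> runs from 0 to 1. The sharpness of
  the Hoelder exponent and the sign of a cell both rest on this.\<close>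

lemma E_cell_increment: "\<bar>E (of_int (i + 1) / real b ^ m) - E (of_int i / real b ^ m)\<bar> = 1 / real q ^ m"
proof (rule E_cell[of i m])
  fix e assume "\<And>s. 0 \<le> s \<Longrightarrow> s \<le> 1 \<Longrightarrow> E ((of_int i + s) / real b ^ m) = e + V s / real q ^ m"
  from this[of 0] this[of 1] show ?thesis by (simp add: V_0 V_1)
next
  fix e assume "\<And>s. 0 \<le> s \<Longrightarrow> s \<le> 1 \<Longrightarrow> E ((of_int i + s) / real b ^ m) = e + V (1 - s) / real q ^ m"
  from this[of 0] this[of 1] show ?thesis by (simp add: V_0 V_1)
qed

text \<open>Such points lie in one cell or in two adjacent ones, whence the factor 2.\<close>

lemma E_close:
  assumes "\<bar>x - y\<bar> \<le> 1 / real b ^ m"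
  shows "\<bar>E x - E y\<bar> \<le> 2 / real q ^ m"
proof -
  have *: "\<bar>E x - E y\<bar> \<le> 2 / real q ^ m" if "x \<le> y" "y - x \<le> 1 / real b ^ m" for x y
  proof -
    define i where "i = \<lfloor>x * real b ^ m\<rfloor>"
    define s where "s = x * real b ^ m - of_int i"
    define t where "t = y * real b ^ m - of_int i"
    have B: "0 < real b ^ m" using b_gt1 by simp
    have s: "0 \<le> s" "s \<le> 1" unfolding s_def i_def by linarith+
    have x: "x = (of_int i + s) / real b ^ m" and y: "y = (of_int i + t) / real b ^ m"
      using B by (auto simp: s_def t_def)
    have "s \<le> t" unfolding s_def t_def using that(1) B by simp
    have "(y - x) * real b ^ m \<le> 1" using that(2) B by (simp add: field_simps)
    then have "t \<le> s + 1" by (simp add: s_def t_def algebra_simps)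
    show ?thesis
    proof (cases "t \<le> 1")
      case True
      have "\<bar>E x - E y\<bar> \<le> 1 / real q ^ m"
        unfolding x y using E_same_cell[of s t] s \<open>s \<le> t\<close> True by auto
      also have "\<dots> \<le> 2 / real q ^ m" by (intro divide_right_mono) auto
      finally show ?thesis .
    next
      case False
      have y': "y = (of_int (i + 1) + (t - 1)) / real b ^ m" unfolding y by simp
      have z: "(of_int (i + 1) + 0) / real b ^ m = (of_int i + 1) / real b ^ m" by simp
      have "\<bar>E ((of_int i + s) / real b ^ m) - E ((of_int i + 1) / real b ^ m)\<bar> \<le> 1 / real q ^ m"
        using s by (intro E_same_cell) auto
      moreover have "\<bar>E ((of_int (i + 1) + 0) / real b ^ m) - E ((of_int (i + 1) + (t - 1)) / real b ^ m)\<bar> \<le> 1 / real q ^ m"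
        using False \<open>t \<le> s + 1\<close> s by (intro E_same_cell) auto
      ultimately show ?thesis unfolding z x[symmetric] y'[symmetric] by linarith
    qed
  qed
  show ?thesis
    using *[of x y] *[of y x] assms by (cases "x \<le> y") (auto simp: abs_minus_commute)
qed

end

section \<open>Affine substitutions and phase integrals\<close>

lemma integral_affine:
  fixes f :: "real \<Rightarrow> 'a::euclidean_space"
  assumes "continuous_on UNIV f" "0 < c" "a \<le> b"
  shows "integral {c * a + d..c * b + d} f = c *\<^sub>R integral {a..b} (\<lambda>x. f (c * x + d))"
proof -
  have "((\<lambda>x. c *\<^sub>R f (c * x + d)) has_integral integral {c * a + d..c * b + d} f) {a..b}"
  proof (rule has_integral_substitution[where c = "c * a + d" and d = "c * b + d"])
    show "(\<lambda>x. c * x + d) ` {a..b} \<subseteq> {c * a + d..c * b + d}"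
      using assms by auto
    show "continuous_on {c * a + d..c * b + d} f" using assms(1) by (rule continuous_on_subset) auto
    show "((\<lambda>x. c * x + d) has_field_derivative c) (at x within {a..b})" for x
      by (auto intro!: derivative_eq_intros)
  qed (use assms in auto)
  moreover have "((\<lambda>x. c *\<^sub>R f (c * x + d)) has_integral c *\<^sub>R integral {a..b} (\<lambda>x. f (c * x + d))) {a..b}"
    by (intro has_integral_cmul integrable_integral integrable_continuous_real
        continuous_on_compose2[OF assms(1)] continuous_intros) auto
  ultimately show ?thesis by (rule has_integral_unique)
qed

lemma integral_reflect:
  fixes f :: "real \<Rightarrow> 'a::euclidean_space"
  assumes "continuous_on UNIV f"
  shows "integral {a..b} (\<lambda>x. f (d - x)) = integral {d - b..d - a} f"
proof -
  have "integral {a..b} (\<lambda>x. f (d - x)) = integral {-b..-a} (\<lambda>x. f (d + x))"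
    using Henstock_Kurzweil_Integration.integral_reflect_real[of b a "\<lambda>x. f (d - x)"] by simp
  also have "\<dots> = integral {-b + d..-a + d} f"
    using integral_shift_Icc_real[of "-b" "-a" f d] by (simp add: o_def)
  finally show ?thesis by (simp add: algebra_simps)
qed

lemma norm_cis_minus_1: "cmod (cis x - 1) \<le> \<bar>x\<bar>"
proof -
  have "cmod (cis x - 1) = 2 * \<bar>sin (x / 2)\<bar>"
    using dist_exp_i_1[of x] by (simp add: dist_norm cis_conv_exp)
  then show ?thesis using abs_sin_x_le_abs_x[of "x / 2"] by simp
qed

lemma norm_integral_cis_minus_1:
  fixes f :: "real \<Rightarrow> real"
  assumes "continuous_on {0..1} f" "\<And>s. 0 \<le> s \<Longrightarrow> s \<le> 1 \<Longrightarrow> \<bar>f s\<bar> \<le> 1"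
  shows "cmod (integral {0..1} (\<lambda>s. cis (l * f s)) - 1) \<le> \<bar>l\<bar>"
proof -
  have i: "(\<lambda>s. cis (l * f s)) integrable_on {0..1}"
    by (intro integrable_continuous_real continuous_intros assms)
  have "integral {0..1} (\<lambda>s. cis (l * f s) - 1) = integral {0..1} (\<lambda>s. cis (l * f s)) - 1"
    using i by (subst Henstock_Kurzweil_Integration.integral_diff) auto
  moreover have "norm (integral {0..1} (\<lambda>s. cis (l * f s) - 1)) \<le> \<bar>l\<bar> * (1 - 0)"
  proof (rule integral_bound)
    show "continuous_on {0..1} (\<lambda>s. cis (l * f s) - 1)" by (intro continuous_intros assms)
    fix s :: real assume s: "s \<in> {0..1}"
    have "cmod (cis (l * f s) - 1) \<le> \<bar>l * f s\<bar>" by (rule norm_cis_minus_1)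
    also have "\<dots> \<le> \<bar>l\<bar>" using assms(2)[of s] s by (simp add: abs_mult mult_left_le)
    finally show "cmod (cis (l * f s) - 1) \<le> \<bar>l\<bar>" .
  qed auto
  ultimately show ?thesis by simp
qed

text \<open>The characteristic function of the uniform distribution on the unit interval.\<close>

definition J0 :: "real \<Rightarrow> complex" where
  "J0 l = integral {0..1} (\<lambda>v. cis (l * v))"

lemma J0_value: "l \<noteq> 0 \<Longrightarrow> J0 l = (cis l - 1) / (\<i> * of_real l)"
proof -
  assume l: "l \<noteq> 0"
  let ?F = "\<lambda>v. cis (l * v) / (\<i> * of_real l)"
  have "((\<lambda>v. cis (l * v)) has_integral ?F 1 - ?F 0) {0..1}"
  proof (rule fundamental_theorem_of_calculus)
    fix v :: real
    show "(?F has_vector_derivative cis (l * v)) (at v within {0..1})"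
      using has_vector_derivative_divide[OF has_vector_derivative_cis_mult[of l v "{0..1}"], of "\<i> * of_real l"] l
      by simp
  qed auto
  then show ?thesis by (simp add: J0_def integral_unique diff_divide_distrib)
qed

context zigzag begin

section \<open>Hoelder regularity of the velocity\<close>

definition alpha :: real where "alpha = ln (real q) / ln (real b)"

lemma b_powr_alpha: "real b powr alpha = real q"
  using b_gt1 q_gt1 by (simp add: alpha_def powr_def)

lemma alpha_pos: "0 < alpha"
  using b_gt1 q_gt1 by (simp add: alpha_def)

lemma b_power_powr_alpha: "(1 / real b ^ m) powr alpha = 1 / real q ^ m"
proof -
  have "(real b ^ m) powr alpha = real q ^ m"
    using b_gt1 b_powr_alpha by (metis powr_realpow powr_powr mult.commute less_trans zero_less_one q_gt1)
  then show ?thesis using b_gt1 by (simp add: powr_divide)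
qed

text \<open>Selects the level whose cell width is comparable to \<open>h\<close> up to a factor
  \<open>b\<close>. It serves the Hoelder bound and the choice of a level for given
  viscosity.\<close>

lemma exists_scale:
  assumes "0 < h" "h \<le> 1"
  obtains m where "1 / real b ^ Suc m < h" "h \<le> 1 / real b ^ m"
proof -
  define m where "m = (LEAST m. 1 / real b ^ Suc m < h)"
  have ex: "\<exists>m. 1 / real b ^ Suc m < h"
  proof -
    obtain n where "1 / h < real b ^ n" using real_arch_pow[OF b_gt1] by blast
    also have "real b ^ n \<le> real b ^ Suc n" using b_gt1 by simp
    finally show ?thesis using assms(1) b_gt1 by (intro exI[of _ n]) (simp add: field_simps)
  qed
  have 1: "1 / real b ^ Suc m < h" unfolding m_def by (rule LeastI_ex[OF ex])
  have "h \<le> 1 / real b ^ m"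
  proof (cases m)
    case 0
    then show ?thesis using assms by simp
  next
    case (Suc k)
    then have "\<not> 1 / real b ^ Suc k < h" unfolding m_def by (metis lessI not_less_Least)
    then show ?thesis using Suc by simp
  qed
  with 1 show ?thesis by (rule that)
qed

text \<open>For \<open>\<bar>x - y\<bar>\<close> between \<open>1 / b ^ (m + 1)\<close> and
  \<open>1 / b ^ m\<close> the difference is at most \<open>2 / q ^ m\<close>; comparing with the
  lower end of this range costs the factor \<open>b powr alpha = q\<close>.\<close>

lemma E_holder: "\<bar>E x - E y\<bar> \<le> 2 * real q * \<bar>x - y\<bar> powr alpha"
proof -
  consider "x = y" | "x \<noteq> y" "\<bar>x - y\<bar> \<le> 1" | "\<bar>x - y\<bar> > 1" by linarith
  then show ?thesis
  proof cases
    case 1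
    then show ?thesis by simp
  next
    case 2
    obtain m where m: "1 / real b ^ Suc m < \<bar>x - y\<bar>" "\<bar>x - y\<bar> \<le> 1 / real b ^ m"
      by (rule exists_scale[of "\<bar>x - y\<bar>"]) (use 2 in auto)
    have "\<bar>E x - E y\<bar> \<le> 2 / real q ^ m" by (rule E_close[OF m(2)])
    also have "\<dots> = 2 * real q * (1 / real b ^ Suc m) powr alpha"
      unfolding b_power_powr_alpha using q_gt1 by simp
    also have "\<dots> \<le> 2 * real q * \<bar>x - y\<bar> powr alpha"
      using m(1) alpha_pos b_gt1 by (intro mult_left_mono powr_mono2) auto
    finally show ?thesis .
  next
    case 3
    have "\<bar>E x - E y\<bar> \<le> 1" using E_range[of x] E_range[of y] by auto
    also have "1 \<le> \<bar>x - y\<bar> powr alpha" using 3 alpha_pos by (intro ge_one_powr_ge_zero) auto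
    also have "\<dots> \<le> 2 * real q * \<bar>x - y\<bar> powr alpha"
      using mult_right_mono[of 1 "2 * real q" "\<bar>x - y\<bar> powr alpha"] q_gt1 by simp
    finally show ?thesis .
  qed
qed

lemma continuous_E: "continuous_on A E"
proof -
  have "isCont E x" for x
  proof -
    have "((\<lambda>y. 2 * real q * \<bar>y - x\<bar> powr alpha) \<longlongrightarrow> 2 * real q * \<bar>x - x\<bar> powr alpha) (at x)"
      using alpha_pos by (intro tendsto_intros) auto
    then have lim: "((\<lambda>y. 2 * real q * \<bar>y - x\<bar> powr alpha) \<longlongrightarrow> 0) (at x)" by simp
    have "\<forall>\<^sub>F y in at x. norm (E y - E x) \<le> 2 * real q * \<bar>y - x\<bar> powr alpha"
      unfolding real_norm_def by (intro always_eventually allI E_holder)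
    then have "((\<lambda>y. E y - E x) \<longlongrightarrow> 0) (at x)"
      using lim by (rule Lim_null_comparison)
    then show ?thesis unfolding isCont_def by (rule LIM_zero_cancel)
  qed
  then show ?thesis by (simp add: continuous_at_imp_continuous_on)
qed

definition u :: "real \<Rightarrow> real" where "u y = E (y / pi)"

lemma continuous_u: "continuous_on A u"
  unfolding u_def[abs_def] by (intro continuous_on_compose2[OF continuous_E[of UNIV]] continuous_intros) auto

lemma u_range: "0 \<le> u y" "u y \<le> 1"
  by (auto simp: u_def E_range)

lemma u_periodic: "u (y + 2 * pi) = u y"
  using E_periodic[of "y / pi"] by (simp add: u_def add_divide_distrib)

lemma holder_u:
  assumes "0 < \<beta>" "\<beta> \<le> alpha"
  shows "holder_torus \<beta> u"
proof -
  have E: "\<bar>E x - E y\<bar> \<le> 2 * real q * \<bar>x - y\<bar> powr \<beta>" for x y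
  proof (cases "\<bar>x - y\<bar> \<le> 1")
    case True
    have "\<bar>x - y\<bar> powr alpha \<le> \<bar>x - y\<bar> powr \<beta>"
      using True assms by (intro powr_mono') auto
    then have "2 * real q * \<bar>x - y\<bar> powr alpha \<le> 2 * real q * \<bar>x - y\<bar> powr \<beta>"
      by (intro mult_left_mono) auto
    then show ?thesis using E_holder[of x y] by linarith
  next
    case False
    have "\<bar>E x - E y\<bar> \<le> 1" using E_range[of x] E_range[of y] by auto
    also have "1 \<le> \<bar>x - y\<bar> powr \<beta>" using False assms by (intro ge_one_powr_ge_zero) auto
    also have "\<dots> \<le> 2 * real q * \<bar>x - y\<bar> powr \<beta>"
      using mult_right_mono[of 1 "2 * real q" "\<bar>x - y\<bar> powr \<beta>"] q_gt1 by simp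
    finally show ?thesis .
  qed
  have "\<bar>u x - u y\<bar> \<le> 2 * real q / pi powr \<beta> * \<bar>x - y\<bar> powr \<beta>" for x y
  proof -
    have "\<bar>x / pi - y / pi\<bar> = \<bar>x - y\<bar> / pi"
      by (simp add: diff_divide_distrib[symmetric] abs_divide)
    then have "\<bar>x / pi - y / pi\<bar> powr \<beta> = \<bar>x - y\<bar> powr \<beta> / pi powr \<beta>"
      by (simp add: powr_divide)
    then show ?thesis using E[of "x / pi" "y / pi"] by (simp add: u_def)
  qed
  then show ?thesis unfolding holder_torus_def using u_periodic by blast
qed

text \<open>Across the first cell of level \<open>m\<close> the increment is
  \<open>1 / q ^ m\<close>, that is, \<open>b powr (- alpha * m)\<close>. A bound with exponent
  \<open>\<beta>\<close> would keep all powers of \<open>b powr (\<beta> - alpha)\<close>, a number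
  above 1, bounded.\<close>

lemma not_holder_u:
  assumes "alpha < \<beta>"
  shows "\<not> holder_torus \<beta> u"
proof
  assume "holder_torus \<beta> u"
  then obtain M where M: "\<And>x y. \<bar>u x - u y\<bar> \<le> M * \<bar>x - y\<bar> powr \<beta>"
    unfolding holder_torus_def by blast
  have le: "(real b powr (\<beta> - alpha)) ^ m \<le> M * pi powr \<beta>" for m
  proof -
    have "1 / real q ^ m = \<bar>u (pi / real b ^ m) - u 0\<bar>"
      using E_cell_increment[of 0 m] by (simp add: u_def)
    also have "\<dots> \<le> M * (pi / real b ^ m) powr \<beta>" using M[of "pi / real b ^ m" 0] by simp
    also have "\<dots> = M * pi powr \<beta> / (real b powr \<beta>) ^ m"
      using b_gt1 by (simp add: powr_divide powr_realpow[symmetric] powr_powr mult.commute)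
    finally have "1 / real q ^ m \<le> M * pi powr \<beta> / (real b powr \<beta>) ^ m" .
    moreover have "(real b powr (\<beta> - alpha)) ^ m = (real b powr \<beta>) ^ m / real q ^ m"
      using b_powr_alpha by (simp add: powr_diff power_divide)
    ultimately have "(real b powr (\<beta> - alpha)) ^ m \<le> (real b powr \<beta>) ^ m * (M * pi powr \<beta> / (real b powr \<beta>) ^ m)"
      using b_gt1 by (metis divide_inverse inverse_eq_divide mult_left_mono zero_le_power powr_ge_zero)
    then show ?thesis using b_gt1 by simp
  qed
  have "1 < real b powr (\<beta> - alpha)" using b_gt1 assms by simp
  then obtain m where "M * pi powr \<beta> < (real b powr (\<beta> - alpha)) ^ m" using real_arch_pow by blast
  with le[of m] show False by simp
qed

lemma sharply_holder_u: "sharply_holder alpha u"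
  unfolding sharply_holder_def using holder_u not_holder_u by force

section \<open>Oscillatory integrals along the velocity\<close>

definition K :: "real \<Rightarrow> real \<Rightarrow> complex" where
  "K l x = integral {0..x} (\<lambda>s. cis (l * E s))"

text \<open>The characteristic function of the distribution of \<open>V\<close> under Lebesgue
  measure on the unit interval.\<close>

definition J :: "real \<Rightarrow> complex" where
  "J l = K l 1"

lemma continuous_cis_E [continuous_intros]: "continuous_on A (\<lambda>s. cis (l * E s))"
  by (intro continuous_intros continuous_E)

lemma integrable_cis_E: "(\<lambda>s. cis (l * E s)) integrable_on {a..c}"
  by (intro integrable_continuous_real continuous_intros)

lemma K_combine: "0 \<le> x \<Longrightarrow> x \<le> y \<Longrightarrow> K l y = K l x + integral {x..y} (\<lambda>s. cis (l * E s))"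
  unfolding K_def
  by (subst Henstock_Kurzweil_Integration.integral_combine) (auto intro: integrable_cis_E)

text \<open>Mapping the cell affinely onto the unit interval divides the frequency by
  \<open>Q\<close> and turns the offset \<open>e\<close> into a phase.\<close>

lemma cell_integral:
  assumes "\<And>s. 0 \<le> s \<Longrightarrow> s \<le> 1 \<Longrightarrow> E ((c + s) / B) = e + V s / Q" "0 < B" "0 \<le> x" "x \<le> 1"
  shows "integral {c / B..(c + x) / B} (\<lambda>s. cis (l * E s)) = cis (l * e) / of_real B * K (l / Q) x"
proof -
  have "integral {(1 / B) * 0 + c / B..(1 / B) * x + c / B} (\<lambda>s. cis (l * E s)) =
      (1 / B) *\<^sub>R integral {0..x} (\<lambda>s. cis (l * E ((1 / B) * s + c / B)))"
    by (rule integral_affine) (use assms in \<open>auto intro: continuous_intros\<close>)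
  also have "integral {0..x} (\<lambda>s. cis (l * E ((1 / B) * s + c / B))) =
      integral {0..x} (\<lambda>s. cis (l * e) * cis (l / Q * E s))"
  proof (intro Henstock_Kurzweil_Integration.integral_cong)
    fix s assume s: "s \<in> {0..x}"
    then have "E ((1 / B) * s + c / B) = e + V s / Q"
      using assms(1)[of s] assms(4) by (simp add: add_divide_distrib add.commute)
    moreover have "E s = V s" using s assms(4) by (intro E_id) auto
    ultimately show "cis (l * E ((1 / B) * s + c / B)) = cis (l * e) * cis (l / Q * E s)"
      by (simp add: cis_mult distrib_left)
  qed
  also have "\<dots> = cis (l * e) * K (l / Q) x"
    unfolding K_def by (simp add: integral_mult_right)
  finally show ?thesis using assms(2) by (simp add: add_divide_distrib add.commute scaleR_conv_of_real)
qed

lemma cell_integral_reflected: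
  assumes "\<And>s. 0 \<le> s \<Longrightarrow> s \<le> 1 \<Longrightarrow> E ((c + s) / B) = e + V (1 - s) / Q" "0 < B" "0 \<le> x" "x \<le> 1"
  shows "integral {c / B..(c + x) / B} (\<lambda>s. cis (l * E s)) = cis (l * e) / of_real B * (J (l / Q) - K (l / Q) (1 - x))"
proof -
  have "integral {(1 / B) * 0 + c / B..(1 / B) * x + c / B} (\<lambda>s. cis (l * E s)) =
      (1 / B) *\<^sub>R integral {0..x} (\<lambda>s. cis (l * E ((1 / B) * s + c / B)))"
    by (rule integral_affine) (use assms in \<open>auto intro: continuous_intros\<close>)
  also have "integral {0..x} (\<lambda>s. cis (l * E ((1 / B) * s + c / B))) =
      integral {0..x} (\<lambda>s. cis (l * e) * cis (l / Q * E (1 - s)))"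
  proof (intro Henstock_Kurzweil_Integration.integral_cong)
    fix s assume s: "s \<in> {0..x}"
    then have "E ((1 / B) * s + c / B) = e + V (1 - s) / Q"
      using assms(1)[of s] assms(4) by (simp add: add_divide_distrib add.commute)
    moreover have "E (1 - s) = V (1 - s)" using s assms(4) by (intro E_id) auto
    ultimately show "cis (l * E ((1 / B) * s + c / B)) = cis (l * e) * cis (l / Q * E (1 - s))"
      by (simp add: cis_mult distrib_left)
  qed
  also have "\<dots> = cis (l * e) * integral {0..x} (\<lambda>s. cis (l / Q * E (1 - s)))"
    by (simp add: integral_mult_right)
  also have "integral {0..x} (\<lambda>s. cis (l / Q * E (1 - s))) = integral {1 - x..1 - 0} (\<lambda>s. cis (l / Q * E s))"
    by (rule integral_reflect[of "\<lambda>s. cis (l / Q * E s)"]) (intro continuous_intros)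
  also have "\<dots> = J (l / Q) - K (l / Q) (1 - x)"
    unfolding J_def using K_combine[of "1 - x" 1 "l / Q"] assms by simp
  finally show ?thesis using assms(2) by (simp add: add_divide_distrib add.commute scaleR_conv_of_real)
qed

lemma K_0: "K l 0 = 0"
  by (simp add: K_def)

text \<open>Uniform in the direction of the cell: \<open>y\<close> is \<open>x\<close> on an
  ascending cell and \<open>1 - x\<close> on a descending one, where the integral is a difference of
  \<open>J\<close> and \<open>K\<close>.\<close>

lemma cell_integral_norm:
  assumes "0 \<le> x" "x \<le> 1"
  obtains y where "0 \<le> y" "y \<le> 1"
    "cmod (integral {of_int i / real b ^ m..(of_int i + x) / real b ^ m} (\<lambda>s. cis (l * E s)))
      \<le> (cmod (J (l / real q ^ m)) + cmod (K (l / real q ^ m) y)) / real b ^ m"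
proof -
  have B: "0 < real b ^ m" using b_gt1 by simp
  show ?thesis
  proof (rule E_cell[of i m])
    fix e assume e: "\<And>s. 0 \<le> s \<Longrightarrow> s \<le> 1 \<Longrightarrow> E ((of_int i + s) / real b ^ m) = e + V s / real q ^ m"
    show ?thesis
      by (rule that[of x]) (use assms B in \<open>auto simp: cell_integral[OF e B assms] norm_mult norm_divide norm_power divide_right_mono\<close>)
  next
    fix e assume e: "\<And>s. 0 \<le> s \<Longrightarrow> s \<le> 1 \<Longrightarrow> E ((of_int i + s) / real b ^ m) = e + V (1 - s) / real q ^ m"
    show ?thesis
      by (rule that[of "1 - x"])
        (use assms B in \<open>auto simp: cell_integral_reflected[OF e B assms] norm_mult norm_divide norm_power intro!: divide_right_mono norm_triangle_ineq4\<close>)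
  qed
qed

lemma cell_integral_norm_full:
  "cmod (integral {of_int i / real b ^ m..(of_int i + 1) / real b ^ m} (\<lambda>s. cis (l * E s))) \<le> cmod (J (l / real q ^ m)) / real b ^ m"
proof -
  have B: "0 < real b ^ m" using b_gt1 by simp
  show ?thesis
  proof (rule E_cell[of i m])
    fix e assume e: "\<And>s. 0 \<le> s \<Longrightarrow> s \<le> 1 \<Longrightarrow> E ((of_int i + s) / real b ^ m) = e + V s / real q ^ m"
    show ?thesis
      using B by (simp add: cell_integral[OF e B] norm_mult norm_divide norm_power J_def)
  next
    fix e assume e: "\<And>s. 0 \<le> s \<Longrightarrow> s \<le> 1 \<Longrightarrow> E ((of_int i + s) / real b ^ m) = e + V (1 - s) / real q ^ m"
    show ?thesis
      using B by (simp add: cell_integral_reflected[OF e B] norm_mult norm_divide norm_power K_0)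
  qed
qed

lemma K_prefix: "K l (real n / real b) = (\<Sum>i<n. integral {real i / real b..(real i + 1) / real b} (\<lambda>s. cis (l * E s)))"
proof (induction n)
  case 0
  then show ?case by (simp add: K_0)
next
  case (Suc n)
  have "K l (real (Suc n) / real b) = K l (real n / real b) + integral {real n / real b..real (Suc n) / real b} (\<lambda>s. cis (l * E s))"
    by (rule K_combine) (auto intro: divide_right_mono)
  then show ?case using Suc by (simp add: add.commute)
qed

text \<open>Over a complete cell the direction is irrelevant, so the \<open>r\<close> crossings of
  strip \<open>j\<close> contribute the same phase, and averaging over the strips leaves a geometric
  sum.\<close>

lemma J_recursion: "J l = (\<Sum>j<q. cis (l / real q) ^ j) / of_nat q * J (l / real q)"
proof -
  have B: "0 < real b" using b_gt1 by simp
  have cell: "integral {real i / real b..(real i + 1) / real b} (\<lambda>s. cis (l * E s))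
      = cis (l * (real (i div r) / real q)) / of_nat b * J (l / real q)" if "i < b" for i
  proof -
    have ir: "i div r < q" "i mod r < r" "i div r * r + i mod r = i"
      using that r3 by (auto simp: b_def less_mult_imp_div_less)
    have rg: "0 \<le> (real i + s) / real b" "(real i + s) / real b \<le> 1" if "0 \<le> s" "s \<le> 1" for s
    proof -
      have "real i + 1 \<le> real b" using \<open>i < b\<close> by simp
      then show "(real i + s) / real b \<le> 1" using that B by (simp add: field_simps)
    qed (use that in auto)
    have V: "E ((real i + s) / real b) = real (i div r) / real q + V (if even (i mod r) then s else 1 - s) / real q"
      if "0 \<le> s" "s \<le> 1" for s
      using V_cell[OF ir(1,2) that] ir(3) E_id[OF rg[OF that]] by (simp add: add_divide_distrib)
    show ?thesis
    proof (cases "even (i mod r)")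
      case True
      with V have "\<And>s. 0 \<le> s \<Longrightarrow> s \<le> 1 \<Longrightarrow> E ((real i + s) / real b) = real (i div r) / real q + V s / real q" by simp
      from cell_integral[OF this B, of 1 l] show ?thesis by (simp add: J_def)
    next
      case False
      with V have "\<And>s. 0 \<le> s \<Longrightarrow> s \<le> 1 \<Longrightarrow> E ((real i + s) / real b) = real (i div r) / real q + V (1 - s) / real q" by simp
      from cell_integral_reflected[OF this B, of 1 l] show ?thesis by (simp add: K_0)
    qed
  qed
  have "J l = K l (real b / real b)" using B by (simp add: J_def)
  also have "\<dots> = (\<Sum>i<b. cis (l * (real (i div r) / real q)) / of_nat b * J (l / real q))"
    unfolding K_prefix by (intro sum.cong cell) auto
  also have "\<dots> = (\<Sum>i<q * r. cis (l * (real (i div r) / real q))) / of_nat b * J (l / real q)"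
    by (simp add: sum_divide_distrib sum_distrib_right b_def)
  also have "(\<Sum>i<q * r. cis (l * (real (i div r) / real q))) =
      (\<Sum>j<q. \<Sum>i\<in>{j * r..<j * r + r}. cis (l * (real (i div r) / real q)))"
    by (rule sum.nat_group[symmetric])
  also have "\<dots> = (\<Sum>j<q. \<Sum>i\<in>{j * r..<j * r + r}. cis (l / real q) ^ j)"
  proof (intro sum.cong refl)
    fix j i assume "i \<in> {j * r..<j * r + r}"
    then have "i div r = j" by (intro div_nat_eqI) (auto simp: mult.commute)
    then show "cis (l * (real (i div r) / real q)) = cis (l / real q) ^ j"
      by (simp add: Complex.DeMoivre mult_ac)
  qed
  also have "\<dots> = of_nat r * (\<Sum>j<q. cis (l / real q) ^ j)"
    by (simp add: sum_distrib_left)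
  finally show ?thesis using r3 by (simp add: b_def field_simps)
qed

lemma J0_recursion: "l \<noteq> 0 \<Longrightarrow> J0 l = (\<Sum>j<q. cis (l / real q) ^ j) / of_nat q * J0 (l / real q)"
proof -
  assume l: "l \<noteq> 0"
  have "(cis (l / real q) - 1) * (\<Sum>j<q. cis (l / real q) ^ j) = cis (l / real q) ^ q - 1"
    by (rule power_diff_1_eq[symmetric])
  also have "cis (l / real q) ^ q = cis l" using q_gt1 by (simp add: Complex.DeMoivre)
  finally have "cis l - 1 = (cis (l / real q) - 1) * (\<Sum>j<q. cis (l / real q) ^ j)" ..
  then show ?thesis using l q_gt1 by (simp add: J0_value)
qed

text \<open>The push-forward of Lebesgue measure under \<open>V\<close> is Lebesgue measure: both characteristic
  functions satisfy the same functional equation \<open>J l = D l * J (l / q)\<close> with \<open>\<bar>D l\<bar> \<le> 1\<close>, are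
  continuous at \<open>0\<close> and equal \<open>1\<close> there.\<close>

lemma J_value:
  assumes "l \<noteq> 0"
  shows "J l = (cis l - 1) / (\<i> * of_real l)"
proof -
  have c: "cmod (J x - J0 x) \<le> cmod (J (x / real q) - J0 (x / real q))" if "x \<noteq> 0" for x
  proof -
    have "J x - J0 x = (\<Sum>j<q. cis (x / real q) ^ j) / of_nat q * (J (x / real q) - J0 (x / real q))"
      using J_recursion[of x] J0_recursion[OF that] by (simp add: right_diff_distrib)
    moreover have "cmod ((\<Sum>j<q. cis (x / real q) ^ j) / of_nat q) \<le> 1"
    proof -
      have "cmod (\<Sum>j<q. cis (x / real q) ^ j) \<le> (\<Sum>j<q. 1)"
        by (intro sum_norm_le) (simp add: norm_power)
      then show ?thesis using q_gt1 by (simp add: norm_divide)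
    qed
    ultimately show ?thesis by (simp only: norm_mult mult_left_le_one_le norm_ge_zero)
  qed
  have it: "cmod (J l - J0 l) \<le> cmod (J (l / real q ^ m) - J0 (l / real q ^ m))" for m
  proof (induction m)
    case (Suc m)
    have "l / real q ^ m \<noteq> 0" using assms q_gt1 by simp
    from order_trans[OF Suc c[OF this]] show ?case by (simp add: mult.commute)
  qed simp
  have small: "cmod (J x - J0 x) \<le> 2 * \<bar>x\<bar>" for x
  proof -
    have "cmod (J x - 1) \<le> \<bar>x\<bar>" "cmod (J0 x - 1) \<le> \<bar>x\<bar>"
      unfolding J_def K_def J0_def using E_range
      by (auto intro!: norm_integral_cis_minus_1 continuous_E)
    then show ?thesis using norm_triangle_ineq4[of "J x - 1" "J0 x - 1"] by simp
  qed
  have "(\<lambda>m. 2 * \<bar>l\<bar> * (1 / real q) ^ m) \<longlonglongrightarrow> 2 * \<bar>l\<bar> * 0"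
    using q_gt1 by (intro tendsto_intros LIMSEQ_power_zero) auto
  then have "cmod (J l - J0 l) \<le> 2 * \<bar>l\<bar> * 0"
  proof (rule LIMSEQ_le_const)
    have "cmod (J l - J0 l) \<le> 2 * \<bar>l\<bar> * (1 / real q) ^ m" for m
      using order_trans[OF it small, of m] by (simp add: power_one_over abs_divide)
    then show "\<exists>N. \<forall>m\<ge>N. cmod (J l - J0 l) \<le> 2 * \<bar>l\<bar> * (1 / real q) ^ m" by blast
  qed
  then show ?thesis using J0_value[OF assms] by simp
qed

lemma J_bound:
  assumes "l \<noteq> 0"
  shows "cmod (J l) \<le> 2 / \<bar>l\<bar>"
proof -
  have "cmod (cis l - 1) \<le> 2" using norm_triangle_ineq4[of "cis l" 1] by simp
  then show ?thesis using assms by (simp add: J_value norm_divide norm_mult divide_right_mono)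
qed

lemma J_zero: "k \<noteq> 0 \<Longrightarrow> J (2 * pi * of_int k) = 0"
  using cis_multiple_2pi[of "of_int k"] by (simp add: J_value)

text \<open>The complete cells to the left of \<open>x\<close> give at most
  \<open>cmod (J (l / q))\<close> in total. The cell that contains \<open>x\<close> gives at worst a
  fraction \<open>1 / b\<close> of that and, with the same fraction, a rescaled
  \<open>K\<close>.\<close>

lemma K_recursion_bound:
  assumes "0 \<le> x" "x \<le> 1"
  obtains y where "0 \<le> y" "y \<le> 1" "cmod (K l x) \<le> 2 * cmod (J (l / real q)) + cmod (K (l / real q) y) / real b"
proof -
  \<comment> \<open>The minimum puts \<open>x = 1\<close> into the last cell, with
    \<open>s = 1\<close>.\<close>
  define i where "i = min (nat \<lfloor>x * real b\<rfloor>) (b - 1)"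
  define s where "s = x * real b - real i"
  have b: "0 < real b" using b_gt1 by simp
  have "0 \<le> x * real b" using assms b by simp
  then have fl: "real (nat \<lfloor>x * real b\<rfloor>) \<le> x * real b" "x * real b < real (nat \<lfloor>x * real b\<rfloor>) + 1"
    by linarith+
  have "x * real b \<le> real b" using assms b by simp
  have s: "0 \<le> s" "s \<le> 1"
  proof -
    show "0 \<le> s" using fl by (simp add: s_def i_def)
    show "s \<le> 1"
    proof (cases "nat \<lfloor>x * real b\<rfloor> \<le> b - 1")
      case True
      then have "i = nat \<lfloor>x * real b\<rfloor>" by (simp add: i_def)
      then show ?thesis using fl unfolding s_def by linarith
    next
      case False
      then have "real i = real b - 1" using b by (simp add: i_def of_nat_diff)
      then show ?thesis using \<open>x * real b \<le> real b\<close> unfolding s_def by linarith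
    qed
  qed
  have i: "real i \<le> real b" using b by (simp add: i_def)
  have x: "x = (real i + s) / real b" using b by (simp add: s_def)
  obtain y where y: "0 \<le> y" "y \<le> 1"
    "cmod (integral {of_int (int i) / real b ^ 1..(of_int (int i) + s) / real b ^ 1} (\<lambda>s. cis (l * E s)))
      \<le> (cmod (J (l / real q ^ 1)) + cmod (K (l / real q ^ 1) y)) / real b ^ 1"
    using s by (rule cell_integral_norm)
  have "cmod (integral {real i / real b..x} (\<lambda>s. cis (l * E s)))
      \<le> cmod (J (l / real q)) / real b + cmod (K (l / real q) y) / real b"
    using y(3) unfolding x by (simp add: add_divide_distrib)
  moreover have "cmod (K l x) \<le> cmod (K l (real i / real b)) + cmod (integral {real i / real b..x} (\<lambda>s. cis (l * E s)))"
  proof -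
    have "K l x = K l (real i / real b) + integral {real i / real b..x} (\<lambda>s. cis (l * E s))"
      using s b unfolding x by (intro K_combine) (auto intro: divide_right_mono)
    then show ?thesis using norm_triangle_ineq by metis
  qed
  moreover have "cmod (K l (real i / real b)) \<le> real i / real b * cmod (J (l / real q))"
  proof -
    have "cmod (K l (real i / real b)) \<le> (\<Sum>j<i. cmod (J (l / real q)) / real b)"
      unfolding K_prefix
      by (intro sum_norm_le) (use cell_integral_norm_full[of "int _" 1 l] in simp)
    then show ?thesis by simp
  qed
  moreover have "real i / real b * cmod (J (l / real q)) + cmod (J (l / real q)) / real b \<le> 2 * cmod (J (l / real q))"
  proof -
    have "real i / real b + 1 / real b \<le> 2" using i b b_gt1 by (simp add: field_simps)
    from mult_right_mono[OF this, of "cmod (J (l / real q))"] show ?thesis by (simp add: distrib_right)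
  qed
  ultimately have "cmod (K l x) \<le> 2 * cmod (J (l / real q)) + cmod (K (l / real q) y) / real b"
    by linarith
  with y show ?thesis by (intro that)
qed

lemma K_trivial_bound:
  assumes "0 \<le> x" "x \<le> 1"
  shows "cmod (K l x) \<le> 1"
proof -
  have "cmod (K l x) \<le> 1 * (x - 0)"
    unfolding K_def using assms by (intro integral_bound) (auto intro: continuous_intros)
  then show ?thesis using assms by simp
qed

text \<open>One application of \<open>K_recursion_bound\<close> contributes
  \<open>4 * q / \<bar>l\<bar>\<close> through \<open>J_bound\<close>, and the rescaled term
  \<open>(6 / r) * q / \<bar>l\<bar>\<close>, at most \<open>2 * q / \<bar>l\<bar>\<close>: the
  constant 6 reproduces itself. The remainder \<open>(1 / b) ^ m\<close> from the trivial bound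
  disappears in the limit.\<close>

lemma K_bound:
  assumes "l \<noteq> 0" "0 \<le> x" "x \<le> 1"
  shows "cmod (K l x) \<le> 6 * real q / \<bar>l\<bar>"
proof -
  have *: "l \<noteq> 0 \<Longrightarrow> 0 \<le> x \<Longrightarrow> x \<le> 1 \<Longrightarrow> cmod (K l x) \<le> 6 * real q / \<bar>l\<bar> + (1 / real b) ^ m" for m l x
  proof (induction m arbitrary: l x)
    case 0
    then show ?case using K_trivial_bound[of x l] by (simp add: add_increasing)
  next
    case (Suc m)
    obtain y where y: "0 \<le> y" "y \<le> 1" "cmod (K l x) \<le> 2 * cmod (J (l / real q)) + cmod (K (l / real q) y) / real b"
      using Suc.prems(2,3) by (rule K_recursion_bound)
    have l: "l / real q \<noteq> 0" using Suc.prems q_gt1 by simp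
    have "cmod (J (l / real q)) \<le> 2 * real q / \<bar>l\<bar>" using J_bound[OF l] by (simp add: abs_divide)
    moreover have "cmod (K (l / real q) y) / real b \<le> (6 * real q * real q / \<bar>l\<bar> + (1 / real b) ^ m) / real b"
      using Suc.IH[OF l y(1,2)] b_gt1 by (intro divide_right_mono) (auto simp: abs_divide)
    moreover have "(6 * real q * real q / \<bar>l\<bar> + (1 / real b) ^ m) / real b = (6 / real r) * (real q / \<bar>l\<bar>) + (1 / real b) ^ Suc m"
      using q_gt1 r3 by (simp add: b_def field_simps)
    moreover have "(6 / real r) * (real q / \<bar>l\<bar>) \<le> 2 * (real q / \<bar>l\<bar>)"
      using r3 by (intro mult_right_mono) (auto simp: field_simps)
    ultimately show ?case using y(3) by simp
  qed
  have "(\<lambda>m. 6 * real q / \<bar>l\<bar> + (1 / real b) ^ m) \<longlonglongrightarrow> 6 * real q / \<bar>l\<bar> + 0"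
    using b_gt1 by (intro tendsto_intros LIMSEQ_power_zero) auto
  then have "cmod (K l x) \<le> 6 * real q / \<bar>l\<bar> + 0"
    by (rule LIMSEQ_le_const) (use *[OF assms] in blast)
  then show ?thesis by simp
qed

text \<open>At these frequencies \<open>J\<close> vanishes after each of the \<open>m\<close>
  divisions by \<open>q\<close>, so only the partial cell survives and gains a factor
  \<open>1 / b\<close> every time; the trivial bound ends the recursion.\<close>

lemma K_resonant_bound:
  assumes "k \<noteq> 0" "0 \<le> x" "x \<le> 1"
  shows "cmod (K (2 * pi * of_int k * real q ^ m) x) \<le> 1 / real b ^ m"
  using assms(2,3)
proof (induction m arbitrary: x)
  case 0
  then show ?case using K_trivial_bound by simp
next
  case (Suc m)
  let ?l = "2 * pi * of_int k * real q ^ Suc m"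
  obtain y where y: "0 \<le> y" "y \<le> 1" "cmod (K ?l x) \<le> 2 * cmod (J (?l / real q)) + cmod (K (?l / real q) y) / real b"
    using Suc.prems by (rule K_recursion_bound)
  have l: "?l / real q = 2 * pi * of_int (k * int q ^ m)" "?l / real q = 2 * pi * of_int k * real q ^ m"
    using q_gt1 by auto
  have "J (?l / real q) = 0" unfolding l(1) using assms(1) q3 by (intro J_zero) auto
  with y(3) have "cmod (K ?l x) \<le> cmod (K (?l / real q) y) / real b" by simp
  also have "\<dots> \<le> 1 / real b ^ m / real b"
    using Suc.IH[OF y(1,2)] unfolding l(2) by (intro divide_right_mono) auto
  finally show ?case by (simp add: mult.commute)
qed

definition G :: "real \<Rightarrow> real \<Rightarrow> complex" where
  "G l y = integral {0..y} (\<lambda>s. cis (l * u s))"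

lemma G_eq:
  assumes "0 \<le> y"
  shows "G l y = of_real pi * K l (y / pi)"
proof -
  have "integral {pi * 0 + 0..pi * (y / pi) + 0} (\<lambda>s. cis (l * u s)) = pi *\<^sub>R integral {0..y / pi} (\<lambda>s. cis (l * u (pi * s + 0)))"
    using assms by (intro integral_affine continuous_intros continuous_u) auto
  then show ?thesis by (simp add: G_def K_def u_def scaleR_conv_of_real)
qed

text \<open>\<open>E\<close> is symmetric about 1, so the part beyond 1 repeats the integral over
  \<open>{2 - x..1}\<close>.\<close>

lemma K_beyond_1:
  assumes "1 \<le> x" "x \<le> 2"
  shows "K l x = 2 * J l - K l (2 - x)"
proof -
  have "integral {real_of_int 1 / 1..(of_int 1 + (x - 1)) / 1} (\<lambda>s. cis (l * E s)) =
     cis (l * 0) / of_real 1 * (J (l / 1) - K (l / 1) (1 - (x - 1)))"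
    by (rule cell_integral_reflected) (use assms in \<open>auto simp: E_def tri_int_add[where n = 1, simplified]\<close>)
  moreover have "K l x = K l 1 + integral {1..x} (\<lambda>s. cis (l * E s))"
    using assms by (intro K_combine) auto
  ultimately show ?thesis by (simp add: J_def)
qed

text \<open>The factor 3 comes from \<open>2 * J l - K l (2 - x)\<close> on the second half of the
  period, and \<open>pi\<close> from the change of scale.\<close>

lemma G_norm:
  assumes "0 \<le> y" "y \<le> 2 * pi" "\<And>x. 0 \<le> x \<Longrightarrow> x \<le> 1 \<Longrightarrow> cmod (K l x) \<le> c"
  shows "cmod (G l y) \<le> 3 * pi * c"
proof -
  have "cmod (K l (y / pi)) \<le> 3 * c"
  proof (cases "y / pi \<le> 1")
    case True
    then have "cmod (K l (y / pi)) \<le> c" using assms by simp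
    moreover have "0 \<le> c" using assms(3)[of 0] by (simp add: K_0)
    ultimately show ?thesis by simp
  next
    case False
    then have "cmod (K l (2 - y / pi)) \<le> c" "cmod (J l) \<le> c"
      using assms by (auto simp: J_def field_simps intro!: assms(3))
    moreover have "K l (y / pi) = 2 * J l - K l (2 - y / pi)"
      using False assms by (intro K_beyond_1) (auto simp: field_simps)
    ultimately show ?thesis using norm_triangle_ineq4[of "2 * J l" "K l (2 - y / pi)"] by (simp add: norm_mult)
  qed
  then show ?thesis using assms(1) by (simp add: G_eq norm_mult)
qed

lemma G_full: "G l (2 * pi) = of_real (2 * pi) * J l"
  by (simp add: G_eq K_beyond_1 K_0)

end

subsection \<open>Inviscid mixing\<close>

lemma tp_has_vector_derivative:
  "(tp N c has_vector_derivative tp N (\<lambda>n. \<i> * of_int n * c n) y) (at y within A)"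
proof -
  have "((\<lambda>y. \<Sum>n\<in>{-int N..int N}. c n * cis (of_int n * y)) has_vector_derivative
      (\<Sum>n\<in>{-int N..int N}. c n * (\<i> * of_real (of_int n) * cis (of_int n * y)))) (at y within A)"
    by (intro has_vector_derivative_sum has_vector_derivative_mult_right has_vector_derivative_cis_mult)
  then show ?thesis
    unfolding tp_def[abs_def] by (simp add: mult_ac)
qed

lemma tp_mult_cnj_has_vector_derivative:
  "((\<lambda>y. tp M a y * cnj (tp N d y)) has_vector_derivative
     (tp M a y * cnj (tp N (\<lambda>n. \<i> * of_int n * d n) y) + tp M (\<lambda>n. \<i> * of_int n * a n) y * cnj (tp N d y))) (at y within A)"
  by (intro has_vector_derivative_mult tp_has_vector_derivative has_vector_derivative_cnj)

lemma sum_weight_split: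
  "(\<Sum>n\<in>A. (cmod (c n))\<^sup>2) \<le> (\<Sum>n\<in>A. (1 + (of_int n)\<^sup>2) * (cmod (c n))\<^sup>2)"
  "(\<Sum>n\<in>A. (cmod (\<i> * of_int n * c n))\<^sup>2) \<le> (\<Sum>n\<in>A. (1 + (of_int n)\<^sup>2) * (cmod (c n))\<^sup>2)"
  by (intro sum_mono; simp add: norm_mult power_mult_distrib distrib_right)+

text \<open>Integration by parts against the primitive \<open>G\<close> of \<open>w\<close>, corrected by a linear function so
  that it vanishes at both ends of the period.\<close>

lemma oscillatory_pairing_tp:
  assumes w: "continuous_on UNIV w"
    and G: "\<And>y. 0 \<le> y \<Longrightarrow> y \<le> 2 * pi \<Longrightarrow> cmod (integral {0..y} w) \<le> g"
    and H: "(\<Sum>n\<in>{-int M..int M}. (1 + (of_int n)\<^sup>2) * (cmod (a n))\<^sup>2) \<le> H"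
    and S: "(\<Sum>n\<in>{-int N..int N}. (1 + (of_int n)\<^sup>2) * (cmod (d n))\<^sup>2) \<le> S"
  shows "cmod (LINT y|torus. w y * tp M a y * cnj (tp N d y)) \<le> 2 * pi * (5 * g * (sqrt H * sqrt S))"
proof -
  define Gt where "Gt y = integral {0..y} w - of_real (y / (2 * pi)) * integral {0..2 * pi} w" for y
  define f where "f = tp M a"
  define f' where "f' = tp M (\<lambda>n. \<i> * of_int n * a n)"
  define p where "p = tp N d"
  define p' where "p' = tp N (\<lambda>n. \<i> * of_int n * d n)"
  define I where "I = integral {0..2 * pi} w"
  have cont: "continuous_on A f" "continuous_on A f'" "continuous_on A p" "continuous_on A p'" for A
    unfolding f_def f'_def p_def p'_def by (intro continuous_intros)+
  have L2: "f \<in> L2 torus" "f' \<in> L2 torus" "p \<in> L2 torus" "p' \<in> L2 torus"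
    unfolding f_def f'_def p_def p'_def by (intro tp_L2)+
  have cw: "continuous_on A w" for A using w by (rule continuous_on_subset) auto
  have "0 \<le> g" using G[of 0] by simp
  have H0: "0 \<le> H" by (rule order_trans[OF _ H]) (intro sum_nonneg mult_nonneg_nonneg; simp)
  have S0: "0 \<le> S" by (rule order_trans[OF _ S]) (intro sum_nonneg mult_nonneg_nonneg; simp)
  have sqrt_HS: "sqrt (2 * pi * H) * sqrt (2 * pi * S) = 2 * pi * (sqrt H * sqrt S)"
  proof -
    have "sqrt (2 * pi * H) * sqrt (2 * pi * S) = (sqrt (2 * pi) * sqrt (2 * pi)) * (sqrt H * sqrt S)"
      unfolding real_sqrt_mult[of "2 * pi"] by (simp only: mult_ac)
    moreover have "sqrt (2 * pi) * sqrt (2 * pi) = 2 * pi" by (intro real_sqrt_mult_self[THEN trans]) simp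
    ultimately show ?thesis by (simp only:)
  qed
  have GD: "(Gt has_vector_derivative (w y - of_real (1 / (2 * pi)) * I)) (at y within {0..2 * pi})"
    if "y \<in> {0..2 * pi}" for y
  proof -
    have "((\<lambda>y. integral {0..y} w) has_vector_derivative w y) (at y within {0..2 * pi})"
      using that by (intro integral_has_vector_derivative cw)
    moreover have "((\<lambda>y. of_real (y / (2 * pi)) * I) has_vector_derivative of_real (1 / (2 * pi)) * I) (at y within {0..2 * pi})"
      by (auto intro!: derivative_eq_intros has_vector_derivative_mult_left has_vector_derivative_of_real
          simp: has_real_derivative_iff_has_vector_derivative[symmetric])
    ultimately show ?thesis unfolding Gt_def I_def by (rule has_vector_derivative_diff)
  qed
  have cG: "continuous_on {0..2 * pi} Gt"
    using GD by (intro continuous_on_vector_derivative) auto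
  have "cmod I \<le> g" unfolding I_def by (rule G) auto
  have Gb: "cmod (Gt y) \<le> 2 * g" if "y \<in> {0..2 * pi}" for y
  proof -
    have "cmod (of_real (y / (2 * pi)) * I) \<le> 1 * g"
      unfolding norm_mult norm_of_real using that \<open>cmod I \<le> g\<close> by (intro mult_mono) auto
    moreover have "cmod (integral {0..y} w) \<le> g" using that by (intro G) auto
    ultimately show ?thesis
      using norm_triangle_ineq4[of "integral {0..y} w" "of_real (y / (2 * pi)) * I"]
      unfolding Gt_def I_def by linarith
  qed
  have Gend: "Gt 0 = 0" "Gt (2 * pi) = 0" by (auto simp: Gt_def)
  let ?q = "\<lambda>y. f y * cnj (p' y) + f' y * cnj (p y)"
  have "((\<lambda>y. Gt y * ?q y + (w y - of_real (1 / (2 * pi)) * I) * (f y * cnj (p y))) has_integral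
      Gt (2 * pi) * (f (2 * pi) * cnj (p (2 * pi))) - Gt 0 * (f 0 * cnj (p 0))) {0..2 * pi}"
  proof (rule fundamental_theorem_of_calculus)
    fix y assume "y \<in> {0..2 * pi}"
    from has_vector_derivative_mult[OF GD[OF this] tp_mult_cnj_has_vector_derivative[of M a N d y]]
    show "((\<lambda>y. Gt y * (f y * cnj (p y))) has_vector_derivative
        Gt y * ?q y + (w y - of_real (1 / (2 * pi)) * I) * (f y * cnj (p y))) (at y within {0..2 * pi})"
      unfolding f_def f'_def p_def p'_def .
  qed auto
  then have z: "((\<lambda>y. Gt y * ?q y + (w y * f y * cnj (p y) - of_real (1 / (2 * pi)) * I * (f y * cnj (p y)))) has_integral 0) {0..2 * pi}"
    unfolding Gend by (simp add: algebra_simps)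
  have i1: "(\<lambda>y. Gt y * ?q y) integrable_on {0..2 * pi}" and i2: "(\<lambda>y. w y * f y * cnj (p y)) integrable_on {0..2 * pi}"
    and i3: "(\<lambda>y. of_real (1 / (2 * pi)) * I * (f y * cnj (p y))) integrable_on {0..2 * pi}"
    by (intro integrable_continuous_real continuous_intros cG cont cw)+
  have "integral {0..2 * pi} (\<lambda>y. Gt y * ?q y) + (integral {0..2 * pi} (\<lambda>y. w y * f y * cnj (p y))
      - integral {0..2 * pi} (\<lambda>y. of_real (1 / (2 * pi)) * I * (f y * cnj (p y)))) = 0"
    using has_integral_unique[OF z has_integral_add[OF integrable_integral[OF i1]
      has_integral_diff[OF integrable_integral[OF i2] integrable_integral[OF i3]]]] by simp
  then have split: "integral {0..2 * pi} (\<lambda>y. w y * f y * cnj (p y)) =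
      of_real (1 / (2 * pi)) * I * integral {0..2 * pi} (\<lambda>y. f y * cnj (p y)) - integral {0..2 * pi} (\<lambda>y. Gt y * ?q y)"
    by (simp add: integral_mult_right algebra_simps add_eq_0_iff)
  \<comment> \<open>The term left by the linear correction involves \<open>w\<close> through its
    total integral only, and \<open>cmod I \<le> g\<close> makes it small without integrating by
    parts.\<close>
  have "cmod (of_real (1 / (2 * pi)) * I * integral {0..2 * pi} (\<lambda>y. f y * cnj (p y))) \<le> g * (sqrt H * sqrt S)"
    (is "?L1 \<le> _")
  proof -
    have "integral {0..2 * pi} (\<lambda>y. f y * cnj (p y)) = (LINT y|torus. f y * cnj (p y))"
      by (intro torus_integral_eq[symmetric] continuous_intros cont)
    moreover have "cmod (LINT y|torus. f y * cnj (p y)) \<le> L2nrm torus f * L2nrm torus (\<lambda>y. cnj (p y))"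
      by (intro L2_Cauchy_Schwarz L2 L2_cnj)
    moreover have "L2nrm torus (\<lambda>y. cnj (p y)) = L2nrm torus p" by (simp add: L2nrm_def)
    moreover have "L2nrm torus f * L2nrm torus p \<le> sqrt (2 * pi * H) * sqrt (2 * pi * S)"
      using L2nrm_tp[of M a] L2nrm_tp[of N d] order_trans[OF sum_weight_split(1) H] order_trans[OF sum_weight_split(1) S]
      unfolding f_def p_def by (intro mult_mono real_le_rsqrt) (use H0 S0 in auto)
    ultimately have "cmod (integral {0..2 * pi} (\<lambda>y. f y * cnj (p y))) \<le> 2 * pi * (sqrt H * sqrt S)"
      unfolding sqrt_HS by simp
    then have "cmod (of_real (1 / (2 * pi)) * I) * cmod (integral {0..2 * pi} (\<lambda>y. f y * cnj (p y))) \<le>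
        1 / (2 * pi) * g * (2 * pi * (sqrt H * sqrt S))"
      using \<open>cmod I \<le> g\<close> \<open>0 \<le> g\<close> by (intro mult_mono) (auto simp: norm_mult norm_divide divide_right_mono)
    also have "\<dots> = g * (sqrt H * sqrt S)" by simp
    finally show ?thesis by (simp only: norm_mult)
  qed
  moreover have "cmod (integral {0..2 * pi} (\<lambda>y. Gt y * ?q y)) \<le> 2 * g * (2 * (2 * pi * (sqrt H * sqrt S)))"
    (is "?L2 \<le> _")
  proof -
    have cq: "continuous_on A (\<lambda>y. cmod (f y) * cmod (p' y) + cmod (f' y) * cmod (p y))" for A
      by (intro continuous_intros cont)
    have "?L2 \<le> integral {0..2 * pi} (\<lambda>y. 2 * g * (cmod (f y) * cmod (p' y) + cmod (f' y) * cmod (p y)))"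
    proof (rule integral_norm_bound_integral[OF i1])
      show "(\<lambda>y. 2 * g * (cmod (f y) * cmod (p' y) + cmod (f' y) * cmod (p y))) integrable_on {0..2 * pi}"
        by (intro integrable_continuous_real continuous_intros cq cont)
      fix y assume "y \<in> {0..2 * pi}"
      then show "norm (Gt y * ?q y) \<le> 2 * g * (cmod (f y) * cmod (p' y) + cmod (f' y) * cmod (p y))"
        unfolding norm_mult using Gb \<open>0 \<le> g\<close>
        by (intro mult_mono order_trans[OF norm_triangle_ineq]) (auto simp: norm_mult)
    qed
    also have "\<dots> = 2 * g * integral {0..2 * pi} (\<lambda>y. cmod (f y) * cmod (p' y) + cmod (f' y) * cmod (p y))"
      by (simp add: integral_mult_right)
    also have "integral {0..2 * pi} (\<lambda>y. cmod (f y) * cmod (p' y) + cmod (f' y) * cmod (p y)) =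
       (LINT y|torus. cmod (f y) * cmod (p' y) + cmod (f' y) * cmod (p y))"
      by (rule torus_integral_eq[OF cq, symmetric])
    also have "\<dots> = (LINT y|torus. cmod (f y) * cmod (p' y)) + (LINT y|torus. cmod (f' y) * cmod (p y))"
      by (intro Bochner_Integration.integral_add L2_integrable_mult_cmod L2)
    also have "\<dots> \<le> L2nrm torus f * L2nrm torus p' + L2nrm torus f' * L2nrm torus p"
      by (intro add_mono L2_Cauchy_Schwarz_cmod L2)
    also have "\<dots> \<le> sqrt (2 * pi * H) * sqrt (2 * pi * S) + sqrt (2 * pi * H) * sqrt (2 * pi * S)"
      using L2nrm_tp[of M a] L2nrm_tp[of N d] L2nrm_tp[of M "\<lambda>n. \<i> * of_int n * a n"] L2nrm_tp[of N "\<lambda>n. \<i> * of_int n * d n"]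
        order_trans[OF sum_weight_split(1) H] order_trans[OF sum_weight_split(1) S]
        order_trans[OF sum_weight_split(2) H] order_trans[OF sum_weight_split(2) S]
      unfolding f_def p_def f'_def p'_def by (intro add_mono mult_mono real_le_rsqrt) (use H0 S0 in auto)
    also have "\<dots> = 2 * (2 * pi * (sqrt H * sqrt S))"
      unfolding sqrt_HS by simp
    finally show ?thesis using \<open>0 \<le> g\<close> by (simp add: mult_left_mono)
  qed
  moreover have "cmod (x - y) \<le> A + B" if "cmod x \<le> A" "cmod y \<le> B" for x y and A B :: real
    using norm_triangle_ineq4[of x y] that by linarith
  ultimately have "cmod (integral {0..2 * pi} (\<lambda>y. w y * f y * cnj (p y))) \<le>
      g * (sqrt H * sqrt S) + 2 * g * (2 * (2 * pi * (sqrt H * sqrt S)))"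
    unfolding split by blast
  moreover have "(LINT y|torus. w y * tp M a y * cnj (tp N d y)) = integral {0..2 * pi} (\<lambda>y. w y * f y * cnj (p y))"
    unfolding f_def p_def by (intro torus_integral_eq continuous_intros cw)
  ultimately have "cmod (LINT y|torus. w y * tp M a y * cnj (tp N d y)) \<le>
      g * (sqrt H * sqrt S) + 2 * g * (2 * (2 * pi * (sqrt H * sqrt S)))" by (simp only:)
  also have "\<dots> = (1 + 8 * pi) * (g * (sqrt H * sqrt S))" by (simp add: algebra_simps)
  also have "\<dots> \<le> (10 * pi) * (g * (sqrt H * sqrt S))"
  proof (rule mult_right_mono)
    show "0 \<le> g * (sqrt H * sqrt S)" using \<open>0 \<le> g\<close> H0 S0 by simp
  qed (use pi_gt3 in simp)
  finally show ?thesis by (simp add: mult_ac)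
qed

text \<open>Duality. Pairing \<open>h\<close> with its truncated Riesz representative
  \<open>d\<close> returns the squared negative norm \<open>S\<close>, and the squared H1 norm of
  \<open>d\<close> is \<open>S\<close> again. The pairing bound thus reads
  \<open>S \<le> 5 * g * (sqrt H * sqrt S)\<close>, and one root cancels.\<close>

lemma mixing_bound:
  assumes w: "continuous_on UNIV w" "\<And>y. cmod (w y) \<le> 1"
    and G: "\<And>y. 0 \<le> y \<Longrightarrow> y \<le> 2 * pi \<Longrightarrow> cmod (integral {0..y} w) \<le> g"
    and f: "f \<in> L2 torus"
    and H: "\<And>M::nat. (\<Sum>n\<in>{-int M..int M}. (1 + (of_int n)\<^sup>2) * (cmod (fc f n))\<^sup>2) \<le> H"
  shows "(\<Sum>n\<in>{-int N..int N}. (cmod (fc (\<lambda>y. w y * f y) n))\<^sup>2 / (1 + (of_int n)\<^sup>2)) \<le> 25 * g\<^sup>2 * H"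
proof -
  define h where "h = (\<lambda>y. w y * f y)"
  define d where "d n = fc h n / of_real (1 + (of_int n)\<^sup>2)" for n
  define S where "S = (\<Sum>n\<in>{-int N..int N}. (cmod (fc h n))\<^sup>2 / (1 + (of_int n)\<^sup>2))"
  have pos: "0 < 1 + (real_of_int n)\<^sup>2" for n by (simp add: add_pos_nonneg)
  have wm: "w \<in> borel_measurable torus" using w(1) by (rule continuous_measurable_torus)
  have h: "h \<in> L2 torus" unfolding h_def using f wm w(2) by (rule L2_bounded_mult)
  have "0 \<le> g" using G[of 0] by simp
  have "0 \<le> S" unfolding S_def using pos by (intro sum_nonneg divide_nonneg_pos) auto
  have "0 \<le> (cmod (fc f 0))\<^sup>2" by (rule zero_le_power2)
  also have "\<dots> \<le> H" using H[of 0] by simp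
  finally have "0 \<le> H" .
  have Sd: "(\<Sum>n\<in>{-int N..int N}. (1 + (of_int n)\<^sup>2) * (cmod (d n))\<^sup>2) = S"
    unfolding S_def
  proof (intro sum.cong refl)
    fix n :: int
    have "cmod (d n) = cmod (fc h n) / (1 + (real_of_int n)\<^sup>2)"
      unfolding d_def norm_divide using pos[of n] by (simp only: norm_of_real abs_of_pos)
    then show "(1 + (real_of_int n)\<^sup>2) * (cmod (d n))\<^sup>2 = (cmod (fc h n))\<^sup>2 / (1 + (real_of_int n)\<^sup>2)"
      using pos[of n] by (simp add: power_divide power2_eq_square[of "1 + _"])
  qed
  have pair: "(LINT y|torus. h y * cnj (tp N d y)) = of_real (2 * pi * S)"
  proof -
    have "fc h n * cnj (d n) = of_real ((cmod (fc h n))\<^sup>2 / (1 + (of_int n)\<^sup>2))" for n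
      unfolding d_def by (simp add: complex_norm_square of_real_divide del: of_real_add of_real_power)
    then show ?thesis
      unfolding L2_mult_cnj_tp[OF h] S_def by (simp only: of_real_mult of_real_sum)
  qed
  have bM: "cmod (LINT y|torus. w y * tp M (fc f) y * cnj (tp N d y)) \<le> 2 * pi * (5 * g * (sqrt H * sqrt S))" for M
    by (rule oscillatory_pairing_tp[OF w(1) G H]) (simp_all add: Sd)
  \<comment> \<open>The pairing bound is available for truncations of \<open>f\<close>; the
    remainder of \<open>f\<close> is bounded in L2 and vanishes as \<open>M\<close> grows.\<close>
  have "cmod (LINT y|torus. h y * cnj (tp N d y)) \<le>
      2 * pi * (5 * g * (sqrt H * sqrt S)) + L2nrm torus (\<lambda>y. f y - tp M (fc f) y) * L2nrm torus (tp N d)" for M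
  proof -
    have dM: "(\<lambda>y. f y - tp M (fc f) y) \<in> L2 torus" by (intro L2_diff f tp_L2)
    have dM': "(\<lambda>y. w y * (f y - tp M (fc f) y)) \<in> L2 torus" by (rule L2_bounded_mult[OF dM wm w(2)])
    have i: "integrable torus (\<lambda>y. w y * (f y - tp M (fc f) y) * cnj (tp N d y))"
      "integrable torus (\<lambda>y. w y * tp M (fc f) y * cnj (tp N d y))"
      by (intro L2_integrable_mult dM' L2_cnj tp_L2 L2_bounded_mult[OF tp_L2 wm w(2)])+
    have "(LINT y|torus. h y * cnj (tp N d y)) =
        (LINT y|torus. w y * (f y - tp M (fc f) y) * cnj (tp N d y) + w y * tp M (fc f) y * cnj (tp N d y))"
      unfolding h_def by (intro Bochner_Integration.integral_cong) (auto simp: algebra_simps)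
    also have "\<dots> = (LINT y|torus. w y * (f y - tp M (fc f) y) * cnj (tp N d y)) +
        (LINT y|torus. w y * tp M (fc f) y * cnj (tp N d y))"
      using i by (rule Bochner_Integration.integral_add)
    finally have "cmod (LINT y|torus. h y * cnj (tp N d y)) \<le>
        cmod (LINT y|torus. w y * (f y - tp M (fc f) y) * cnj (tp N d y)) + cmod (LINT y|torus. w y * tp M (fc f) y * cnj (tp N d y))"
      by (simp add: norm_triangle_ineq)
    moreover have "cmod (LINT y|torus. w y * (f y - tp M (fc f) y) * cnj (tp N d y)) \<le>
       L2nrm torus (\<lambda>y. w y * (f y - tp M (fc f) y)) * L2nrm torus (\<lambda>y. cnj (tp N d y))"
      by (intro L2_Cauchy_Schwarz dM' L2_cnj tp_L2)
    moreover have "L2nrm torus (\<lambda>y. cnj (tp N d y)) = L2nrm torus (tp N d)" by (simp add: L2nrm_def)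
    moreover have "L2nrm torus (\<lambda>y. w y * (f y - tp M (fc f) y)) \<le> L2nrm torus (\<lambda>y. f y - tp M (fc f) y)"
      by (intro L2nrm_mono dM dM') (simp add: norm_mult w(2) mult_left_le_one_le)
    ultimately show ?thesis
      using bM[of M] mult_right_mono[of "L2nrm torus (\<lambda>y. w y * (f y - tp M (fc f) y))" "L2nrm torus (\<lambda>y. f y - tp M (fc f) y)" "L2nrm torus (tp N d)"]
      by simp
  qed
  moreover have "(\<lambda>M. 2 * pi * (5 * g * (sqrt H * sqrt S)) + L2nrm torus (\<lambda>y. f y - tp M (fc f) y) * L2nrm torus (tp N d))
      \<longlonglongrightarrow> 2 * pi * (5 * g * (sqrt H * sqrt S)) + 0 * L2nrm torus (tp N d)"
    by (intro tendsto_intros L2_fourier_convergence f)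
  ultimately have "cmod (LINT y|torus. h y * cnj (tp N d y)) \<le> 2 * pi * (5 * g * (sqrt H * sqrt S)) + 0 * L2nrm torus (tp N d)"
    by (intro LIMSEQ_le_const) auto
  then have le: "S \<le> 5 * g * (sqrt H * sqrt S)"
    unfolding pair norm_of_real using \<open>0 \<le> S\<close> by simp
  have "S \<le> 25 * g\<^sup>2 * H"
  proof (cases "S = 0")
    case True
    then show ?thesis using \<open>0 \<le> H\<close> by simp
  next
    case False
    then have "0 < sqrt S" using \<open>0 \<le> S\<close> by simp
    moreover have "sqrt S * sqrt S \<le> (5 * g * sqrt H) * sqrt S" using le \<open>0 \<le> S\<close> by simp
    ultimately have "sqrt S \<le> 5 * g * sqrt H" using mult_right_le_imp_le by blast
    then have "(sqrt S)\<^sup>2 \<le> (5 * g * sqrt H)\<^sup>2" using \<open>0 \<le> S\<close> by (intro power_mono) auto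
    then show ?thesis using \<open>0 \<le> S\<close> \<open>0 \<le> H\<close> by (simp add: power_mult_distrib)
  qed
  then show ?thesis by (simp add: S_def h_def)
qed

section \<open>Sobolev norms through the modes in x\<close>

lemma sobolev_term_nonneg: "0 \<le> sobolev_term r s \<phi> z"
  by (cases z) (simp add: sobolev_term_def)

text \<open>Reduces an inequality between Sobolev norms to one for each fixed \<open>k\<close>.
  Phrasing \<open>step\<close> with an arbitrary bound \<open>H\<close> of the partial sums lets it
  be proved from finite sums alone, in the form that \<open>mixing_bound\<close> provides.\<close>

lemma sobolev_transfer:
  assumes sum: "sobolev_term r s \<psi> summable_on UNIV"
    and step: "\<And>k H N. (\<And>M::nat. (\<Sum>n\<in>{-int M..int M}. sobolev_term r s \<psi> (k, n)) \<le> H) \<Longrightarrow>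
       (\<Sum>n\<in>{-int N..int N}. sobolev_term r' s' \<phi> (k, n)) \<le> D * H"
    and D: "0 \<le> D"
  shows "sobolev_term r' s' \<phi> summable_on UNIV"
    "infsum (sobolev_term r' s' \<phi>) UNIV \<le> D * infsum (sobolev_term r s \<psi>) UNIV"
proof -
  let ?t = "sobolev_term r s \<psi>" and ?t' = "sobolev_term r' s' \<phi>"
  have sub: "?t summable_on A" for A using sum by (rule summable_on_subset_banach) auto
  have subk: "(\<lambda>n. ?t (k, n)) summable_on UNIV" for k
  proof -
    have "?t summable_on (Pair k ` UNIV)" by (rule sub)
    then show ?thesis by (subst (asm) summable_on_reindex) (auto simp: inj_on_def o_def)
  qed
  have fin: "sum ?t' F \<le> D * infsum ?t UNIV" if "finite F" for F
  proof -
    obtain N :: nat where N: "F \<subseteq> {-int N..int N} \<times> {-int N..int N}"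
    proof -
      define N where "N = Max (insert 0 ((\<lambda>z. max (nat \<bar>fst z\<bar>) (nat \<bar>snd z\<bar>)) ` F))"
      have "max (nat \<bar>fst z\<bar>) (nat \<bar>snd z\<bar>) \<le> N" if "z \<in> F" for z
        unfolding N_def using that \<open>finite F\<close> by (intro Max_ge) auto
      then have "F \<subseteq> {-int N..int N} \<times> {-int N..int N}" by (force simp: abs_le_iff)
      then show ?thesis by (rule that)
    qed
    have "sum ?t' F \<le> sum ?t' ({-int N..int N} \<times> {-int N..int N})"
      using N by (intro sum_mono2) (auto simp: sobolev_term_nonneg)
    also have "\<dots> = (\<Sum>k\<in>{-int N..int N}. \<Sum>n\<in>{-int N..int N}. ?t' (k, n))"
      by (simp add: sum.cartesian_product)
    also have "\<dots> \<le> (\<Sum>k\<in>{-int N..int N}. D * infsum (\<lambda>n. ?t (k, n)) UNIV)"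
      by (intro sum_mono step finite_sum_le_infsum subk) (auto simp: sobolev_term_nonneg)
    also have "\<dots> = D * (\<Sum>k\<in>{-int N..int N}. infsum (\<lambda>n. ?t (k, n)) UNIV)"
      by (simp add: sum_distrib_left)
    also have "(\<Sum>k\<in>{-int N..int N}. infsum (\<lambda>n. ?t (k, n)) UNIV) = infsum (\<lambda>k. infsum (\<lambda>n. ?t (k, n)) UNIV) {-int N..int N}"
      by simp
    also have "\<dots> = infsum (\<lambda>(k, n). ?t (k, n)) (Sigma {-int N..int N} (\<lambda>_. UNIV))"
      using sub[of "Sigma {-int N..int N} (\<lambda>_. UNIV)"] by (intro infsum_Sigma'_banach) simp
    also have "\<dots> \<le> infsum ?t UNIV"
      using sub by (intro infsum_mono_neutral) (auto simp: sobolev_term_nonneg)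
    finally show ?thesis using D by (simp add: mult_left_mono)
  qed
  show s: "?t' summable_on UNIV"
  proof (rule nonneg_bdd_above_summable_on)
    show "bdd_above (sum ?t' ` {F. F \<subseteq> UNIV \<and> finite F})"
      using fin by (auto intro!: bdd_aboveI)
  qed (simp add: sobolev_term_nonneg)
  show "infsum ?t' UNIV \<le> D * infsum ?t UNIV"
    by (rule infsum_le_finite_sums[OF s]) (use fin in auto)
qed

lemma fourier_coeff_fc: "fourier_coeff \<phi> k n = fc (\<phi> k) n"
  by (simp add: fourier_coeff_def fc_def)

lemma japanese_bracket_pos: "0 < japanese_bracket k"
  by (simp add: japanese_bracket_def add_pos_nonneg)

lemma japanese_bracket_powr_2: "japanese_bracket k powr 2 = 1 + (of_int k)\<^sup>2"
  by (simp add: japanese_bracket_def powr_half_sqrt[symmetric] powr_powr add_pos_nonneg)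

lemma sobolev_term_H1:
  "sobolev_term r 1 \<phi> (k, n) = japanese_bracket k powr (2 * r) * ((1 + (of_int n)\<^sup>2) * (cmod (fc (\<phi> k) n))\<^sup>2)"
  by (simp add: sobolev_term_def fourier_coeff_fc japanese_bracket_powr_2)

lemma sobolev_term_H_minus_1:
  "sobolev_term 0 (-1) \<phi> (k, n) = (cmod (fc (\<phi> k) n))\<^sup>2 / (1 + (of_int n)\<^sup>2)"
  using japanese_bracket_pos[of k]
  by (simp add: sobolev_term_def fourier_coeff_fc powr_minus japanese_bracket_powr_2 divide_inverse)

lemma sobolev_space_L2: "\<phi> \<in> sobolev_space r s \<Longrightarrow> \<phi> k \<in> L2 torus"
  by (simp add: sobolev_space_def L2_def)

lemma fc_zero_AE: "AE y in torus. g y = 0 \<Longrightarrow> fc g n = 0"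
proof -
  assume "AE y in torus. g y = 0"
  then have "AE y in torus. g y * cis (- of_int n * y) = 0" by eventually_elim simp
  then have "(LINT y|torus. g y * cis (- of_int n * y)) = 0"
    by (rule integral_eq_zero_AE)
  then show ?thesis by (simp add: fc_def)
qed

definition single_mode :: xmodes where
  "single_mode k y = (if k = 1 then 1 else 0)"

lemma fc_single_mode: "fc (single_mode k) n = (if k = 1 \<and> n = 0 then 1 else 0)"
proof -
  have "single_mode k = tp 0 (\<lambda>_. if k = 1 then 1 else 0)"
    by (auto simp: single_mode_def tp_def)
  then show ?thesis by (simp add: fc_tp)
qed

lemma single_mode:
  "single_mode \<in> sobolev_space 0 1" "sobolev_norm 0 1 single_mode = 1" "zero_xmean_modes single_mode"
  "\<not> (\<forall>k. AE y in torus. single_mode k y = 0)"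
proof -
  have t: "sobolev_term 0 1 single_mode z = (if z = (1, 0) then 1 else 0)" for z
    using japanese_bracket_pos[of 1] by (cases z) (simp add: sobolev_term_H1 fc_single_mode)
  have hs: "(sobolev_term 0 1 single_mode has_sum 1) UNIV"
  proof -
    have "(sobolev_term 0 1 single_mode has_sum (\<Sum>z\<in>{(1, 0)}. sobolev_term 0 1 single_mode z)) {(1, 0)}"
      by (rule has_sum_finite) simp
    then have "(sobolev_term 0 1 single_mode has_sum 1) {(1, 0)}" by (simp add: t)
    then show ?thesis by (rule has_sum_cong_neutral[THEN iffD1, rotated -1]) (auto simp: t)
  qed
  show "single_mode \<in> sobolev_space 0 1"
    using hs by (auto simp: sobolev_space_def single_mode_def[abs_def] summable_on_def)
  show "sobolev_norm 0 1 single_mode = 1"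
    using hs by (simp add: sobolev_norm_def infsumI)
  show "zero_xmean_modes single_mode"
    by (simp add: zero_xmean_modes_def single_mode_def)
  show "\<not> (\<forall>k. AE y in torus. single_mode k y = 0)"
  proof
    assume "\<forall>k. AE y in torus. single_mode k y = 0"
    then have "fc (single_mode 1) 0 = 0" by (intro fc_zero_AE) simp
    then show False by (simp add: fc_single_mode)
  qed
qed

context zigzag begin

lemma continuous_phase: "continuous_on A (\<lambda>y. cis (l * u y))"
  by (intro continuous_intros continuous_u)

lemma inviscid_L2:
  assumes "f k \<in> L2 torus"
  shows "inviscid_solution u f t k \<in> L2 torus"
proof -
  have "(\<lambda>y. cis (- t * of_int k * u y)) \<in> borel_measurable torus"
    by (intro continuous_measurable_torus continuous_phase)
  from L2_bounded_mult[OF assms this, of 1] show ?thesis by (simp add: inviscid_solution_def)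
qed

text \<open>Decay in \<open>k\<close> of the bound \<open>g k\<close> on the primitive is traded for
  the weight \<open>japanese_bracket k powr (2 * \<rho>)\<close> of the datum. The mode
  \<open>k = 0\<close> does not mix and is removed by the zero mean. The 25 is that of
  \<open>mixing_bound\<close>.\<close>

lemma inviscid_mixing:
  assumes f: "f \<in> sobolev_space \<rho> 1" and z: "zero_xmean_modes f"
    and G: "\<And>k y. k \<noteq> 0 \<Longrightarrow> 0 \<le> y \<Longrightarrow> y \<le> 2 * pi \<Longrightarrow> cmod (G (- t * of_int k) y) \<le> g k"
    and D: "\<And>k. k \<noteq> 0 \<Longrightarrow> 25 * (g k)\<^sup>2 \<le> D\<^sup>2 * japanese_bracket k powr (2 * \<rho>)" "0 \<le> D"
  shows "inviscid_solution u f t \<in> sobolev_space 0 (-1)"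
    "sobolev_norm 0 (-1) (inviscid_solution u f t) \<le> D * sobolev_norm \<rho> 1 f"
proof -
  let ?s = "inviscid_solution u f t"
  have fL: "f k \<in> L2 torus" for k using f by (rule sobolev_space_L2)
  have step: "(\<Sum>n\<in>{-int N..int N}. sobolev_term 0 (-1) ?s (k, n)) \<le> D\<^sup>2 * H"
    if H: "\<And>M::nat. (\<Sum>n\<in>{-int M..int M}. sobolev_term \<rho> 1 f (k, n)) \<le> H" for k N H
  proof -
    have H0: "0 \<le> H" using H[of 0] sobolev_term_nonneg[of \<rho> 1 f "(k, 0)"] by simp
    show ?thesis
    proof (cases "k = 0")
      case True
      have "AE y in torus. ?s 0 y = 0"
        using z unfolding zero_xmean_modes_def by eventually_elim (simp add: inviscid_solution_def)
      then have "fc (?s 0) n = 0" for n by (rule fc_zero_AE)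
      then show ?thesis using True H0 by (simp add: sobolev_term_H_minus_1)
    next
      case False
      let ?j = "japanese_bracket k powr (2 * \<rho>)"
      have j: "0 < ?j" using japanese_bracket_pos[of k] by simp
      have "(\<Sum>n\<in>{-int N..int N}. (cmod (fc (\<lambda>y. cis (- t * of_int k * u y) * f k y) n))\<^sup>2 / (1 + (of_int n)\<^sup>2))
          \<le> 25 * (g k)\<^sup>2 * (H / ?j)"
      proof (rule mixing_bound)
        show "cmod (integral {0..y} (\<lambda>y. cis (- t * of_int k * u y))) \<le> g k" if "0 \<le> y" "y \<le> 2 * pi" for y
          using G[OF False that] by (simp add: G_def)
        show "(\<Sum>n\<in>{-int M..int M}. (1 + (of_int n)\<^sup>2) * (cmod (fc (f k) n))\<^sup>2) \<le> H / ?j" for M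
          using H[of M] j
          unfolding sobolev_term_H1 sum_distrib_left[symmetric] pos_le_divide_eq[OF j] by (simp only: mult.commute)
      qed (simp_all only: fL continuous_phase norm_cis order_refl)
      also have "\<dots> \<le> D\<^sup>2 * ?j * (H / ?j)"
        using D(1)[OF False] H0 j by (intro mult_right_mono) auto
      also have "\<dots> = D\<^sup>2 * H" using j by simp
      finally show ?thesis
        by (simp only: sobolev_term_H_minus_1 inviscid_solution_def)
    qed
  qed
  have sum: "sobolev_term \<rho> 1 f summable_on UNIV" using f by (simp add: sobolev_space_def)
  have D2: "0 \<le> D\<^sup>2" by simp
  note tr = sobolev_transfer[OF sum step D2]
  show "?s \<in> sobolev_space 0 (-1)"
    using tr(1) inviscid_L2[OF fL] by (auto simp: sobolev_space_def L2_def)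
  have "sobolev_norm 0 (-1) ?s \<le> sqrt (D\<^sup>2 * infsum (sobolev_term \<rho> 1 f) UNIV)"
    unfolding sobolev_norm_def using tr(2) by (rule real_sqrt_le_mono)
  then show "sobolev_norm 0 (-1) ?s \<le> D * sobolev_norm \<rho> 1 f"
    using D(2) by (simp add: sobolev_norm_def real_sqrt_mult)
qed

text \<open>The primitive is of size \<open>1 / (t * \<bar>k\<bar>)\<close>, and the factor
  \<open>1 / \<bar>k\<bar>\<close> is what allows the datum to be measured in
  \<open>H\<^sup>-\<^sup>1\<close> in x. The constant is 3 * 6 from \<open>G_norm\<close> and
  \<open>K_bound\<close>, times 5 from \<open>mixing_bound\<close>, times 2 for comparing
  \<open>\<bar>k\<bar>\<close> with its bracket.\<close>

lemma inviscid_mixing_all_times: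
  assumes f: "f \<in> sobolev_space (-1) 1" "zero_xmean_modes f" and t: "0 < t"
  shows "inviscid_solution u f t \<in> sobolev_space 0 (-1)"
    "sobolev_norm 0 (-1) (inviscid_solution u f t) \<le> 180 * pi * real q * t powr (-1) * sobolev_norm (-1) 1 f"
proof -
  define g where "g k = 18 * pi * real q / (t * \<bar>of_int k\<bar>)" for k :: int
  have G: "cmod (G (- t * of_int k) y) \<le> g k" if "k \<noteq> 0" "0 \<le> y" "y \<le> 2 * pi" for k y
  proof -
    have "cmod (G (- t * of_int k) y) \<le> 3 * pi * (6 * real q / \<bar>- t * of_int k\<bar>)"
      by (rule G_norm[OF that(2,3)], rule K_bound) (use that t in auto)
    then show ?thesis using t by (simp add: g_def abs_mult mult_ac)
  qed
  have D: "25 * (g k)\<^sup>2 \<le> (180 * pi * real q * t powr (-1))\<^sup>2 * japanese_bracket k powr (2 * (-1))" if "k \<noteq> 0" for k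
  proof -
    have "1 \<le> \<bar>real_of_int k\<bar>" using that by linarith
    then have "1 \<le> \<bar>real_of_int k\<bar>\<^sup>2" by (rule one_le_power)
    then have k: "1 \<le> (real_of_int k)\<^sup>2" by simp
    have "25 * (g k)\<^sup>2 = (90 * pi * real q / t)\<^sup>2 * (1 / (of_int k)\<^sup>2)"
      by (simp add: g_def power_mult_distrib power_divide)
    also have "\<dots> \<le> (90 * pi * real q / t)\<^sup>2 * (4 / (1 + (of_int k)\<^sup>2))"
    proof (rule mult_left_mono)
      have "4 / (4 * (real_of_int k)\<^sup>2) \<le> 4 / (1 + (real_of_int k)\<^sup>2)"
        using k by (intro divide_left_mono mult_pos_pos) auto
      then show "1 / (real_of_int k)\<^sup>2 \<le> 4 / (1 + (real_of_int k)\<^sup>2)" by simp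
    qed simp
    also have "\<dots> = (180 * pi * real q / t)\<^sup>2 * (1 / (1 + (of_int k)\<^sup>2))"
      by (simp add: power_mult_distrib power_divide)
    also have "\<dots> = (180 * pi * real q * t powr (-1))\<^sup>2 * japanese_bracket k powr (2 * (-1))"
      using t japanese_bracket_powr_2[of k] by (simp add: powr_minus powr_one divide_inverse)
    finally show ?thesis .
  qed
  show "inviscid_solution u f t \<in> sobolev_space 0 (-1)"
    "sobolev_norm 0 (-1) (inviscid_solution u f t) \<le> 180 * pi * real q * t powr (-1) * sobolev_norm (-1) 1 f"
    by (rule inviscid_mixing[OF f G D]; use t q3 in simp)+
qed

text \<open>For every nonzero \<open>k\<close> the frequency \<open>- t * k\<close> is a multiple of
  \<open>2 * pi * q ^ m\<close>, so one time is resonant for all modes at once. The bound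
  \<open>1 / b ^ m\<close> does not improve with \<open>k\<close>, which is why the datum is
  measured in L2 in x; \<open>q powr (1 / alpha) = b\<close> converts it into a power of
  \<open>t\<close>.\<close>

lemma inviscid_mixing_resonant_times:
  fixes m :: nat
  defines "t \<equiv> 2 * pi * real q ^ m"
  assumes f: "f \<in> sobolev_space 0 1" "zero_xmean_modes f"
  shows "inviscid_solution u f t \<in> sobolev_space 0 (-1)"
    "sobolev_norm 0 (-1) (inviscid_solution u f t) \<le>
      15 * pi * (2 * pi) powr (1 / alpha) * t powr (- (1 / alpha)) * sobolev_norm 0 1 f"
proof -
  define g where "g = 3 * pi * (1 / real b ^ m)"
  have G: "cmod (G (- t * of_int k) y) \<le> g" if "k \<noteq> 0" "0 \<le> y" "y \<le> 2 * pi" for k y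
    unfolding g_def
  proof (rule G_norm[OF that(2,3)])
    fix x :: real assume "0 \<le> x" "x \<le> 1"
    from K_resonant_bound[OF _ this, of "-k" m] that(1)
    show "cmod (K (- t * of_int k) x) \<le> 1 / real b ^ m" by (simp add: t_def mult_ac)
  qed
  have "t powr (- (1 / alpha)) = (2 * pi) powr (- (1 / alpha)) * (real q ^ m) powr (- (1 / alpha))"
    using q_gt1 by (simp add: t_def powr_mult)
  also have "(real q ^ m) powr (- (1 / alpha)) = 1 / real b ^ m"
  proof -
    have "real q ^ m = (real b ^ m) powr alpha"
      using b_power_powr_alpha[of m] b_gt1 by (simp add: powr_divide)
    then have "(real q ^ m) powr (- (1 / alpha)) = (real b ^ m) powr (-1)"
      using alpha_pos by (simp add: powr_powr)
    then show ?thesis using b_gt1 by (simp add: powr_minus divide_inverse)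
  qed
  finally have tp: "15 * pi * (2 * pi) powr (1 / alpha) * t powr (- (1 / alpha)) = 5 * g"
    by (simp add: g_def powr_minus field_simps)
  have D: "25 * g\<^sup>2 \<le> (5 * g)\<^sup>2 * japanese_bracket k powr (2 * 0)" for k
    using japanese_bracket_pos[of k] by (simp add: power_mult_distrib)
  have "0 \<le> 5 * g" by (simp add: g_def)
  from inviscid_mixing[OF f G D this]
  show "inviscid_solution u f t \<in> sobolev_space 0 (-1)"
    "sobolev_norm 0 (-1) (inviscid_solution u f t) \<le>
      15 * pi * (2 * pi) powr (1 / alpha) * t powr (- (1 / alpha)) * sobolev_norm 0 1 f"
    unfolding tp by simp_all
qed

text \<open>At an odd multiple of \<open>pi\<close> one has \<open>cis (- t) = -1\<close>, so the
  mean in y has modulus \<open>2 / t\<close>, and this single coefficient bounds the norm from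
  below.\<close>

lemma single_mode_lower_bound:
  fixes m :: nat
  defines "t \<equiv> (2 * real m + 1) * pi"
  shows "inviscid_solution u single_mode t \<in> sobolev_space 0 (-1)"
    "2 * t powr (-1) \<le> sobolev_norm 0 (-1) (inviscid_solution u single_mode t)"
proof -
  let ?s = "inviscid_solution u single_mode t"
  have t: "0 < t" by (simp add: t_def add_nonneg_pos)
  have G: "cmod (G (- t * of_int k) y) \<le> 3 * pi" if "0 \<le> y" "y \<le> 2 * pi" for k y
    using G_norm[OF that, of "- t * of_int k" 1] K_trivial_bound by simp
  have D: "25 * (3 * pi)\<^sup>2 \<le> (15 * pi)\<^sup>2 * japanese_bracket k powr (2 * 0)" for k
    using japanese_bracket_pos[of k] by (simp add: power_mult_distrib)
  show mem: "?s \<in> sobolev_space 0 (-1)"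
    by (rule inviscid_mixing(1)[OF single_mode(1,3) G D]) auto
  have "fc (?s 1) 0 = G (- t) (2 * pi) / of_real (2 * pi)"
  proof -
    have "fc (?s 1) 0 = (LINT y|torus. cis (- t * u y)) / of_real (2 * pi)"
      by (simp add: fc_def inviscid_solution_def single_mode_def)
    also have "(LINT y|torus. cis (- t * u y)) = integral {0..2 * pi} (\<lambda>y. cis (- t * u y))"
      by (intro torus_integral_eq continuous_phase)
    finally show ?thesis by (simp add: G_def)
  qed
  then have "fc (?s 1) 0 = (cis (- t) - 1) / (\<i> * of_real (- t))"
    using t by (simp only: G_full J_value) simp
  moreover have "cis (- t) = -1"
  proof -
    have "cis (- t) = cis (- pi) * cis (2 * pi * of_int (- int m))"
      by (simp add: cis_mult t_def algebra_simps)
    also have "cis (2 * pi * of_int (- int m)) = 1" by (rule cis_multiple_2pi) simp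
    finally show ?thesis by (simp add: complex_eq_iff)
  qed
  ultimately have "cmod (fc (?s 1) 0) = 2 / t" using t by (simp add: norm_divide norm_mult)
  then have "(2 / t)\<^sup>2 = sum (sobolev_term 0 (-1) ?s) {(1, 0)}"
    by (simp add: sobolev_term_H_minus_1)
  also have "\<dots> \<le> infsum (sobolev_term 0 (-1) ?s) UNIV"
    using mem by (intro finite_sum_le_infsum) (auto simp: sobolev_space_def sobolev_term_nonneg)
  finally have "2 / t \<le> sobolev_norm 0 (-1) ?s"
    unfolding sobolev_norm_def by (rule real_le_rsqrt)
  then show "2 * t powr (-1) \<le> sobolev_norm 0 (-1) ?s"
    using t by (simp add: powr_minus divide_inverse)
qed

end

subsection \<open>Enhanced dissipation for one Fourier mode\<close>

lemma torus_integral_shift: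
  fixes F :: "real \<Rightarrow> 'a::euclidean_space"
  assumes F: "continuous_on UNIV F" and per: "\<And>y. F (y + 2 * pi) = F y" and \<theta>: "0 \<le> \<theta>" "\<theta> \<le> 2 * pi"
  shows "(LINT y|torus. F (y + \<theta>)) = (LINT y|torus. F y)"
proof -
  have c: "continuous_on A F" for A using F by (rule continuous_on_subset) auto
  have i: "F integrable_on {x..y}" for x y by (intro integrable_continuous_real c)
  have "(LINT y|torus. F (y + \<theta>)) = integral {0..2 * pi} (\<lambda>y. F (y + \<theta>))"
    by (intro torus_integral_eq continuous_on_compose2[OF F] continuous_intros) auto
  also have "\<dots> = integral {\<theta>..2 * pi + \<theta>} F"
    using integral_shift_Icc_real[of 0 "2 * pi" F \<theta>] by (simp add: o_def add.commute)
  also have "\<dots> = integral {\<theta>..2 * pi} F + integral {2 * pi..2 * pi + \<theta>} F"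
    using \<theta> i by (intro Henstock_Kurzweil_Integration.integral_combine[symmetric]) auto
  also have "integral {2 * pi..2 * pi + \<theta>} F = integral {0..\<theta>} F"
    using integral_shift_Icc_real[of 0 \<theta> F "2 * pi"] per by (simp add: o_def add.commute)
  also have "integral {\<theta>..2 * pi} F + integral {0..\<theta>} F = integral {0..2 * pi} F"
    using \<theta> i by (subst add.commute) (intro Henstock_Kurzweil_Integration.integral_combine, auto)
  also have "\<dots> = (LINT y|torus. F y)"
    by (intro torus_integral_eq[symmetric] c)
  finally show ?thesis .
qed

lemma continuous_periodic_bounded:
  fixes F :: "real \<Rightarrow> 'a::real_normed_vector"
  assumes "continuous_on UNIV F"
  obtains B where "\<And>y. y \<in> space torus \<Longrightarrow> norm (F y) \<le> B"
proof -
  have "compact (F ` {0..2 * pi})"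
    by (intro compact_continuous_image continuous_on_subset[OF assms]) auto
  then obtain B where "\<And>y. y \<in> {0..2 * pi} \<Longrightarrow> norm (F y) \<le> B"
    using compact_imp_bounded[of "F ` {0..2 * pi}"] unfolding bounded_iff by blast
  then show ?thesis by (intro that[of B]) auto
qed

lemma continuous_integrable_torus:
  fixes F :: "real \<Rightarrow> 'a::euclidean_space"
  assumes "continuous_on UNIV F"
  shows "integrable torus F"
proof -
  obtain B where B: "\<And>y. y \<in> space torus \<Longrightarrow> norm (F y) \<le> B"
    using continuous_periodic_bounded[OF assms] by blast
  show ?thesis
    by (rule torus.integrable_const_bound[where B = B])
      (use B continuous_measurable_torus[OF assms] in auto)
qed

lemma continuous_L2_torus:
  assumes "continuous_on UNIV F"
  shows "F \<in> L2 torus"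
proof -
  obtain B where "\<And>y. y \<in> space torus \<Longrightarrow> norm (F y) \<le> B"
    using continuous_periodic_bounded[OF assms] by blast
  then show ?thesis using continuous_measurable_torus[OF assms] by (intro torus.bounded_L2)
qed

lemma weighted_Cauchy_Schwarz:
  assumes w: "w \<in> borel_measurable M" "\<And>z. cmod (w z) \<le> B" and f: "f \<in> L2 M" "g \<in> L2 M"
  shows "cmod (LINT z|M. w z * (f z * cnj (g z))) \<le> B * (L2nrm M f * L2nrm M g)"
proof -
  have "0 \<le> B" using w(2)[of undefined] norm_ge_zero order_trans by blast
  have "cmod (LINT z|M. w z * (f z * cnj (g z))) \<le> (LINT z|M. cmod (w z * (f z * cnj (g z))))"
    by (rule integral_norm_bound)
  also have "\<dots> \<le> (LINT z|M. B * (cmod (f z) * cmod (g z)))"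
  proof (rule integral_mono)
    have "integrable M (\<lambda>z. (w z * f z) * cnj (g z))"
      by (intro L2_integrable_mult L2_bounded_mult[OF f(1) w] L2_cnj f)
    then show "integrable M (\<lambda>z. cmod (w z * (f z * cnj (g z))))"
      by (simp add: mult.assoc)
    show "integrable M (\<lambda>z. B * (cmod (f z) * cmod (g z)))"
      using L2_integrable_mult_cmod[OF f] by simp
    show "cmod (w z * (f z * cnj (g z))) \<le> B * (cmod (f z) * cmod (g z))" for z
      using w(2)[of z] by (simp add: norm_mult mult_right_mono)
  qed
  also have "\<dots> = B * (LINT z|M. cmod (f z) * cmod (g z))" by simp
  also have "\<dots> \<le> B * (L2nrm M f * L2nrm M g)"
    using \<open>0 \<le> B\<close> by (intro mult_left_mono L2_Cauchy_Schwarz_cmod f)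
  finally show ?thesis .
qed

text \<open>Up to the factor \<open>2 * pi\<close>, \<open>nsq\<close> and \<open>dsq\<close> are
  the squared L2 norms of \<open>tp N c\<close> and of its derivative; all estimates for truncations
  are expressed in these two quantities.\<close>

definition nsq :: "nat \<Rightarrow> (int \<Rightarrow> complex) \<Rightarrow> real" where
  "nsq N c = (\<Sum>n\<in>{-int N..int N}. (cmod (c n))\<^sup>2)"

definition dsq :: "nat \<Rightarrow> (int \<Rightarrow> complex) \<Rightarrow> real" where
  "dsq N c = (\<Sum>n\<in>{-int N..int N}. (of_int n)\<^sup>2 * (cmod (c n))\<^sup>2)"

definition diff_coeff :: "(int \<Rightarrow> complex) \<Rightarrow> int \<Rightarrow> complex" where
  "diff_coeff c n = \<i> * of_int n * c n"

definition shift_coeff :: "real \<Rightarrow> (int \<Rightarrow> complex) \<Rightarrow> int \<Rightarrow> complex" where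
  "shift_coeff h c n = c n * cis (of_int n * h)"

lemma nsq_nonneg: "0 \<le> nsq N c" and dsq_nonneg: "0 \<le> dsq N c"
  by (simp_all add: nsq_def dsq_def sum_nonneg)

lemma L2nrm_tp_nsq: "L2nrm torus (tp N c) = sqrt (2 * pi) * sqrt (nsq N c)"
  unfolding real_sqrt_mult[symmetric] nsq_def L2nrm_tp[symmetric] by simp

lemma nsq_diff_coeff: "nsq N (diff_coeff c) = dsq N c"
  by (simp add: nsq_def dsq_def diff_coeff_def norm_mult power_mult_distrib)

lemma nsq_shift_coeff: "nsq N (shift_coeff h c) = nsq N c"
  by (simp add: nsq_def shift_coeff_def norm_mult)

lemma tp_shift: "tp N c (y + h) = tp N (shift_coeff h c) y"
  unfolding tp_def shift_coeff_def
  by (intro sum.cong) (simp_all add: cis_mult mult.assoc distrib_left add.commute)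

lemma tp_diff: "tp N c y - tp N d y = tp N (\<lambda>n. c n - d n) y"
  by (simp add: tp_def sum_subtractf left_diff_distrib)

lemma diff_shift_coeff: "diff_coeff (shift_coeff h c) = shift_coeff h (diff_coeff c)"
  by (simp add: diff_coeff_def shift_coeff_def fun_eq_iff mult_ac)

lemma tp_deriv: "(tp N c has_vector_derivative tp N (diff_coeff c) y) (at y within A)"
  using tp_has_vector_derivative[of N c y A] by (simp add: diff_coeff_def[abs_def])

text \<open>On the Fourier side the difference is multiplication by \<open>cis (n * h) - 1\<close>,
  of modulus at most \<open>\<bar>n * h\<bar>\<close>.\<close>

lemma L2nrm_shift_diff:
  "L2nrm torus (\<lambda>y. tp N c (y + h) - tp N c y) \<le> sqrt (2 * pi) * (\<bar>h\<bar> * sqrt (dsq N c))"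
proof -
  have "nsq N (\<lambda>n. shift_coeff h c n - c n) \<le> h\<^sup>2 * dsq N c"
    unfolding nsq_def dsq_def sum_distrib_left
  proof (rule sum_mono)
    fix n
    have "shift_coeff h c n - c n = c n * (cis (of_int n * h) - 1)"
      by (simp add: shift_coeff_def algebra_simps)
    then have "cmod (shift_coeff h c n - c n) \<le> cmod (c n) * \<bar>of_int n * h\<bar>"
      by (simp only: norm_mult) (intro mult_left_mono norm_cis_minus_1 norm_ge_zero)
    then have "(cmod (shift_coeff h c n - c n))\<^sup>2 \<le> (cmod (c n) * \<bar>of_int n * h\<bar>)\<^sup>2"
      by (intro power_mono) auto
    then show "(cmod (shift_coeff h c n - c n))\<^sup>2 \<le> h\<^sup>2 * ((of_int n)\<^sup>2 * (cmod (c n))\<^sup>2)"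
      by (simp add: power_mult_distrib mult_ac)
  qed
  then have "sqrt (nsq N (\<lambda>n. shift_coeff h c n - c n)) \<le> \<bar>h\<bar> * sqrt (dsq N c)"
    by (metis real_sqrt_le_mono real_sqrt_mult real_sqrt_abs)
  then show ?thesis
    unfolding tp_shift tp_diff L2nrm_tp_nsq by (intro mult_left_mono) auto
qed

text \<open>The difference of the two squares factors, and one factor is controlled by the
  translation difference of \<open>L2nrm_shift_diff\<close>. This lets the weight be moved at a cost
  linear in the distance.\<close>

lemma weighted_shift_square:
  assumes A: "continuous_on UNIV A" "\<And>y. 0 \<le> A y" "\<And>y. A y \<le> (1::real)" and h: "0 \<le> h"
  shows "(LINT y|torus. A y * (cmod (tp N c (y + h)))\<^sup>2) \<le>
    (LINT y|torus. A y * (cmod (tp N c y))\<^sup>2) + 4 * pi * h * (sqrt (nsq N c) * sqrt (dsq N c))"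
proof -
  let ?p = "tp N c" and ?t = "\<lambda>y. tp N c (y + h)"
  have ct: "continuous_on UNIV ?t" unfolding tp_shift by (rule continuous_on_tp)
  have L: "?p \<in> L2 torus" "?t \<in> L2 torus" "(\<lambda>y. ?t y - ?p y) \<in> L2 torus"
    by (intro continuous_L2_torus continuous_intros ct)+
  have "(LINT y|torus. A y * (cmod (?t y))\<^sup>2) \<le>
      (LINT y|torus. A y * (cmod (?p y))\<^sup>2 + (cmod (?t y - ?p y) * cmod (?t y) + cmod (?t y - ?p y) * cmod (?p y)))"
  proof (rule integral_mono)
    show "integrable torus (\<lambda>y. A y * (cmod (?t y))\<^sup>2)"
      by (intro continuous_integrable_torus continuous_intros A ct)
    show "integrable torus (\<lambda>y. A y * (cmod (?p y))\<^sup>2 + (cmod (?t y - ?p y) * cmod (?t y) + cmod (?t y - ?p y) * cmod (?p y)))"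
      by (intro continuous_integrable_torus continuous_intros A ct)
    fix y
    let ?x = "cmod (?t y)" and ?z = "cmod (?p y)" and ?w = "cmod (?t y - ?p y)"
    have "?x - ?z \<le> ?w" by (rule norm_triangle_ineq2)
    then have "?x\<^sup>2 - ?z\<^sup>2 \<le> ?w * (?x + ?z)"
      unfolding power2_eq_square square_diff_square_factored by (subst mult.commute) (intro mult_right_mono, auto)
    then have "A y * (?x\<^sup>2 - ?z\<^sup>2) \<le> A y * (?w * (?x + ?z))" using A(2) by (rule mult_left_mono)
    also have "\<dots> \<le> 1 * (?w * (?x + ?z))" using A(3) by (intro mult_right_mono) auto
    finally show "A y * ?x\<^sup>2 \<le> A y * ?z\<^sup>2 + (?w * ?x + ?w * ?z)" by (simp add: algebra_simps)
  qed
  also have "\<dots> = (LINT y|torus. A y * (cmod (?p y))\<^sup>2) +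
      ((LINT y|torus. cmod (?t y - ?p y) * cmod (?t y)) + (LINT y|torus. cmod (?t y - ?p y) * cmod (?p y)))"
  proof -
    have "integrable torus (\<lambda>y. A y * (cmod (?p y))\<^sup>2)" "integrable torus (\<lambda>y. cmod (?t y - ?p y) * cmod (?t y))"
      "integrable torus (\<lambda>y. cmod (?t y - ?p y) * cmod (?p y))"
      by (intro continuous_integrable_torus continuous_intros A ct)+
    then show ?thesis by simp
  qed
  also have "(LINT y|torus. cmod (?t y - ?p y) * cmod (?t y)) + (LINT y|torus. cmod (?t y - ?p y) * cmod (?p y)) \<le>
     L2nrm torus (\<lambda>y. ?t y - ?p y) * L2nrm torus ?t + L2nrm torus (\<lambda>y. ?t y - ?p y) * L2nrm torus ?p"
    by (intro add_mono L2_Cauchy_Schwarz_cmod L)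
  also have "\<dots> = L2nrm torus (\<lambda>y. ?t y - ?p y) * (2 * (sqrt (2 * pi) * sqrt (nsq N c)))"
    by (simp add: tp_shift L2nrm_tp_nsq nsq_shift_coeff)
  also have "\<dots> \<le> (sqrt (2 * pi) * (\<bar>h\<bar> * sqrt (dsq N c))) * (2 * (sqrt (2 * pi) * sqrt (nsq N c)))"
    by (intro mult_right_mono L2nrm_shift_diff) (simp add: nsq_nonneg)
  also have "\<dots> = (sqrt (2 * pi) * sqrt (2 * pi)) * (2 * h * (sqrt (nsq N c) * sqrt (dsq N c)))"
    using h by (simp only: mult_ac abs_of_nonneg)
  also have "sqrt (2 * pi) * sqrt (2 * pi) = 2 * pi" by (intro real_sqrt_mult_self[THEN trans]) simp
  finally show ?thesis by simp
qed

text \<open>The factor \<open>a \<lfloor>x\<rfloor>\<close> jumps only at integers, where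
  \<open>s\<close> vanishes.\<close>

lemma isCont_floor_cut:
  fixes s :: "real \<Rightarrow> real"
  assumes s: "isCont s x" "\<And>n::int. s (of_int n) = 0" and a: "\<And>n::int. \<bar>a n\<bar> \<le> 1"
  shows "isCont (\<lambda>x. a \<lfloor>x\<rfloor> * s x) x"
proof (cases "x \<in> \<int>")
  case True
  then have sx: "s x = 0" using s(2) by (auto elim: Ints_cases)
  have "((\<lambda>y. a \<lfloor>y\<rfloor> * s y) \<longlongrightarrow> 0) (at x)"
  proof (rule Lim_null_comparison)
    show "\<forall>\<^sub>F y in at x. norm (a \<lfloor>y\<rfloor> * s y) \<le> \<bar>s y\<bar>"
      using a by (intro always_eventually allI) (simp add: abs_mult mult_left_le_one_le)
    show "((\<lambda>y. \<bar>s y\<bar>) \<longlongrightarrow> 0) (at x)"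
      using s(1) sx unfolding isCont_def by (metis tendsto_rabs_zero_iff)
  qed
  then show ?thesis using sx by (simp add: isCont_def)
next
  case False
  have "\<forall>\<^sub>F y in nhds x. \<lfloor>y\<rfloor> = \<lfloor>x\<rfloor>"
    using eventually_floor_eq[OF tendsto_ident_at[of x UNIV, THEN tendsto_at_iff_tendsto_nhds[THEN iffD1]] False] by simp
  then have "\<forall>\<^sub>F y in nhds x. a \<lfloor>y\<rfloor> * s y = a \<lfloor>x\<rfloor> * s y" by eventually_elim simp
  moreover have "isCont (\<lambda>y. a \<lfloor>x\<rfloor> * s y) x" by (intro continuous_intros s)
  ultimately show ?thesis by (subst isCont_cong)
qed

text \<open>At an integer the zero of \<open>s'\<close> forces the difference quotients from both
  sides to 0, whatever the jump of \<open>a \<lfloor>x\<rfloor>\<close>.\<close>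

lemma DERIV_floor_cut:
  fixes s s' :: "real \<Rightarrow> real"
  assumes s: "(s has_real_derivative s' x) (at x)" "\<And>n::int. s (of_int n) = 0" "\<And>n::int. s' (of_int n) = 0"
    and a: "\<And>n::int. \<bar>a n\<bar> \<le> 1"
  shows "((\<lambda>x. a \<lfloor>x\<rfloor> * s x) has_real_derivative a \<lfloor>x\<rfloor> * s' x) (at x)"
proof (cases "x \<in> \<int>")
  case True
  then have sx: "s x = 0" "s' x = 0" using s(2,3) by (auto elim: Ints_cases)
  have "((\<lambda>y. (a \<lfloor>y\<rfloor> * s y - a \<lfloor>x\<rfloor> * s x) / (y - x)) \<longlongrightarrow> 0) (at x)"
  proof (rule Lim_null_comparison)
    show "\<forall>\<^sub>F y in at x. norm ((a \<lfloor>y\<rfloor> * s y - a \<lfloor>x\<rfloor> * s x) / (y - x)) \<le> \<bar>(s y - s x) / (y - x)\<bar>"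
      using a sx by (intro always_eventually allI) (simp add: abs_mult abs_divide divide_right_mono mult_left_le_one_le)
    have "((\<lambda>y. (s y - s x) / (y - x)) \<longlongrightarrow> 0) (at x)"
      using s(1) sx by (simp add: has_field_derivative_iff)
    then show "((\<lambda>y. \<bar>(s y - s x) / (y - x)\<bar>) \<longlongrightarrow> 0) (at x)" by (rule tendsto_rabs_zero)
  qed
  then show ?thesis using sx by (simp add: has_field_derivative_iff)
next
  case False
  have "\<forall>\<^sub>F y in nhds x. \<lfloor>y\<rfloor> = \<lfloor>x\<rfloor>"
    using eventually_floor_eq[OF tendsto_ident_at[of x UNIV, THEN tendsto_at_iff_tendsto_nhds[THEN iffD1]] False] by simp
  then have "\<forall>\<^sub>F y in nhds x. a \<lfloor>y\<rfloor> * s y = a \<lfloor>x\<rfloor> * s y" by eventually_elim simp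
  moreover have "((\<lambda>y. a \<lfloor>x\<rfloor> * s y) has_real_derivative a \<lfloor>x\<rfloor> * s' x) (at x)"
    using s(1) by (rule DERIV_cmult)
  ultimately show ?thesis by (subst DERIV_cong_ev[OF refl _ refl])
qed

lemma sin_floor_zero: "sin (pi * of_int n) = 0"
  using sin_zero_iff_int2 by (metis mult.commute)

text \<open>With \<open>q\<close> the translate of \<open>p\<close>, the integrand is the derivative
  of \<open>W * (q1 * cnj p + q * cnj p1)\<close> minus \<open>2 * W * q1 * cnj p1\<close> and minus
  a term with \<open>W'\<close>. Periodicity removes the boundary values, so that no second
  derivative is left.\<close>

lemma twisted_diffusion_bound:
  fixes W W' :: "real \<Rightarrow> real"
  assumes W: "\<And>y. (W has_real_derivative W' y) (at y)" "continuous_on UNIV W'" "\<And>y. W (y + 2 * pi) = W y"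
    and b: "\<And>y. \<bar>W y\<bar> \<le> 1" "\<And>y. \<bar>W' y\<bar> \<le> B"
  shows "cmod (LINT y|torus. of_real (W y) * (tp N (diff_coeff (diff_coeff c)) (y + h) * cnj (tp N c y)
      + tp N c (y + h) * cnj (tp N (diff_coeff (diff_coeff c)) y)))
    \<le> 2 * pi * (2 * dsq N c + 2 * B * (sqrt (nsq N c) * sqrt (dsq N c)))"
proof -
  define p where "p = tp N c"
  define p1 where "p1 = tp N (diff_coeff c)"
  define p2 where "p2 = tp N (diff_coeff (diff_coeff c))"
  define q where "q = tp N (shift_coeff h c)"
  define q1 where "q1 = tp N (shift_coeff h (diff_coeff c))"
  define q2 where "q2 = tp N (shift_coeff h (diff_coeff (diff_coeff c)))"
  have D: "(p has_vector_derivative p1 y) (at y within A)" "(p1 has_vector_derivative p2 y) (at y within A)"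
    "(q has_vector_derivative q1 y) (at y within A)" "(q1 has_vector_derivative q2 y) (at y within A)" for y A
    using tp_deriv[of N "shift_coeff h c" y A] tp_deriv[of N "shift_coeff h (diff_coeff c)" y A]
    unfolding p_def p1_def p2_def q_def q1_def q2_def diff_shift_coeff by (auto intro: tp_deriv)
  have per: "p (2 * pi) = p 0" "p1 (2 * pi) = p1 0" "q (2 * pi) = q 0" "q1 (2 * pi) = q1 0"
    using tp_periodic[of N _ 0] unfolding p_def p1_def q_def q1_def by simp_all
  have cont: "continuous_on A p" "continuous_on A p1" "continuous_on A p2" "continuous_on A q" "continuous_on A q1" "continuous_on A q2" for A
    unfolding p_def p1_def p2_def q_def q1_def q2_def by (intro continuous_on_tp)+
  have cW': "continuous_on A W'" for A using W(2) by (rule continuous_on_subset) auto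
  have cW: "continuous_on A W" for A
    by (rule DERIV_continuous_on[of A W W']) (use W(1) has_field_derivative_at_within in blast)
  have L: "p \<in> L2 torus" "p1 \<in> L2 torus" "q \<in> L2 torus" "q1 \<in> L2 torus"
    by (intro continuous_L2_torus cont)+
  let ?R = "\<lambda>y. of_real (W y) * (q2 y * cnj (p y) + q y * cnj (p2 y))"
  let ?X = "\<lambda>y. 2 * (of_real (W y) * (q1 y * cnj (p1 y)))"
  let ?Y = "\<lambda>y. of_real (W' y) * (q1 y * cnj (p y)) + of_real (W' y) * (q y * cnj (p1 y))"
  let ?F = "\<lambda>y. of_real (W y) * (q1 y * cnj (p y) + q y * cnj (p1 y))"
  have "((\<lambda>y. ?R y + (?X y + ?Y y)) has_integral ?F (2 * pi) - ?F 0) {0..2 * pi}"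
  proof (rule fundamental_theorem_of_calculus)
    fix y :: real
    have "((\<lambda>y. complex_of_real (W y)) has_vector_derivative of_real (W' y)) (at y within {0..2 * pi})"
      using W(1)[of y] by (intro has_vector_derivative_of_real)
        (simp add: has_real_derivative_iff_has_vector_derivative has_vector_derivative_at_within)
    then have "(?F has_vector_derivative of_real (W y) * ((q1 y * cnj (p1 y) + q2 y * cnj (p y)) + (q y * cnj (p2 y) + q1 y * cnj (p1 y)))
        + of_real (W' y) * (q1 y * cnj (p y) + q y * cnj (p1 y))) (at y within {0..2 * pi})"
      by (intro has_vector_derivative_mult has_vector_derivative_add has_vector_derivative_cnj D)
    then show "(?F has_vector_derivative ?R y + (?X y + ?Y y)) (at y within {0..2 * pi})"
      by (simp add: algebra_simps)
  qed auto
  moreover have "?F (2 * pi) - ?F 0 = 0" using per W(3)[of 0] by simp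
  ultimately have "integral {0..2 * pi} (\<lambda>y. ?R y + (?X y + ?Y y)) = 0" by (simp add: integral_unique)
  moreover have "integral {0..2 * pi} (\<lambda>y. ?R y + (?X y + ?Y y)) = (LINT y|torus. ?R y + (?X y + ?Y y))"
    by (intro torus_integral_eq[symmetric] continuous_intros cont cW cW')
  moreover have "(LINT y|torus. ?R y + (?X y + ?Y y)) =
     (LINT y|torus. ?R y) + (2 * (LINT y|torus. of_real (W y) * (q1 y * cnj (p1 y))) +
       ((LINT y|torus. of_real (W' y) * (q1 y * cnj (p y))) + (LINT y|torus. of_real (W' y) * (q y * cnj (p1 y)))))"
  proof -
    have i: "integrable torus ?R" "integrable torus (\<lambda>y. of_real (W y) * (q1 y * cnj (p1 y)))"
      "integrable torus (\<lambda>y. of_real (W' y) * (q1 y * cnj (p y)))" "integrable torus (\<lambda>y. of_real (W' y) * (q y * cnj (p1 y)))"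
      by (intro continuous_integrable_torus continuous_intros cont cW cW')+
    have "(LINT y|torus. ?R y + (?X y + ?Y y)) = (LINT y|torus. ?R y) + ((LINT y|torus. ?X y) + (LINT y|torus. ?Y y))"
      using i by (subst Bochner_Integration.integral_add Bochner_Integration.integrable_add | simp)+
    moreover have "(LINT y|torus. ?Y y) = (LINT y|torus. of_real (W' y) * (q1 y * cnj (p y))) + (LINT y|torus. of_real (W' y) * (q y * cnj (p1 y)))"
      using i by (intro Bochner_Integration.integral_add)
    moreover have "(LINT y|torus. ?X y) = 2 * (LINT y|torus. of_real (W y) * (q1 y * cnj (p1 y)))" by simp
    ultimately show ?thesis by simp
  qed
  ultimately have "(LINT y|torus. ?R y) + (2 * (LINT y|torus. of_real (W y) * (q1 y * cnj (p1 y))) +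
       ((LINT y|torus. of_real (W' y) * (q1 y * cnj (p y))) + (LINT y|torus. of_real (W' y) * (q y * cnj (p1 y))))) = 0"
    by (simp only:)
  then have "(LINT y|torus. ?R y) = - (2 * (LINT y|torus. of_real (W y) * (q1 y * cnj (p1 y))) +
       ((LINT y|torus. of_real (W' y) * (q1 y * cnj (p y))) + (LINT y|torus. of_real (W' y) * (q y * cnj (p1 y)))))"
    by (simp only: eq_neg_iff_add_eq_0)
  then have "cmod (LINT y|torus. ?R y) = cmod (2 * (LINT y|torus. of_real (W y) * (q1 y * cnj (p1 y))) +
       ((LINT y|torus. of_real (W' y) * (q1 y * cnj (p y))) + (LINT y|torus. of_real (W' y) * (q y * cnj (p1 y)))))"
    by (simp only: norm_minus_cancel)
  also have "\<dots> \<le> 2 * cmod (LINT y|torus. of_real (W y) * (q1 y * cnj (p1 y))) +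
       (cmod (LINT y|torus. of_real (W' y) * (q1 y * cnj (p y))) + cmod (LINT y|torus. of_real (W' y) * (q y * cnj (p1 y))))"
    by (intro order_trans[OF norm_triangle_ineq] add_mono) (simp_all add: norm_mult)
  also have "\<dots> \<le> 2 * (1 * (L2nrm torus q1 * L2nrm torus p1)) +
     (B * (L2nrm torus q1 * L2nrm torus p) + B * (L2nrm torus q * L2nrm torus p1))"
  proof -
    have m: "(\<lambda>y. complex_of_real (W y)) \<in> borel_measurable torus" "(\<lambda>y. complex_of_real (W' y)) \<in> borel_measurable torus"
      by (intro continuous_measurable_torus continuous_intros cW cW')+
    show ?thesis
      by (intro add_mono mult_left_mono weighted_Cauchy_Schwarz m L) (use b in auto)
  qed
  also have "\<dots> = (sqrt (2 * pi) * sqrt (2 * pi)) * (2 * (sqrt (dsq N c) * sqrt (dsq N c)) + 2 * B * (sqrt (nsq N c) * sqrt (dsq N c)))"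
    unfolding p_def p1_def q_def q1_def L2nrm_tp_nsq nsq_shift_coeff nsq_diff_coeff by (simp only: algebra_simps)
  also have "sqrt (2 * pi) * sqrt (2 * pi) = 2 * pi" by (intro real_sqrt_mult_self[THEN trans]) simp
  also have "sqrt (dsq N c) * sqrt (dsq N c) = dsq N c" using dsq_nonneg by simp
  finally show ?thesis unfolding tp_shift p_def p1_def p2_def q_def q1_def q2_def .
qed

section \<open>The weight on the subcells\<close>

context zigzag begin

text \<open>The weight \<open>wt m\<close> lives on the first subcell of every cell of level \<open>m\<close>, and \<open>step m\<close> moves that
  subcell to the last one of the same cell. The sign records whether \<open>u\<close> rises or falls across the
  cell; its jumps are at double zeros of the sine.\<close>

definition cell_sign :: "nat \<Rightarrow> int \<Rightarrow> real" where
  "cell_sign m l = (if int b dvd l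
     then sgn (E (of_int (l div int b + 1) / real b ^ m) - E (of_int (l div int b) / real b ^ m)) else 0)"

definition wt :: "nat \<Rightarrow> real \<Rightarrow> real" where
  "wt m y = cell_sign m \<lfloor>real b ^ Suc m * y / pi\<rfloor> * (sin (real b ^ Suc m * y))\<^sup>2"

definition wt' :: "nat \<Rightarrow> real \<Rightarrow> real" where
  "wt' m y = cell_sign m \<lfloor>real b ^ Suc m * y / pi\<rfloor> * (real b ^ Suc m * sin (2 * (real b ^ Suc m * y)))"

definition step :: "nat \<Rightarrow> real" where
  "step m = pi * (real b - 1) / real b ^ Suc m"

lemma cell_sign_abs: "\<bar>cell_sign m l\<bar> = (if int b dvd l then 1 else 0)"
proof -
  have "E (of_int (i + 1) / real b ^ m) - E (of_int i / real b ^ m) \<noteq> 0" for i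
    using E_cell_increment[of i m] q_gt1 by auto
  then show ?thesis by (auto simp: cell_sign_def abs_sgn_eq)
qed

lemma cell_sign_le: "\<bar>cell_sign m l\<bar> \<le> 1"
  by (simp add: cell_sign_abs)

lemma wt_le: "\<bar>wt m y\<bar> \<le> 1"
  unfolding wt_def abs_mult by (intro mult_le_one) (auto simp: cell_sign_le abs_square_le_1)

lemma wt'_le: "\<bar>wt' m y\<bar> \<le> real b ^ Suc m"
proof -
  have "\<bar>wt' m y\<bar> \<le> 1 * (real b ^ Suc m * 1)"
    unfolding wt'_def abs_mult
    by (intro mult_mono) (auto simp: cell_sign_le)
  then show ?thesis by simp
qed

lemma wt_cut:
  fixes m :: nat
  defines "M \<equiv> real b ^ Suc m"
  shows "wt m = (\<lambda>y. (\<lambda>x. cell_sign m \<lfloor>x\<rfloor> * (sin (pi * x))\<^sup>2) (M * y / pi))"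
    "wt' m = (\<lambda>y. (\<lambda>x. cell_sign m \<lfloor>x\<rfloor> * (pi * sin (2 * (pi * x)))) (M * y / pi) * (M / pi))"
  by (auto simp: wt_def wt'_def M_def fun_eq_iff)

lemma continuous_wt': "continuous_on A (wt' m)"
proof -
  have "isCont (\<lambda>x. cell_sign m \<lfloor>x\<rfloor> * (pi * sin (2 * (pi * x)))) x" for x
  proof (rule isCont_floor_cut)
    show "pi * sin (2 * (pi * real_of_int n)) = 0" for n
      using sin_floor_zero[of "2 * n"] by (simp add: mult_ac)
  qed (auto simp: cell_sign_le intro!: continuous_intros)
  then have c: "continuous_on UNIV (\<lambda>x. cell_sign m \<lfloor>x\<rfloor> * (pi * sin (2 * (pi * x))))"
    by (simp add: continuous_at_imp_continuous_on)
  show ?thesis unfolding wt_cut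
    by (intro continuous_on_mult continuous_on_compose2[OF c] continuous_intros) auto
qed

lemma DERIV_wt: "(wt m has_real_derivative wt' m y) (at y)"
proof -
  define M where "M = real b ^ Suc m"
  have "((\<lambda>x. cell_sign m \<lfloor>x\<rfloor> * (sin (pi * x))\<^sup>2) has_real_derivative
      cell_sign m \<lfloor>x\<rfloor> * (pi * sin (2 * (pi * x)))) (at x)" for x
  proof (rule DERIV_floor_cut)
    show "((\<lambda>x. (sin (pi * x))\<^sup>2) has_real_derivative pi * sin (2 * (pi * x))) (at x)"
      unfolding sin_double by (auto intro!: derivative_eq_intros)
    show "(sin (pi * real_of_int n))\<^sup>2 = 0" for n using sin_floor_zero[of n] by simp
    show "pi * sin (2 * (pi * real_of_int n)) = 0" for n
      using sin_floor_zero[of "2 * n"] by (simp add: mult_ac)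
  qed (rule cell_sign_le)
  moreover have "((\<lambda>y. M * y / pi) has_real_derivative M / pi) (at y)"
    by (auto intro!: derivative_eq_intros)
  ultimately have "((\<lambda>y. (\<lambda>x. cell_sign m \<lfloor>x\<rfloor> * (sin (pi * x))\<^sup>2) (M * y / pi)) has_real_derivative
      cell_sign m \<lfloor>M * y / pi\<rfloor> * (pi * sin (2 * (pi * (M * y / pi)))) * (M / pi)) (at y)"
    by (rule DERIV_chain2)
  then show ?thesis unfolding wt_cut M_def[symmetric] .
qed

lemma continuous_wt: "continuous_on A (wt m)"
  by (rule DERIV_continuous_on) (use DERIV_wt has_field_derivative_at_within in blast)

text \<open>One period of \<open>E\<close>, of length 2, consists of \<open>2 * b ^ (m + 1)\<close>
  subcells.\<close>

lemma cell_sign_periodic: "cell_sign m (l + 2 * int (b ^ Suc m)) = cell_sign m l"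
proof (cases "int b dvd l")
  case True
  have d: "(l + 2 * int (b ^ Suc m)) div int b = l div int b + 2 * int b ^ m"
  proof -
    have "l + 2 * int (b ^ Suc m) = l + (2 * int b ^ m) * int b" by simp
    then show ?thesis using b_gt1 by (simp only: div_mult_self1)
  qed
  have E: "E (of_int (i + 2 * int b ^ m) / real b ^ m) = E (of_int i / real b ^ m)" for i
    using E_periodic[of "of_int i / real b ^ m"] b_gt1 by (simp add: add_divide_distrib)
  have "int b dvd l + 2 * int (b ^ Suc m)" using True by simp
  moreover have "l div int b + 2 * int b ^ m + 1 = (l div int b + 1) + 2 * int b ^ m" by simp
  ultimately show ?thesis using True unfolding cell_sign_def d by (simp only: E if_True)
next
  case False
  then have "\<not> int b dvd l + 2 * int (b ^ Suc m)" by (simp add: dvd_add_left_iff)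
  then show ?thesis using False by (simp add: cell_sign_def)
qed

lemma wt_periodic: "wt m (y + 2 * pi) = wt m y"
proof -
  define M where "M = real b ^ Suc m"
  have "\<lfloor>M * (y + 2 * pi) / pi\<rfloor> = \<lfloor>M * y / pi\<rfloor> + 2 * int (b ^ Suc m)"
  proof -
    have "M * (y + 2 * pi) / pi = M * y / pi + of_int (2 * int (b ^ Suc m))"
      by (simp add: M_def field_simps)
    then show ?thesis by (simp only: floor_add_int)
  qed
  moreover have "sin (M * (y + 2 * pi)) = sin (M * y)"
  proof -
    have "M * (y + 2 * pi) = M * y + of_int (int (b ^ Suc m)) * (2 * pi)" by (simp add: M_def algebra_simps)
    then show ?thesis using sin.plus_of_int[of "M * y" "int (b ^ Suc m)"] by simp
  qed
  ultimately show ?thesis unfolding wt_def M_def[symmetric] by (simp only: cell_sign_periodic)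
qed

lemma V_first_subcell: "0 \<le> s \<Longrightarrow> s \<le> 1 \<Longrightarrow> V (s / real b) = V s / real q"
  using V_cell[of 0 0 s] q3 r3 by simp

lemma V_last_subcell: "0 \<le> s \<Longrightarrow> s \<le> 1 \<Longrightarrow> V ((real b - 1 + s) / real b) = (real q - 1 + V s) / real q"
proof -
  assume s: "0 \<le> s" "s \<le> 1"
  have "(q - 1) * r + (r - 1) = b - 1" using q3 r3 by (simp add: b_def algebra_simps)
  moreover have "even (r - 1)" using odd_r by simp
  ultimately show ?thesis
    using V_cell[of "q - 1" "r - 1" s] s q3 r3 b_ge by (simp add: of_nat_diff)
qed

text \<open>In every cell of level \<open>m\<close> the first and the last subcell carry the same graph, at heights
  that differ by \<open>\<plusminus>(q - 1) / q\<close> of the height of the cell.\<close>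

lemma wt_increment: "wt m y * (u (y + step m) - u y) = (real q - 1) / real q / real q ^ m * \<bar>wt m y\<bar>"
proof -
  define x where "x = real b ^ Suc m * y / pi"
  define l where "l = \<lfloor>x\<rfloor>"
  define s where "s = x - of_int l"
  define i where "i = l div int b"
  have wt: "wt m y = cell_sign m l * (sin (real b ^ Suc m * y))\<^sup>2" by (simp add: wt_def l_def x_def)
  have s: "0 \<le> s" "s \<le> 1" unfolding s_def l_def by linarith+
  have bp: "0 < real b" "0 < real b ^ m" using b_gt1 by auto
  show ?thesis
  proof (cases "int b dvd l")
    case False
    then show ?thesis by (simp add: wt cell_sign_def)
  next
    case True
    then have l: "real_of_int l = real b * of_int i" unfolding i_def
      by (metis dvd_mult_div_cancel of_int_mult of_int_of_nat_eq)
    have y: "y / pi = (of_int i + s / real b) / real b ^ m"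
    proof -
      have "y / pi = x / real b ^ Suc m" using bp by (simp add: x_def)
      also have "x = real b * of_int i + s" by (simp add: s_def l)
      finally show ?thesis using bp by (simp add: field_simps)
    qed
    have yh: "(y + step m) / pi = (of_int i + (real b - 1 + s) / real b) / real b ^ m"
    proof -
      have "(y + step m) / pi = y / pi + (real b - 1) / real b / real b ^ m"
        by (simp add: step_def add_divide_distrib)
      then show ?thesis unfolding y by (simp add: add_divide_distrib diff_divide_distrib)
    qed
    have sb: "0 \<le> s / real b" "s / real b \<le> 1" "0 \<le> (real b - 1 + s) / real b" "(real b - 1 + s) / real b \<le> 1"
      using s b_gt1 by (auto simp: field_simps)
    have sg: "cell_sign m l = sgn (E ((of_int i + 1) / real b ^ m) - E ((of_int i + 0) / real b ^ m))"
      using True by (simp add: cell_sign_def i_def)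
    have Qp: "0 < 1 / real q ^ m" using q_gt1 by simp
    have "cell_sign m l * (u (y + step m) - u y) = (real q - 1) / real q / real q ^ m \<and> \<bar>cell_sign m l\<bar> = 1"
    proof (rule E_cell[of i m])
      fix e assume e: "\<And>s. 0 \<le> s \<Longrightarrow> s \<le> 1 \<Longrightarrow> E ((of_int i + s) / real b ^ m) = e + V s / real q ^ m"
      have "cell_sign m l = 1" unfolding sg using e[of 0] e[of 1] q3 by (simp add: V_0 V_1)
      moreover have "u (y + step m) - u y = (real q - 1) / real q / real q ^ m"
        unfolding u_def y yh e[OF sb(1,2)] e[OF sb(3,4)] V_first_subcell[OF s] V_last_subcell[OF s]
        using q_gt1 by (simp add: field_simps)
      ultimately show ?thesis by simp
    next
      fix e assume e: "\<And>s. 0 \<le> s \<Longrightarrow> s \<le> 1 \<Longrightarrow> E ((of_int i + s) / real b ^ m) = e + V (1 - s) / real q ^ m"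
      have "cell_sign m l = - 1" unfolding sg using e[of 0] e[of 1] q3 by (simp add: V_0 V_1)
      moreover have "1 - s / real b = (real b - 1 + (1 - s)) / real b" "1 - (real b - 1 + s) / real b = (1 - s) / real b"
        using b_gt1 by (auto simp: field_simps)
      then have v: "V (1 - s / real b) = (real q - 1 + V (1 - s)) / real q" "V (1 - (real b - 1 + s) / real b) = V (1 - s) / real q"
        using V_last_subcell[of "1 - s"] V_first_subcell[of "1 - s"] s by auto
      then have "u (y + step m) - u y = - ((real q - 1) / real q / real q ^ m)"
        unfolding u_def y yh e[OF sb(1,2)] e[OF sb(3,4)] v
        using q_gt1 by (simp add: field_simps)
      ultimately show ?thesis by (simp only: mult_minus1 minus_minus abs_neg_one simp_thms)
    qed
    then have c: "cell_sign m l * (u (y + step m) - u y) = (real q - 1) / real q / real q ^ m" "\<bar>cell_sign m l\<bar> = 1"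
      by blast+
    have "wt m y * (u (y + step m) - u y) = (cell_sign m l * (u (y + step m) - u y)) * (sin (real b ^ Suc m * y))\<^sup>2"
      by (simp only: wt mult_ac)
    then show ?thesis unfolding c(1) by (simp add: wt abs_mult c(2))
  qed
qed

text \<open>Among \<open>b\<close> consecutive subcells exactly one is the first of its cell, and
  shifts by whole subcells leave the squared sine unchanged.\<close>

lemma sum_shifted_wt: "(\<Sum>j<b. \<bar>wt m (y - real j * (pi / real b ^ Suc m))\<bar>) = (sin (real b ^ Suc m * y))\<^sup>2"
proof -
  define M where "M = real b ^ Suc m"
  define l where "l = \<lfloor>M * y / pi\<rfloor>"
  have M: "0 < M" using b_gt1 by (simp add: M_def)
  have *: "\<bar>wt m (y - real j * (pi / M))\<bar> = (if j = nat (l mod int b) then (sin (M * y))\<^sup>2 else 0)" if "j < b" for j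
  proof -
    have x: "M * (y - real j * (pi / M)) / pi = M * y / pi - of_int (int j)" "M * (y - real j * (pi / M)) = M * y - of_int (int j) * pi"
      using M by (auto simp: field_simps)
    have "(sin (M * y - of_int (int j) * pi))\<^sup>2 = (sin (M * y))\<^sup>2"
    proof -
      have "sin (real_of_int (int j) * pi) = 0" using sin_floor_zero[of "int j"] by (simp add: mult.commute)
      moreover from this have "(cos (real_of_int (int j) * pi))\<^sup>2 = 1" using sin_cos_squared_add[of "real_of_int (int j) * pi"] by simp
      ultimately show ?thesis by (simp add: sin_diff power_mult_distrib)
    qed
    moreover have "\<lfloor>M * (y - real j * (pi / M)) / pi\<rfloor> = l - int j"
      unfolding x(1) l_def by (rule floor_diff_of_int)
    ultimately have "\<bar>wt m (y - real j * (pi / M))\<bar> = (if int b dvd l - int j then 1 else 0) * (sin (M * y))\<^sup>2"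
      unfolding wt_def M_def[symmetric] abs_mult cell_sign_abs x(2) by simp
    moreover have "int b dvd l - int j \<longleftrightarrow> j = nat (l mod int b)"
    proof -
      have "int b dvd l - int j \<longleftrightarrow> l mod int b = int j mod int b" by (simp add: mod_eq_dvd_iff)
      also have "\<dots> \<longleftrightarrow> l mod int b = int j" using that by simp
      also have "\<dots> \<longleftrightarrow> j = nat (l mod int b)" using b_ge by (auto simp: nat_eq_iff2)
      finally show ?thesis .
    qed
    ultimately show ?thesis by simp
  qed
  have "nat (l mod int b) < b" using b_ge by (simp add: nat_less_iff)
  moreover have "(\<Sum>j<b. \<bar>wt m (y - real j * (pi / M))\<bar>) = (\<Sum>j<b. if j = nat (l mod int b) then (sin (M * y))\<^sup>2 else 0)"
    by (rule sum.cong[OF refl *]) simp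
  ultimately show ?thesis unfolding M_def[symmetric] by (simp add: sum.delta)
qed

text \<open>Two averaging arguments bound from below the mass that the weight sees. The squared sine
  and its translate, the squared cosine, add up to 1, which gives the 2; the squared sine is the sum
  of \<open>b\<close> translates of \<open>\<bar>wt m\<bar>\<close>, which gives the
  \<open>b\<close>. All translations are by at most one cell width, whence the error.\<close>

lemma wt_mass:
  "nsq N c / (2 * real b) - 8 / real b ^ m * (sqrt (nsq N c) * sqrt (dsq N c))
    \<le> (LINT y|torus. \<bar>wt m y\<bar> * (cmod (tp N c y))\<^sup>2) / (2 * pi)"
proof -
  define M where "M = real b ^ Suc m"
  define S where "S = sqrt (nsq N c) * sqrt (dsq N c)"
  define X where "X = (LINT y|torus. \<bar>wt m y\<bar> * (cmod (tp N c y))\<^sup>2)"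
  define Y where "Y = (LINT y|torus. (sin (M * y))\<^sup>2 * (cmod (tp N c y))\<^sup>2)"
  have S0: "0 \<le> S" by (simp add: S_def nsq_nonneg dsq_nonneg)
  have b9: "9 \<le> real b" using b_ge by simp
  have M1: "real b \<le> M" unfolding M_def using b_gt1 self_le_power[of "real b" "Suc m"] by simp
  then have M0: "0 < M" using b_gt1 by simp
  have cs: "continuous_on UNIV (\<lambda>y. (sin (M * y))\<^sup>2)" "continuous_on UNIV (\<lambda>y. (cos (M * y))\<^sup>2)"
    by (intro continuous_intros)+
  have ca: "continuous_on A (\<lambda>y. \<bar>wt m (y - \<theta>)\<bar>)" for \<theta> A
    by (intro continuous_intros continuous_on_compose2[OF continuous_wt[of UNIV]]) auto
  have per2: "sin (M * (y + 2 * pi)) = sin (M * y)" "cos (M * (y + 2 * pi)) = cos (M * y)" for y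
  proof -
    have "M * (y + 2 * pi) = M * y + of_int (int (b ^ Suc m)) * (2 * pi)" by (simp add: M_def algebra_simps)
    then show "sin (M * (y + 2 * pi)) = sin (M * y)" "cos (M * (y + 2 * pi)) = cos (M * y)"
      using sin.plus_of_int[of "M * y" "int (b ^ Suc m)"] cos.plus_of_int[of "M * y" "int (b ^ Suc m)"] by simp_all
  qed
  have "2 * pi * nsq N c = (LINT y|torus. (cmod (tp N c y))\<^sup>2)"
    unfolding L2nrm_square[symmetric] L2nrm_tp nsq_def ..
  also have "\<dots> = (LINT y|torus. (sin (M * y))\<^sup>2 * (cmod (tp N c y))\<^sup>2 + (cos (M * y))\<^sup>2 * (cmod (tp N c y))\<^sup>2)"
    by (simp flip: distrib_right)
  also have "\<dots> = Y + (LINT y|torus. (cos (M * y))\<^sup>2 * (cmod (tp N c y))\<^sup>2)"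
    unfolding Y_def by (intro Bochner_Integration.integral_add continuous_integrable_torus continuous_intros)
  also have "(LINT y|torus. (cos (M * y))\<^sup>2 * (cmod (tp N c y))\<^sup>2) =
      (LINT y|torus. (cos (M * (y + pi / (2 * M))))\<^sup>2 * (cmod (tp N c (y + pi / (2 * M))))\<^sup>2)"
  proof (rule torus_integral_shift[symmetric])
    show "continuous_on UNIV (\<lambda>y. (cos (M * y))\<^sup>2 * (cmod (tp N c y))\<^sup>2)" by (intro continuous_intros)
    show "pi / (2 * M) \<le> 2 * pi" using M1 b9 by (simp add: field_simps)
  qed (use M0 per2 tp_periodic in auto)
  also have "\<dots> = (LINT y|torus. (sin (M * y))\<^sup>2 * (cmod (tp N c (y + pi / (2 * M))))\<^sup>2)"
  proof -
    have "cos (M * (y + pi / (2 * M))) = - sin (M * y)" for y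
    proof -
      have "M * (y + pi / (2 * M)) = M * y + pi / 2" using M0 by (simp add: field_simps)
      then show ?thesis by (simp add: cos_add)
    qed
    then show ?thesis by simp
  qed
  also have "\<dots> \<le> Y + 4 * pi * (pi / (2 * M)) * S"
    unfolding Y_def S_def using cs M0 by (intro weighted_shift_square) (auto simp: abs_square_le_1)
  finally have 1: "2 * pi * nsq N c \<le> 2 * Y + 2 * pi * (pi / M) * S" by (simp add: field_simps)
  have "Y = (LINT y|torus. (\<Sum>j<b. \<bar>wt m (y - real j * (pi / M))\<bar> * (cmod (tp N c y))\<^sup>2))"
    unfolding Y_def M_def sum_shifted_wt[symmetric] sum_distrib_right ..
  also have "\<dots> = (\<Sum>j<b. LINT y|torus. \<bar>wt m (y - real j * (pi / M))\<bar> * (cmod (tp N c y))\<^sup>2)"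
    by (intro Bochner_Integration.integral_sum continuous_integrable_torus continuous_intros ca)
  also have "\<dots> \<le> (\<Sum>j<b. X + 4 * pi * (real b * (pi / M)) * S)"
  proof (rule sum_mono)
    fix j assume "j \<in> {..<b}"
    then have j: "real j \<le> real b" by simp
    let ?\<theta> = "real j * (pi / M)"
    have "(LINT y|torus. \<bar>wt m (y - ?\<theta>)\<bar> * (cmod (tp N c y))\<^sup>2) =
        (LINT y|torus. \<bar>wt m (y + ?\<theta> - ?\<theta>)\<bar> * (cmod (tp N c (y + ?\<theta>)))\<^sup>2)"
    proof (rule torus_integral_shift[symmetric])
      show "continuous_on UNIV (\<lambda>y. \<bar>wt m (y - ?\<theta>)\<bar> * (cmod (tp N c y))\<^sup>2)"
        by (intro continuous_intros ca)
      have "wt m (y + 2 * pi - ?\<theta>) = wt m (y - ?\<theta>)" for y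
        using wt_periodic[of m "y - ?\<theta>"] by (simp add: algebra_simps)
      then show "\<bar>wt m (y + 2 * pi - ?\<theta>)\<bar> * (cmod (tp N c (y + 2 * pi)))\<^sup>2 = \<bar>wt m (y - ?\<theta>)\<bar> * (cmod (tp N c y))\<^sup>2" for y
        by (simp only: tp_periodic)
      have "real j * pi \<le> M * pi" using j M1 by (intro mult_right_mono) auto
      then have "real j * pi / M \<le> pi" using M0 by (simp add: field_simps)
      then have "real j * pi / M \<le> 2 * pi" using pi_gt_zero by linarith
      then show "?\<theta> \<le> 2 * pi" by simp
    qed (use M0 in auto)
    also have "\<dots> \<le> X + 4 * pi * ?\<theta> * S"
      unfolding X_def S_def add_diff_cancel_right' using M0 ca[of UNIV 0] wt_le[of m]
      by (intro weighted_shift_square) auto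
    also have "\<dots> \<le> X + 4 * pi * (real b * (pi / M)) * S"
      using j M0 S0 by (intro add_left_mono mult_right_mono mult_left_mono) auto
    finally show "(LINT y|torus. \<bar>wt m (y - ?\<theta>)\<bar> * (cmod (tp N c y))\<^sup>2) \<le> X + 4 * pi * (real b * (pi / M)) * S" .
  qed
  also have "\<dots> = real b * X + 4 * pi * ((real b)\<^sup>2 * (pi / M)) * S"
    by (simp add: distrib_left power2_eq_square)
  finally have 2: "Y \<le> real b * X + 4 * pi * ((real b)\<^sup>2 * (pi / M)) * S" .
  have "2 * pi * nsq N c \<le> 2 * (real b * X + 4 * pi * ((real b)\<^sup>2 * (pi / M)) * S) + 2 * pi * (pi / M) * S"
    by (rule order_trans[OF 1]) (intro add_right_mono mult_left_mono 2, simp)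
  also have "\<dots> = 2 * real b * X + 2 * pi * ((4 * pi * (real b)\<^sup>2 + pi) / M * S)"
    by (simp add: add_divide_distrib algebra_simps)
  also have "(4 * pi * (real b)\<^sup>2 + pi) / M * S \<le> 16 * (real b)\<^sup>2 / M * S"
  proof (intro mult_right_mono divide_right_mono)
    have "1 \<le> (real b)\<^sup>2" using b9 by (simp add: one_le_power)
    then have "pi \<le> pi * (real b)\<^sup>2" by simp
    moreover have "pi * (real b)\<^sup>2 \<le> (16 / 5) * (real b)\<^sup>2"
      using pi_approx by (intro mult_right_mono) auto
    ultimately show "4 * pi * (real b)\<^sup>2 + pi \<le> 16 * (real b)\<^sup>2" by linarith
  qed (use M0 S0 in auto)
  finally have "2 * pi * nsq N c \<le> 2 * real b * X + 2 * pi * (16 * (real b)\<^sup>2 / M * S)" by simp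
  also have "16 * (real b)\<^sup>2 / M * S = 16 * ((real b)\<^sup>2 / M) * S" by simp
  also have "(real b)\<^sup>2 / M = real b / real b ^ m" using b_gt1 by (simp add: M_def power2_eq_square)
  finally have "2 * pi * nsq N c \<le> 2 * real b * X + 2 * pi * (16 * (real b / real b ^ m) * S)" .
  then have "2 * pi * nsq N c / (4 * pi * real b) \<le> (2 * real b * X + 2 * pi * (16 * (real b / real b ^ m) * S)) / (4 * pi * real b)"
    using b_gt1 by (intro divide_right_mono) auto
  moreover have "2 * pi * nsq N c / (4 * pi * real b) = nsq N c / (2 * real b)" by simp
  moreover have "(2 * real b * X + 2 * pi * (16 * (real b / real b ^ m) * S)) / (4 * pi * real b) = X / (2 * pi) + 8 / real b ^ m * S"
    using b_gt1 by (simp add: field_simps)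
  ultimately have "nsq N c / (2 * real b) \<le> X / (2 * pi) + 8 / real b ^ m * S" by simp
  then show ?thesis unfolding X_def S_def by linarith
qed

text \<open>Replaces the square in \<open>wt_mass\<close> by a correlation over the distance
  \<open>step m\<close>. As \<open>step m \<le> 4 / b ^ m\<close>, this adds 4 to the 8 of
  \<open>wt_mass\<close>.\<close>

lemma wt_correlation:
  "nsq N c / (2 * real b) - 12 / real b ^ m * (sqrt (nsq N c) * sqrt (dsq N c))
    \<le> (LINT y|torus. \<bar>wt m y\<bar> * Re (tp N c (y + step m) * cnj (tp N c y))) / (2 * pi)"
proof -
  define S where "S = sqrt (nsq N c) * sqrt (dsq N c)"
  let ?p = "tp N c" and ?t = "\<lambda>y. tp N c (y + step m)"
  have S0: "0 \<le> S" by (simp add: S_def nsq_nonneg dsq_nonneg)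
  have ct: "continuous_on UNIV ?t" unfolding tp_shift by (rule continuous_on_tp)
  have L: "?p \<in> L2 torus" "(\<lambda>y. ?t y - ?p y) \<in> L2 torus"
    by (intro continuous_L2_torus continuous_intros ct)+
  have i: "integrable torus (\<lambda>y. \<bar>wt m y\<bar> * (cmod (?p y))\<^sup>2)" "integrable torus (\<lambda>y. cmod (?t y - ?p y) * cmod (?p y))"
    "integrable torus (\<lambda>y. \<bar>wt m y\<bar> * Re (?t y * cnj (?p y)))"
    by (intro continuous_integrable_torus continuous_intros ct continuous_wt)+
  have "(LINT y|torus. \<bar>wt m y\<bar> * (cmod (?p y))\<^sup>2) - (LINT y|torus. cmod (?t y - ?p y) * cmod (?p y)) =
      (LINT y|torus. \<bar>wt m y\<bar> * (cmod (?p y))\<^sup>2 - cmod (?t y - ?p y) * cmod (?p y))"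
    using i by simp
  also have "\<dots> \<le> (LINT y|torus. \<bar>wt m y\<bar> * Re (?t y * cnj (?p y)))"
  proof (rule integral_mono)
    fix y
    have "?t y * cnj (?p y) = of_real ((cmod (?p y))\<^sup>2) + (?t y - ?p y) * cnj (?p y)"
      unfolding complex_norm_square by (simp add: algebra_simps)
    then have "Re (?t y * cnj (?p y)) = (cmod (?p y))\<^sup>2 + Re ((?t y - ?p y) * cnj (?p y))" by simp
    moreover have "- (cmod (?t y - ?p y) * cmod (?p y)) \<le> Re ((?t y - ?p y) * cnj (?p y))"
      using abs_Re_le_cmod[of "(?t y - ?p y) * cnj (?p y)"] unfolding norm_mult complex_mod_cnj by linarith
    ultimately have "\<bar>wt m y\<bar> * ((cmod (?p y))\<^sup>2 - cmod (?t y - ?p y) * cmod (?p y)) \<le> \<bar>wt m y\<bar> * Re (?t y * cnj (?p y))"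
      by (intro mult_left_mono) auto
    moreover have "\<bar>wt m y\<bar> * (cmod (?t y - ?p y) * cmod (?p y)) \<le> 1 * (cmod (?t y - ?p y) * cmod (?p y))"
      using wt_le by (intro mult_right_mono) auto
    ultimately show "\<bar>wt m y\<bar> * (cmod (?p y))\<^sup>2 - cmod (?t y - ?p y) * cmod (?p y) \<le> \<bar>wt m y\<bar> * Re (?t y * cnj (?p y))"
      by (simp add: right_diff_distrib)
  qed (use i in auto)
  finally have 1: "(LINT y|torus. \<bar>wt m y\<bar> * (cmod (?p y))\<^sup>2) \<le>
      (LINT y|torus. \<bar>wt m y\<bar> * Re (?t y * cnj (?p y))) + (LINT y|torus. cmod (?t y - ?p y) * cmod (?p y))"
    by simp
  have "(LINT y|torus. cmod (?t y - ?p y) * cmod (?p y)) \<le> L2nrm torus (\<lambda>y. ?t y - ?p y) * L2nrm torus ?p"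
    by (intro L2_Cauchy_Schwarz_cmod L)
  also have "\<dots> \<le> (sqrt (2 * pi) * (\<bar>step m\<bar> * sqrt (dsq N c))) * (sqrt (2 * pi) * sqrt (nsq N c))"
    unfolding L2nrm_tp_nsq by (intro mult_right_mono L2nrm_shift_diff) (simp add: nsq_nonneg)
  also have "\<dots> = (sqrt (2 * pi) * sqrt (2 * pi)) * (\<bar>step m\<bar> * S)"
    unfolding S_def by (simp only: mult_ac)
  also have "sqrt (2 * pi) * sqrt (2 * pi) = 2 * pi" by (intro real_sqrt_mult_self[THEN trans]) simp
  also have "\<bar>step m\<bar> \<le> 4 / real b ^ m"
  proof -
    have "step m = pi * ((real b - 1) / real b) / real b ^ m" by (simp add: step_def)
    moreover have "pi * ((real b - 1) / real b) \<le> 4 * 1"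
      using b_gt1 pi_less_4 by (intro mult_mono) auto
    ultimately have "step m \<le> 4 * 1 / real b ^ m" by (simp only:) (intro divide_right_mono, auto)
    moreover have "0 \<le> step m" using b_gt1 by (simp add: step_def)
    ultimately show ?thesis by simp
  qed
  finally have "(LINT y|torus. cmod (?t y - ?p y) * cmod (?p y)) \<le> 2 * pi * (4 / real b ^ m * S)"
    using S0 by (simp add: mult_left_mono mult_right_mono)
  with 1 have "(LINT y|torus. \<bar>wt m y\<bar> * (cmod (?p y))\<^sup>2) / (2 * pi) \<le>
      ((LINT y|torus. \<bar>wt m y\<bar> * Re (?t y * cnj (?p y))) + 2 * pi * (4 / real b ^ m * S)) / (2 * pi)"
    by (intro divide_right_mono) auto
  also have "\<dots> = (LINT y|torus. \<bar>wt m y\<bar> * Re (?t y * cnj (?p y))) / (2 * pi) + 4 / real b ^ m * S"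
    by (simp add: add_divide_distrib)
  finally show ?thesis using wt_mass[of N c m] unfolding S_def by linarith
qed

end

section \<open>Evolution of the twisted energy\<close>

lemma L2nrm_shift:
  assumes "continuous_on UNIV F" "\<And>y. F (y + 2 * pi) = F y" "0 \<le> h" "h \<le> 2 * pi"
  shows "L2nrm torus (\<lambda>y. F (y + h)) = L2nrm torus F"
  unfolding L2nrm_def
  by (subst torus_integral_shift[of "\<lambda>y. (cmod (F y))\<^sup>2"]) (use assms in \<open>auto intro!: continuous_intros\<close>)

lemma L2nrm_cnj: "L2nrm M (\<lambda>z. cnj (f z)) = L2nrm M f"
  by (simp add: L2nrm_def)

text \<open>Here \<open>x\<close> and \<open>z\<close> stand for the norms of the truncated mode and
  of its derivative, \<open>N1\<close> and \<open>N2\<close> for the rates of the energy and of the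
  twist. One half of the dissipation in \<open>N1\<close> absorbs the diffusive terms of
  \<open>\<gamma> * N2\<close>, the other half part of the cross term in \<open>x * z\<close>. One
  half of the damping in \<open>\<gamma> * N2\<close> absorbs the rest of the cross term, and the
  other half gives the decay.\<close>

lemma hypocoercive_arith:
  fixes x z :: real
  assumes N1: "N1 \<le> - 2 * \<nu> * (\<kappa>\<^sup>2 * x\<^sup>2 + z\<^sup>2) + err"
    and N2: "N2 \<le> - \<kappa> * Q * (x\<^sup>2 / (2 * B) - 12 * \<delta> * (x * z)) + err + 2 * \<nu> * \<kappa>\<^sup>2 * x\<^sup>2 + \<nu> * (2 * z\<^sup>2 + 2 * D * (x * z))"
    and \<gamma>: "0 \<le> \<gamma>" "\<gamma> \<le> 1 / 2" and \<nu>: "0 < \<nu>"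
    and small: "\<gamma> * (12 * \<kappa> * Q * \<delta> + 2 * \<nu> * D)\<^sup>2 \<le> \<nu> * \<kappa> * Q / B"
    and lam: "0 \<le> \<mu>" "2 * \<mu> \<le> \<gamma> * \<kappa> * Q / (4 * B)" and F: "F \<le> 2 * x\<^sup>2" and err: "0 \<le> err"
  shows "N1 + \<gamma> * N2 \<le> - \<mu> * F + 2 * err"
proof -
  define \<Theta> where "\<Theta> = 12 * \<kappa> * Q * \<delta> + 2 * \<nu> * D"
  have "\<gamma> * N2 \<le> \<gamma> * (- \<kappa> * Q * (x\<^sup>2 / (2 * B) - 12 * \<delta> * (x * z)) + err + 2 * \<nu> * \<kappa>\<^sup>2 * x\<^sup>2 + \<nu> * (2 * z\<^sup>2 + 2 * D * (x * z)))"
    using N2 \<gamma>(1) by (rule mult_left_mono)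
  also have "\<dots> = - 2 * (\<gamma> * \<kappa> * Q / (4 * B) * x\<^sup>2) + \<gamma> * \<Theta> * (x * z) + \<gamma> * err + 2 * \<gamma> * (\<nu> * (\<kappa>\<^sup>2 * x\<^sup>2 + z\<^sup>2))"
    by (simp add: \<Theta>_def algebra_simps)
  finally have 1: "\<gamma> * N2 \<le> - 2 * (\<gamma> * \<kappa> * Q / (4 * B) * x\<^sup>2) + \<gamma> * \<Theta> * (x * z) + \<gamma> * err + 2 * \<gamma> * (\<nu> * (\<kappa>\<^sup>2 * x\<^sup>2 + z\<^sup>2))" .
  have 2: "2 * \<gamma> * (\<nu> * (\<kappa>\<^sup>2 * x\<^sup>2 + z\<^sup>2)) \<le> 1 * (\<nu> * (\<kappa>\<^sup>2 * x\<^sup>2 + z\<^sup>2))"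
    using \<gamma> \<nu> by (intro mult_right_mono) auto
  have 3: "\<gamma> * err \<le> 1 * err" using \<gamma> err by (intro mult_right_mono) auto
  have 4: "\<gamma> * \<Theta> * (x * z) \<le> \<nu> * z\<^sup>2 + \<gamma> * \<kappa> * Q / (4 * B) * x\<^sup>2"
  proof -
    \<comment> \<open>Young's inequality, weighted so that \<open>small\<close> bounds the term in
      \<open>x\<^sup>2\<close> by half of the damping.\<close>
    have "0 \<le> (2 * \<nu> * z - \<gamma> * \<Theta> * x)\<^sup>2" by simp
    then have "4 * \<nu> * (\<gamma> * \<Theta> * (x * z)) \<le> 4 * \<nu> * (\<nu> * z\<^sup>2) + \<gamma> * (\<gamma> * \<Theta>\<^sup>2) * x\<^sup>2"
      by (simp add: power2_eq_square algebra_simps)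
    also have "\<gamma> * (\<gamma> * \<Theta>\<^sup>2) * x\<^sup>2 \<le> \<gamma> * (\<nu> * \<kappa> * Q / B) * x\<^sup>2"
      using small \<gamma>(1) unfolding \<Theta>_def by (intro mult_right_mono mult_left_mono) auto
    also have "\<gamma> * (\<nu> * \<kappa> * Q / B) * x\<^sup>2 = 4 * \<nu> * (\<gamma> * \<kappa> * Q / (4 * B) * x\<^sup>2)" by simp
    finally have "4 * \<nu> * (\<gamma> * \<Theta> * (x * z)) \<le> 4 * \<nu> * (\<nu> * z\<^sup>2 + \<gamma> * \<kappa> * Q / (4 * B) * x\<^sup>2)"
      by (simp add: distrib_left)
    then show ?thesis using \<nu> by (simp only: mult_le_cancel_left_pos mult_pos_pos zero_less_numeral)
  qed
  have 5: "\<nu> * z\<^sup>2 \<le> \<nu> * (\<kappa>\<^sup>2 * x\<^sup>2 + z\<^sup>2)" using \<nu> by (intro mult_left_mono) auto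
  have "\<mu> * F \<le> \<mu> * (2 * x\<^sup>2)" using F lam(1) by (rule mult_left_mono)
  also have "\<mu> * (2 * x\<^sup>2) \<le> \<gamma> * \<kappa> * Q / (4 * B) * x\<^sup>2"
    using mult_right_mono[OF lam(2), of "x\<^sup>2"] by simp
  finally show ?thesis using N1 1 2 3 4 5 by (simp add: algebra_simps) 
qed

context zigzag begin

definition twist :: "nat \<Rightarrow> nat \<Rightarrow> (int \<Rightarrow> complex) \<Rightarrow> (int \<Rightarrow> complex) \<Rightarrow> complex" where
  "twist m N a c = (LINT y|torus. of_real (wt m y) * (tp N a (y + step m) * cnj (tp N c y)))"

lemma step_range: "0 \<le> step m" "step m \<le> 2 * pi"
proof -
  show "0 \<le> step m" using b_gt1 by (simp add: step_def)
  have "real b \<le> real b ^ Suc m" by (rule self_le_power) (use b_gt1 in auto)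
  then have "real b - 1 \<le> real b ^ Suc m" by linarith
  then have "(real b - 1) / real b ^ Suc m \<le> 1" using b_gt1 by simp
  then have "pi * ((real b - 1) / real b ^ Suc m) \<le> pi * 1" by (intro mult_left_mono) auto
  then have "step m \<le> pi" by (simp add: step_def)
  then show "step m \<le> 2 * pi" using pi_gt_zero by linarith
qed

lemma continuous_tp_step: "continuous_on A (\<lambda>y. tp N a (y + step m))"
  unfolding tp_shift by (rule continuous_on_tp)

text \<open>The integrals no longer contain the coefficients, so the time derivative of
  \<open>twist\<close> is that of a finite sesquilinear expression.\<close>

lemma twist_sum:
  "twist m N a c = (\<Sum>n\<in>{-int N..int N}. \<Sum>l\<in>{-int N..int N}. a n * cnj (c l) *
     (LINT y|torus. of_real (wt m y) * (cis (of_int n * (y + step m)) * cis (- of_int l * y))))"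
proof -
  have "twist m N a c = (LINT y|torus. (\<Sum>n\<in>{-int N..int N}. \<Sum>l\<in>{-int N..int N}. a n * cnj (c l) *
     (of_real (wt m y) * (cis (of_int n * (y + step m)) * cis (- of_int l * y)))))"
    unfolding twist_def tp_def
    by (intro Bochner_Integration.integral_cong refl)
      (simp add: sum_product sum_distrib_left cis_cnj mult_ac)
  also have "\<dots> = (\<Sum>n\<in>{-int N..int N}. LINT y|torus. (\<Sum>l\<in>{-int N..int N}. a n * cnj (c l) *
     (of_real (wt m y) * (cis (of_int n * (y + step m)) * cis (- of_int l * y)))))"
    by (intro Bochner_Integration.integral_sum continuous_integrable_torus continuous_intros continuous_wt)
  also have "\<dots> = (\<Sum>n\<in>{-int N..int N}. \<Sum>l\<in>{-int N..int N}. LINT y|torus. a n * cnj (c l) *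
     (of_real (wt m y) * (cis (of_int n * (y + step m)) * cis (- of_int l * y))))"
    by (intro sum.cong refl Bochner_Integration.integral_sum continuous_integrable_torus continuous_intros continuous_wt)
  also have "\<dots> = (\<Sum>n\<in>{-int N..int N}. \<Sum>l\<in>{-int N..int N}. a n * cnj (c l) *
     (LINT y|torus. of_real (wt m y) * (cis (of_int n * (y + step m)) * cis (- of_int l * y))))"
    by simp
  finally show ?thesis .
qed

lemma twist_has_vector_derivative:
  assumes "\<And>n. (c n has_vector_derivative c' n) (at t within A)"
  shows "((\<lambda>t. twist m N (\<lambda>n. c n t) (\<lambda>n. c n t)) has_vector_derivative
     twist m N c' (\<lambda>n. c n t) + twist m N (\<lambda>n. c n t) c') (at t within A)"
proof -
  let ?\<beta> = "\<lambda>n l. LINT y|torus. of_real (wt m y) * (cis (of_int n * (y + step m)) * cis (- of_int l * y))"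
  have "((\<lambda>t. twist m N (\<lambda>n. c n t) (\<lambda>n. c n t)) has_vector_derivative
     (\<Sum>n\<in>{-int N..int N}. \<Sum>l\<in>{-int N..int N}. (c n t * cnj (c' l) + c' n * cnj (c l t)) * ?\<beta> n l)) (at t within A)"
    unfolding twist_sum
    by (intro has_vector_derivative_sum has_vector_derivative_mult_left has_vector_derivative_mult has_vector_derivative_cnj assms)
  then show ?thesis
    unfolding twist_sum by (simp add: sum.distrib[symmetric] distrib_right add.commute)
qed

lemma twist_lincomb:
  "twist m N (\<lambda>n. x * a n + y * c n + z * e n) d = x * twist m N a d + y * twist m N c d + z * twist m N e d"
  "twist m N d (\<lambda>n. x * a n + y * c n + z * e n) = cnj x * twist m N d a + cnj y * twist m N d c + cnj z * twist m N d e"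
  unfolding twist_sum by (simp_all add: sum.distrib sum_distrib_left algebra_simps)

lemma measurable_wt: "(\<lambda>y. complex_of_real (wt m y)) \<in> borel_measurable torus"
  by (intro continuous_measurable_torus continuous_intros continuous_wt)

lemma norm_twist_le: "cmod (twist m N c c) \<le> 2 * pi * nsq N c"
proof -
  have "cmod (twist m N c c) \<le> 1 * (L2nrm torus (\<lambda>y. tp N c (y + step m)) * L2nrm torus (tp N c))"
    unfolding twist_def
    by (intro weighted_Cauchy_Schwarz measurable_wt continuous_L2_torus continuous_tp_step continuous_on_tp) (simp add: wt_le)
  also have "\<dots> = (sqrt (2 * pi) * sqrt (2 * pi)) * (sqrt (nsq N c) * sqrt (nsq N c))"
    unfolding tp_shift L2nrm_tp_nsq nsq_shift_coeff by (simp only: mult_ac mult_1)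
  also have "sqrt (2 * pi) * sqrt (2 * pi) = 2 * pi" by (intro real_sqrt_mult_self[THEN trans]) simp
  also have "sqrt (nsq N c) * sqrt (nsq N c) = nsq N c" using nsq_nonneg by simp
  finally show ?thesis .
qed

text \<open>The Galerkin error: \<open>c\<close> and \<open>d\<close> stand for the Fourier coefficients of a function \<open>g\<close> and of
  \<open>u * g\<close>.\<close>

definition defect :: "nat \<Rightarrow> (int \<Rightarrow> complex) \<Rightarrow> (int \<Rightarrow> complex) \<Rightarrow> real" where
  "defect N c d = L2nrm torus (\<lambda>y. tp N d y - of_real (u y) * tp N c y) / sqrt (2 * pi)"

lemma defect_nonneg: "0 \<le> defect N c d"
  by (simp add: defect_def)

lemma L2nrm_defect: "L2nrm torus (\<lambda>y. tp N d y - of_real (u y) * tp N c y) * L2nrm torus (tp N c) = 2 * pi * (defect N c d * sqrt (nsq N c))"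
proof -
  have "sqrt (2 * pi) * sqrt (2 * pi) = 2 * pi" by (intro real_sqrt_mult_self[THEN trans]) simp
  then have "2 * pi * (defect N c d * sqrt (nsq N c)) = (sqrt (2 * pi) * sqrt (2 * pi)) * (defect N c d * sqrt (nsq N c))" by (simp only:)
  also have "\<dots> = (sqrt (2 * pi) * defect N c d) * (sqrt (2 * pi) * sqrt (nsq N c))" by (simp only: mult_ac)
  also have "sqrt (2 * pi) * defect N c d = L2nrm torus (\<lambda>y. tp N d y - of_real (u y) * tp N c y)"
    by (simp add: defect_def)
  finally show ?thesis by (simp only: L2nrm_tp_nsq)
qed

text \<open>If \<open>tp N d\<close> were exactly \<open>u\<close> times \<open>tp N c\<close>, the
  sum would be a multiple of the integral of \<open>u\<close> times a squared modulus, which is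
  real. Only the defect contributes an imaginary part.\<close>

lemma energy_transport:
  "\<bar>Im (\<Sum>n\<in>{-int N..int N}. d n * cnj (c n))\<bar> \<le> defect N c d * sqrt (nsq N c)"
proof -
  let ?p = "tp N c" and ?e = "\<lambda>y. tp N d y - of_real (u y) * tp N c y"
  have cu: "continuous_on UNIV u" by (rule continuous_u)
  have L: "?p \<in> L2 torus" "?e \<in> L2 torus"
    by (intro continuous_L2_torus continuous_intros cu)+
  have "of_real (2 * pi) * (\<Sum>n\<in>{-int N..int N}. d n * cnj (c n)) = (LINT y|torus. tp N d y * cnj (?p y))"
    unfolding L2_mult_cnj_tp[OF tp_L2] fc_tp by (intro arg_cong2[where f = "(*)"] sum.cong) auto
  also have "\<dots> = (LINT y|torus. of_real (u y * (cmod (?p y))\<^sup>2) + ?e y * cnj (?p y))"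
    by (intro Bochner_Integration.integral_cong refl) (simp add: complex_norm_square algebra_simps del: of_real_power)
  also have "\<dots> = (LINT y|torus. complex_of_real (u y * (cmod (?p y))\<^sup>2)) + (LINT y|torus. ?e y * cnj (?p y))"
    by (intro Bochner_Integration.integral_add continuous_integrable_torus continuous_intros cu)
  also have "(LINT y|torus. complex_of_real (u y * (cmod (?p y))\<^sup>2)) = of_real (LINT y|torus. u y * (cmod (?p y))\<^sup>2)"
    by (rule integral_complex_of_real)
  finally have "Im (of_real (2 * pi) * (\<Sum>n\<in>{-int N..int N}. d n * cnj (c n))) = Im (LINT y|torus. ?e y * cnj (?p y))"
    by (simp only: plus_complex.sel Im_complex_of_real add_0)
  moreover have "Im (of_real x * z) = x * Im z" for x z by simp
  ultimately have "2 * pi * Im (\<Sum>n\<in>{-int N..int N}. d n * cnj (c n)) = Im (LINT y|torus. ?e y * cnj (?p y))"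
    by (simp only:)
  then have "2 * pi * \<bar>Im (\<Sum>n\<in>{-int N..int N}. d n * cnj (c n))\<bar> = \<bar>Im (LINT y|torus. ?e y * cnj (?p y))\<bar>"
    by (metis abs_mult abs_of_pos mult_pos_pos pi_gt_zero zero_less_numeral)
  also have "\<dots> \<le> cmod (LINT y|torus. ?e y * cnj (?p y))" by (rule abs_Im_le_cmod)
  also have "\<dots> \<le> L2nrm torus ?e * L2nrm torus (\<lambda>y. cnj (?p y))"
    by (intro L2_Cauchy_Schwarz L L2_cnj)
  also have "\<dots> = 2 * pi * (defect N c d * sqrt (nsq N c))"
    unfolding L2nrm_cnj by (rule L2nrm_defect)
  finally show ?thesis by simp
qed

text \<open>Multiplication by \<open>u\<close> in the two slots of the correlation leaves the weight
  \<open>wt m y * (u (y + step m) - u y)\<close>, which \<open>wt_increment\<close> makes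
  nonnegative, so that \<open>wt_correlation\<close> gives coercivity. Each slot adds one
  defect.\<close>

lemma twist_transport:
  "(real q - 1) / real q / real q ^ m * (nsq N c / (2 * real b) - 12 / real b ^ m * (sqrt (nsq N c) * sqrt (dsq N c)))
     - 2 * (defect N c d * sqrt (nsq N c)) \<le> Re (twist m N d c - twist m N c d) / (2 * pi)"
proof -
  let ?p = "tp N c" and ?e = "\<lambda>y. tp N d y - of_real (u y) * tp N c y"
  let ?h = "step m"
  have cu: "continuous_on A u" for A by (rule continuous_u)
  have cuh: "continuous_on UNIV (\<lambda>y. u (y + ?h))"
    by (intro continuous_on_compose2[OF cu[of UNIV]] continuous_intros) auto
  have ce: "continuous_on UNIV ?e" by (intro continuous_intros cu)
  have ceh: "continuous_on UNIV (\<lambda>y. ?e (y + ?h))"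
    by (intro continuous_on_compose2[OF ce] continuous_intros) auto
  note cp = continuous_tp_step continuous_on_tp continuous_wt
  have pe: "?e (y + 2 * pi) = ?e y" for y by (simp add: tp_periodic u_periodic)
  have "twist m N d c - twist m N c d = (LINT y|torus. of_real (wt m y) * (tp N d (y + ?h) * cnj (?p y)) - of_real (wt m y) * (?p (y + ?h) * cnj (tp N d y)))"
    unfolding twist_def
    by (intro Bochner_Integration.integral_diff[symmetric] continuous_integrable_torus continuous_intros cp)
  also have "\<dots> = (LINT y|torus. of_real (wt m y * (u (y + ?h) - u y)) * (?p (y + ?h) * cnj (?p y)) +
      (of_real (wt m y) * (?e (y + ?h) * cnj (?p y)) - of_real (wt m y) * (?p (y + ?h) * cnj (?e y))))"
    by (intro Bochner_Integration.integral_cong refl) (simp add: algebra_simps)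
  also have "\<dots> = (LINT y|torus. of_real (wt m y * (u (y + ?h) - u y)) * (?p (y + ?h) * cnj (?p y))) +
      (LINT y|torus. of_real (wt m y) * (?e (y + ?h) * cnj (?p y)) - of_real (wt m y) * (?p (y + ?h) * cnj (?e y)))"
    by (intro Bochner_Integration.integral_add continuous_integrable_torus continuous_intros cp cu cuh ceh)
  also have "(LINT y|torus. of_real (wt m y) * (?e (y + ?h) * cnj (?p y)) - of_real (wt m y) * (?p (y + ?h) * cnj (?e y))) =
      (LINT y|torus. of_real (wt m y) * (?e (y + ?h) * cnj (?p y))) - (LINT y|torus. of_real (wt m y) * (?p (y + ?h) * cnj (?e y)))"
    by (intro Bochner_Integration.integral_diff continuous_integrable_torus continuous_intros cp cu cuh ceh)
  finally have eq: "twist m N d c - twist m N c d = (LINT y|torus. of_real (wt m y * (u (y + ?h) - u y)) * (?p (y + ?h) * cnj (?p y))) +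
      ((LINT y|torus. of_real (wt m y) * (?e (y + ?h) * cnj (?p y))) - (LINT y|torus. of_real (wt m y) * (?p (y + ?h) * cnj (?e y))))" .
  have main: "Re (LINT y|torus. of_real (wt m y * (u (y + ?h) - u y)) * (?p (y + ?h) * cnj (?p y))) =
      (real q - 1) / real q / real q ^ m * (LINT y|torus. \<bar>wt m y\<bar> * Re (?p (y + ?h) * cnj (?p y)))"
  proof -
    have "Re (LINT y|torus. of_real (wt m y * (u (y + ?h) - u y)) * (?p (y + ?h) * cnj (?p y))) =
      (LINT y|torus. Re (of_real (wt m y * (u (y + ?h) - u y)) * (?p (y + ?h) * cnj (?p y))))"
      by (intro integral_Re[symmetric] continuous_integrable_torus continuous_intros cp cu cuh)
    also have "\<dots> = (LINT y|torus. (real q - 1) / real q / real q ^ m * (\<bar>wt m y\<bar> * Re (?p (y + ?h) * cnj (?p y))))"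
    proof -
      have re: "Re (of_real x * z) = x * Re z" for x z by simp
      show ?thesis unfolding wt_increment re by (simp only: mult.assoc)
    qed
    also have "\<dots> = (real q - 1) / real q / real q ^ m * (LINT y|torus. \<bar>wt m y\<bar> * Re (?p (y + ?h) * cnj (?p y)))"
      by (rule Bochner_Integration.integral_mult_right_zero)
    finally show ?thesis .
  qed
  have L: "?p \<in> L2 torus" "?e \<in> L2 torus" "(\<lambda>y. ?p (y + ?h)) \<in> L2 torus" "(\<lambda>y. ?e (y + ?h)) \<in> L2 torus"
    by (intro continuous_L2_torus ce ceh cp)+
  have e1: "cmod (LINT y|torus. of_real (wt m y) * (?e (y + ?h) * cnj (?p y))) \<le> 2 * pi * (defect N c d * sqrt (nsq N c))"
  proof -
    have "cmod (LINT y|torus. of_real (wt m y) * (?e (y + ?h) * cnj (?p y))) \<le> 1 * (L2nrm torus (\<lambda>y. ?e (y + ?h)) * L2nrm torus ?p)"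
      by (intro weighted_Cauchy_Schwarz measurable_wt L) (simp add: wt_le)
    also have "L2nrm torus (\<lambda>y. ?e (y + ?h)) = L2nrm torus ?e"
      by (rule L2nrm_shift[OF ce pe step_range])
    finally show ?thesis unfolding L2nrm_defect by simp
  qed
  have e2: "cmod (LINT y|torus. of_real (wt m y) * (?p (y + ?h) * cnj (?e y))) \<le> 2 * pi * (defect N c d * sqrt (nsq N c))"
  proof -
    have "cmod (LINT y|torus. of_real (wt m y) * (?p (y + ?h) * cnj (?e y))) \<le> 1 * (L2nrm torus (\<lambda>y. ?p (y + ?h)) * L2nrm torus ?e)"
      by (intro weighted_Cauchy_Schwarz measurable_wt L) (simp add: wt_le)
    also have "L2nrm torus (\<lambda>y. ?p (y + ?h)) = L2nrm torus ?p"
      unfolding tp_shift L2nrm_tp_nsq nsq_shift_coeff ..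
    finally show ?thesis using L2nrm_defect[of N d c] by (simp add: mult.commute)
  qed
  let ?Z = "(LINT y|torus. \<bar>wt m y\<bar> * Re (?p (y + ?h) * cnj (?p y)))"
  have "(real q - 1) / real q / real q ^ m * ?Z - 2 * (2 * pi * (defect N c d * sqrt (nsq N c))) \<le> Re (twist m N d c - twist m N c d)"
    unfolding eq plus_complex.simps minus_complex.simps main
    using e1 e2 abs_Re_le_cmod[of "LINT y|torus. of_real (wt m y) * (?e (y + ?h) * cnj (?p y))"]
      abs_Re_le_cmod[of "LINT y|torus. of_real (wt m y) * (?p (y + ?h) * cnj (?e y))"] by linarith
  then have "((real q - 1) / real q / real q ^ m * ?Z - 2 * (2 * pi * (defect N c d * sqrt (nsq N c)))) / (2 * pi) \<le> Re (twist m N d c - twist m N c d) / (2 * pi)"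
    by (intro divide_right_mono) auto
  moreover have "((real q - 1) / real q / real q ^ m * ?Z - 2 * (2 * pi * (defect N c d * sqrt (nsq N c)))) / (2 * pi) =
     (real q - 1) / real q / real q ^ m * (?Z / (2 * pi)) - 2 * (defect N c d * sqrt (nsq N c))"
    by (simp add: diff_divide_distrib)
  moreover have "(real q - 1) / real q / real q ^ m * (nsq N c / (2 * real b) - 12 / real b ^ m * (sqrt (nsq N c) * sqrt (dsq N c))) \<le>
     (real q - 1) / real q / real q ^ m * (?Z / (2 * pi))"
    using q_gt1 by (intro mult_left_mono wt_correlation) auto
  ultimately show ?thesis by linarith
qed

definition functional :: "nat \<Rightarrow> nat \<Rightarrow> real \<Rightarrow> (int \<Rightarrow> complex) \<Rightarrow> real" where
  "functional m N g c = nsq N c + g * (Im (twist m N c c) / (2 * pi))"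

text \<open>The twist is dominated by the energy, so the functional is equivalent to the energy as
  soon as \<open>\<bar>g\<bar> < 1\<close>.\<close>

lemma functional_bounds:
  "(1 - \<bar>g\<bar>) * nsq N c \<le> functional m N g c" "functional m N g c \<le> (1 + \<bar>g\<bar>) * nsq N c"
proof -
  have "\<bar>Im (twist m N c c)\<bar> \<le> 2 * pi * nsq N c"
    using abs_Im_le_cmod norm_twist_le by (rule order_trans)
  then have "\<bar>Im (twist m N c c) / (2 * pi)\<bar> \<le> nsq N c"
    by (simp add: abs_divide field_simps)
  then have "\<bar>g * (Im (twist m N c c) / (2 * pi))\<bar> \<le> \<bar>g\<bar> * nsq N c"
    unfolding abs_mult by (intro mult_left_mono) auto
  then show "(1 - \<bar>g\<bar>) * nsq N c \<le> functional m N g c" "functional m N g c \<le> (1 + \<bar>g\<bar>) * nsq N c"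
    unfolding functional_def by (simp_all only: left_diff_distrib distrib_right mult_1)
qed

text \<open>The right-hand side of the equation for the \<open>k\<close>-th mode, with
  \<open>d\<close> in the place of the coefficients of \<open>u * g\<close>. Multiplication by
  \<open>u\<close> does not respect truncation, so \<open>d\<close> is kept as separate
  data.\<close>

definition mode_rhs :: "real \<Rightarrow> int \<Rightarrow> (int \<Rightarrow> complex) \<Rightarrow> (int \<Rightarrow> complex) \<Rightarrow> int \<Rightarrow> complex" where
  "mode_rhs \<nu> k c d n = - \<i> * of_int k * d n - of_real (\<nu> * ((of_int k)\<^sup>2 + (of_int n)\<^sup>2)) * c n"

lemma mode_rhs_split:
  "mode_rhs \<nu> k c d = (\<lambda>n. (- \<i> * of_int k) * d n + (- of_real (\<nu> * (of_int k)\<^sup>2)) * c n + of_real \<nu> * diff_coeff (diff_coeff c) n)"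
  by (auto simp: mode_rhs_def diff_coeff_def fun_eq_iff power2_eq_square algebra_simps)

lemma energy_rate:
  "2 * Re (\<Sum>n\<in>{-int N..int N}. mode_rhs \<nu> k c d n * cnj (c n))
     \<le> - 2 * \<nu> * ((of_int k)\<^sup>2 * nsq N c + dsq N c) + 2 * (\<bar>of_int k\<bar> * (defect N c d * sqrt (nsq N c)))"
proof -
  define Z where "Z = (\<Sum>n\<in>{-int N..int N}. d n * cnj (c n))"
  have "mode_rhs \<nu> k c d n * cnj (c n) = - \<i> * of_int k * (d n * cnj (c n)) - of_real (\<nu> * ((of_int k)\<^sup>2 * (cmod (c n))\<^sup>2 + (of_int n)\<^sup>2 * (cmod (c n))\<^sup>2))" for n
  proof -
    have "mode_rhs \<nu> k c d n * cnj (c n) = - \<i> * of_int k * (d n * cnj (c n)) - of_real (\<nu> * ((of_int k)\<^sup>2 + (of_int n)\<^sup>2)) * (c n * cnj (c n))"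
      by (simp add: mode_rhs_def algebra_simps)
    also have "c n * cnj (c n) = of_real ((cmod (c n))\<^sup>2)" by (rule complex_norm_square[symmetric])
    finally show ?thesis by (simp add: algebra_simps)
  qed
  then have "(\<Sum>n\<in>{-int N..int N}. mode_rhs \<nu> k c d n * cnj (c n)) = - \<i> * of_int k * Z - of_real (\<nu> * ((of_int k)\<^sup>2 * nsq N c + dsq N c))"
    unfolding Z_def nsq_def dsq_def by (simp add: sum_subtractf sum_distrib_left sum.distrib distrib_left)
  then have "Re (\<Sum>n\<in>{-int N..int N}. mode_rhs \<nu> k c d n * cnj (c n)) = of_int k * Im Z - \<nu> * ((of_int k)\<^sup>2 * nsq N c + dsq N c)"
    by simp
  moreover have "of_int k * Im Z \<le> \<bar>of_int k\<bar> * (defect N c d * sqrt (nsq N c))"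
  proof -
    have "of_int k * Im Z \<le> \<bar>of_int k\<bar> * \<bar>Im Z\<bar>" by (metis abs_ge_self abs_mult)
    also have "\<dots> \<le> \<bar>of_int k\<bar> * (defect N c d * sqrt (nsq N c))"
      unfolding Z_def by (intro mult_left_mono energy_transport) auto
    finally show ?thesis .
  qed
  ultimately show ?thesis by (simp add: algebra_simps)
qed

text \<open>The factor \<open>- \<i> * k\<close> turns the real part controlled by
  \<open>twist_transport\<close> into \<open>- k\<close> times it in the imaginary part, and
  \<open>sgn k\<close> makes this damping for both signs of \<open>k\<close>. The diffusion in x is
  bounded by \<open>norm_twist_le\<close>, the diffusion in y by
  \<open>twisted_diffusion_bound\<close>.\<close>

lemma twist_rate:
  assumes \<nu>: "0 \<le> \<nu>"
  shows "sgn (of_int k) * (Im (twist m N (mode_rhs \<nu> k c d) c + twist m N c (mode_rhs \<nu> k c d)) / (2 * pi))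
    \<le> - \<bar>of_int k\<bar> * ((real q - 1) / real q / real q ^ m) * (nsq N c / (2 * real b) - 12 / real b ^ m * (sqrt (nsq N c) * sqrt (dsq N c)))
      + 2 * (\<bar>of_int k\<bar> * (defect N c d * sqrt (nsq N c))) + 2 * \<nu> * (of_int k)\<^sup>2 * nsq N c
      + \<nu> * (2 * dsq N c + 2 * real b ^ Suc m * (sqrt (nsq N c) * sqrt (dsq N c)))"
proof -
  define dd where "dd = diff_coeff (diff_coeff c)"
  define X where "X = twist m N d c - twist m N c d"
  define Y where "Y = twist m N dd c + twist m N c dd"
  define \<sigma> where "\<sigma> = sgn (real_of_int k)"
  have \<sigma>k: "\<sigma> * of_int k = \<bar>of_int k\<bar>" and \<sigma>1: "\<bar>\<sigma>\<bar> \<le> 1"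
    unfolding \<sigma>_def by (auto simp: sgn_if)
  have "twist m N (mode_rhs \<nu> k c d) c + twist m N c (mode_rhs \<nu> k c d) =
      - \<i> * of_int k * X - of_real (2 * \<nu> * (of_int k)\<^sup>2) * twist m N c c + of_real \<nu> * Y"
    unfolding mode_rhs_split twist_lincomb X_def Y_def dd_def by (simp add: algebra_simps)
  then have Im_eq: "Im (twist m N (mode_rhs \<nu> k c d) c + twist m N c (mode_rhs \<nu> k c d)) =
      - of_int k * Re X - 2 * \<nu> * (of_int k)\<^sup>2 * Im (twist m N c c) + \<nu> * Im Y"
    by simp
  have eq: "\<sigma> * (Im (twist m N (mode_rhs \<nu> k c d) c + twist m N c (mode_rhs \<nu> k c d)) / (2 * pi)) =
      - \<bar>of_int k\<bar> * (Re X / (2 * pi)) - 2 * \<nu> * (of_int k)\<^sup>2 * (\<sigma> * (Im (twist m N c c) / (2 * pi))) + \<nu> * (\<sigma> * (Im Y / (2 * pi)))"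
    unfolding \<sigma>k[symmetric] Im_eq by (simp add: add_divide_distrib diff_divide_distrib algebra_simps)
  have s: "\<bar>\<sigma> * a\<bar> \<le> A" if "\<bar>a\<bar> \<le> A" for a A
    using mult_mono[OF \<sigma>1 that] by (simp add: abs_mult)
  have "- \<bar>of_int k\<bar> * (Re X / (2 * pi)) \<le> - \<bar>of_int k\<bar> * ((real q - 1) / real q / real q ^ m * (nsq N c / (2 * real b) - 12 / real b ^ m * (sqrt (nsq N c) * sqrt (dsq N c)))
     - 2 * (defect N c d * sqrt (nsq N c)))"
    using twist_transport[of m N c d] unfolding X_def by (intro mult_left_mono_neg) auto
  moreover have "- (2 * \<nu> * (of_int k)\<^sup>2 * (\<sigma> * (Im (twist m N c c) / (2 * pi)))) \<le> 2 * \<nu> * (of_int k)\<^sup>2 * nsq N c"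
  proof -
    have "\<bar>Im (twist m N c c)\<bar> \<le> 2 * pi * nsq N c"
      using abs_Im_le_cmod norm_twist_le by (rule order_trans)
    then have "\<bar>Im (twist m N c c) / (2 * pi)\<bar> \<le> nsq N c" by (simp add: abs_divide field_simps)
    then have "\<bar>\<sigma> * (Im (twist m N c c) / (2 * pi))\<bar> \<le> nsq N c" by (rule s)
    then have "- (\<sigma> * (Im (twist m N c c) / (2 * pi))) \<le> nsq N c" by linarith
    then have "2 * \<nu> * (of_int k)\<^sup>2 * (- (\<sigma> * (Im (twist m N c c) / (2 * pi)))) \<le> 2 * \<nu> * (of_int k)\<^sup>2 * nsq N c"
      using \<nu> by (intro mult_left_mono) auto
    then show ?thesis by simp
  qed
  moreover have "\<nu> * (\<sigma> * (Im Y / (2 * pi))) \<le> \<nu> * (2 * dsq N c + 2 * real b ^ Suc m * (sqrt (nsq N c) * sqrt (dsq N c)))"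
  proof -
    have "Y = (LINT y|torus. of_real (wt m y) * (tp N dd (y + step m) * cnj (tp N c y)) + of_real (wt m y) * (tp N c (y + step m) * cnj (tp N dd y)))"
      unfolding Y_def twist_def
      by (intro Bochner_Integration.integral_add[symmetric] continuous_integrable_torus continuous_intros continuous_tp_step continuous_wt)
    also have "\<dots> = (LINT y|torus. of_real (wt m y) * (tp N dd (y + step m) * cnj (tp N c y) + tp N c (y + step m) * cnj (tp N dd y)))"
      by (simp only: distrib_left)
    finally have "cmod Y \<le> 2 * pi * (2 * dsq N c + 2 * real b ^ Suc m * (sqrt (nsq N c) * sqrt (dsq N c)))"
      unfolding dd_def
      by (simp only:) (rule twisted_diffusion_bound[OF DERIV_wt continuous_wt' wt_periodic wt_le wt'_le])
    then have "\<bar>Im Y\<bar> \<le> 2 * pi * (2 * dsq N c + 2 * real b ^ Suc m * (sqrt (nsq N c) * sqrt (dsq N c)))"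
      using abs_Im_le_cmod[of Y] by linarith
    then have "\<bar>Im Y / (2 * pi)\<bar> \<le> 2 * dsq N c + 2 * real b ^ Suc m * (sqrt (nsq N c) * sqrt (dsq N c))"
      by (simp add: abs_divide pos_divide_le_eq mult.commute)
    then have "\<bar>\<sigma> * (Im Y / (2 * pi))\<bar> \<le> 2 * dsq N c + 2 * real b ^ Suc m * (sqrt (nsq N c) * sqrt (dsq N c))" by (rule s)
    then show ?thesis using \<nu> by (intro mult_left_mono) (rule abs_le_D1)
  qed
  ultimately show ?thesis unfolding \<sigma>_def[symmetric] eq by (simp add: algebra_simps)
qed

lemma functional_derivative:
  assumes c: "\<And>n. (c n has_vector_derivative mode_rhs \<nu> k (\<lambda>n. c n t) d n) (at t within A)"
    and k: "k \<noteq> 0" and \<nu>: "0 < \<nu>" and \<gamma>: "0 \<le> \<gamma>" "\<gamma> \<le> 1 / 2"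
    and small: "\<gamma> * (12 * \<bar>of_int k\<bar> * ((real q - 1) / real q / real q ^ m) / real b ^ m + 2 * \<nu> * real b ^ Suc m)\<^sup>2
       \<le> \<nu> * \<bar>of_int k\<bar> * ((real q - 1) / real q / real q ^ m) / real b"
    and \<mu>: "0 \<le> \<mu>" "2 * \<mu> \<le> \<gamma> * \<bar>of_int k\<bar> * ((real q - 1) / real q / real q ^ m) / (4 * real b)"
  obtains D where "((\<lambda>t. functional m N (\<gamma> * sgn (of_int k)) (\<lambda>n. c n t)) has_real_derivative D) (at t within A)"
    "D \<le> - \<mu> * functional m N (\<gamma> * sgn (of_int k)) (\<lambda>n. c n t) + 4 * \<bar>of_int k\<bar> * (defect N (\<lambda>n. c n t) d * sqrt (nsq N (\<lambda>n. c n t)))"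
proof -
  let ?c = "\<lambda>n. c n t" and ?e = "mode_rhs \<nu> k (\<lambda>n. c n t) d"
  define N1 where "N1 = 2 * Re (\<Sum>n\<in>{-int N..int N}. ?e n * cnj (?c n))"
  define N2 where "N2 = Im (twist m N ?e ?c + twist m N ?c ?e)"
  have "((\<lambda>t. \<Sum>n\<in>{-int N..int N}. c n t * cnj (c n t)) has_vector_derivative
     (\<Sum>n\<in>{-int N..int N}. ?c n * cnj (?e n) + ?e n * cnj (?c n))) (at t within A)"
    by (intro has_vector_derivative_sum has_vector_derivative_mult has_vector_derivative_cnj c)
  from bounded_linear.has_vector_derivative[OF bounded_linear_Re this]
  have "((\<lambda>t. nsq N (\<lambda>n. c n t)) has_vector_derivative Re (\<Sum>n\<in>{-int N..int N}. ?c n * cnj (?e n) + ?e n * cnj (?c n))) (at t within A)"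
    by (simp add: nsq_def complex_norm_square[symmetric] del: of_real_power)
  also have "Re (\<Sum>n\<in>{-int N..int N}. ?c n * cnj (?e n) + ?e n * cnj (?c n)) = N1"
    unfolding N1_def by (simp add: sum.distrib mult.commute)
  finally have d1: "((\<lambda>t. nsq N (\<lambda>n. c n t)) has_real_derivative N1) (at t within A)"
    by (simp add: has_real_derivative_iff_has_vector_derivative)
  from bounded_linear.has_vector_derivative[OF bounded_linear_Im twist_has_vector_derivative[OF c, of m N]]
  have d2: "((\<lambda>t. Im (twist m N (\<lambda>n. c n t) (\<lambda>n. c n t))) has_real_derivative N2) (at t within A)"
    by (simp add: N2_def has_real_derivative_iff_has_vector_derivative)
  have deriv: "((\<lambda>t. functional m N (\<gamma> * sgn (of_int k)) (\<lambda>n. c n t)) has_real_derivative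
      N1 + \<gamma> * sgn (of_int k) * (N2 / (2 * pi))) (at t within A)"
    unfolding functional_def by (intro DERIV_add DERIV_cmult DERIV_cdivide d1 d2)
  have x: "(sqrt (nsq N ?c))\<^sup>2 = nsq N ?c" "(sqrt (dsq N ?c))\<^sup>2 = dsq N ?c"
    using nsq_nonneg dsq_nonneg by auto
  have Fl: "functional m N (\<gamma> * sgn (of_int k)) ?c \<le> 2 * nsq N ?c"
  proof -
    have "(1 + \<bar>\<gamma> * sgn (of_int k)\<bar>) * nsq N ?c \<le> 2 * nsq N ?c"
      using k \<gamma> by (intro mult_right_mono) (auto simp: abs_mult abs_sgn_eq nsq_nonneg)
    with functional_bounds(2) show ?thesis by (rule order_trans)
  qed
  have "N1 + \<gamma> * (sgn (of_int k) * (N2 / (2 * pi))) \<le> - \<mu> * functional m N (\<gamma> * sgn (of_int k)) ?c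
      + 2 * (2 * (\<bar>of_int k\<bar> * (defect N ?c d * sqrt (nsq N ?c))))"
  proof (rule hypocoercive_arith[where x = "sqrt (nsq N ?c)" and z = "sqrt (dsq N ?c)" and \<kappa> = "\<bar>of_int k\<bar>" and \<nu> = \<nu>
        and Q = "(real q - 1) / real q / real q ^ m" and B = "real b" and \<delta> = "1 / real b ^ m" and D = "real b ^ Suc m"])
    show "N1 \<le> - 2 * \<nu> * (\<bar>real_of_int k\<bar>\<^sup>2 * (sqrt (nsq N ?c))\<^sup>2 + (sqrt (dsq N ?c))\<^sup>2) + 2 * (\<bar>of_int k\<bar> * (defect N ?c d * sqrt (nsq N ?c)))"
      using energy_rate[of \<nu> k ?c d N] unfolding N1_def x by simp
    show "sgn (of_int k) * (N2 / (2 * pi)) \<le> - \<bar>of_int k\<bar> * ((real q - 1) / real q / real q ^ m) *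
        ((sqrt (nsq N ?c))\<^sup>2 / (2 * real b) - 12 * (1 / real b ^ m) * (sqrt (nsq N ?c) * sqrt (dsq N ?c)))
        + 2 * (\<bar>of_int k\<bar> * (defect N ?c d * sqrt (nsq N ?c))) + 2 * \<nu> * \<bar>real_of_int k\<bar>\<^sup>2 * (sqrt (nsq N ?c))\<^sup>2 +
        \<nu> * (2 * (sqrt (dsq N ?c))\<^sup>2 + 2 * real b ^ Suc m * (sqrt (nsq N ?c) * sqrt (dsq N ?c)))"
      using twist_rate[of \<nu> k m N ?c d] \<nu> unfolding N2_def x by simp
    show "\<gamma> * (12 * \<bar>of_int k\<bar> * ((real q - 1) / real q / real q ^ m) * (1 / real b ^ m) + 2 * \<nu> * real b ^ Suc m)\<^sup>2
      \<le> \<nu> * \<bar>of_int k\<bar> * ((real q - 1) / real q / real q ^ m) / real b"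
      using small by simp
    show "functional m N (\<gamma> * sgn (of_int k)) ?c \<le> 2 * (sqrt (nsq N ?c))\<^sup>2" unfolding x by (rule Fl)
    show "0 \<le> 2 * (\<bar>of_int k\<bar> * (defect N ?c d * sqrt (nsq N ?c)))"
      by (simp add: defect_nonneg nsq_nonneg)
  qed (use \<gamma> \<nu> \<mu> in auto)
  then show ?thesis by (intro that[OF deriv]) (simp add: mult.assoc)
qed

text \<open>Chosen for \<open>exists_level\<close>: it has to beat
  \<open>296 * q * b\<^sup>2\<close> and one more \<open>b\<close> from the share
  \<open>1 / (2 * b)\<close> of the weight. There is room, since
  \<open>296 / 600 \<le> 2 / 3\<close>.\<close>

definition gamma0 :: real where
  "gamma0 = 1 / (600 * real q * real b ^ 3)"

text \<open>Twice this number is \<open>2 / 3\<close> of \<open>gamma0 / (4 * b)\<close>, with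
  \<open>2 / 3\<close> as the lower bound of \<open>(q - 1) / q\<close>.\<close>

definition rate :: real where
  "rate = gamma0 / (12 * real b)"

lemma gamma0_pos: "0 < gamma0" and gamma0_le: "gamma0 \<le> 1 / 3" and rate_pos: "0 < rate"
proof -
  have "1 \<le> real b ^ 3" using b_gt1 by (intro one_le_power) simp
  then have "3 \<le> 600 * real q * real b ^ 3" using q_gt1 by (smt (verit) mult_less_cancel_left1 mult_le_cancel_left1)
  then show "gamma0 \<le> 1 / 3" unfolding gamma0_def by (intro divide_left_mono) auto
  show "0 < gamma0" using q_gt1 b_gt1 by (simp add: gamma0_def)
  then show "0 < rate" using b_gt1 by (simp add: rate_def)
qed

text \<open>The level \<open>m\<close> is chosen such that cells of width \<open>b\<close>-to-the-\<open>-m\<close> balance transport and diffusion.\<close>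

lemma exists_level:
  assumes \<nu>: "0 < \<nu>" "\<nu> \<le> 1" and k: "k \<noteq> (0::int)"
  obtains m where
    "gamma0 / \<bar>of_int k\<bar> * (12 * \<bar>of_int k\<bar> * ((real q - 1) / real q / real q ^ m) / real b ^ m + 2 * \<nu> * real b ^ Suc m)\<^sup>2
       \<le> \<nu> * \<bar>of_int k\<bar> * ((real q - 1) / real q / real q ^ m) / real b"
    "2 * (rate * \<nu> powr (alpha / (alpha + 2))) \<le> gamma0 / \<bar>of_int k\<bar> * \<bar>of_int k\<bar> * ((real q - 1) / real q / real q ^ m) / (4 * real b)"
proof -
  \<comment> \<open>The solution of \<open>\<nu> = h powr alpha * h\<^sup>2\<close>.\<close>
  define h where "h = \<nu> powr (1 / (alpha + 2))"
  have h: "0 < h" "h \<le> 1" using \<nu> alpha_pos by (auto simp: h_def intro: powr_le1)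
  obtain m where m: "1 / real b ^ Suc m < h" "h \<le> 1 / real b ^ m"
    using exists_scale[OF h] by blast
  define \<delta> where "\<delta> = 1 / real b ^ m"
  define Q where "Q = 1 / real q ^ m"
  define \<kappa> where "\<kappa> = \<bar>real_of_int k\<bar>"
  have \<kappa>: "1 \<le> \<kappa>" unfolding \<kappa>_def using k by linarith
  have \<delta>: "h \<le> \<delta>" "\<delta> < real b * h" "0 < \<delta>"
    using m b_gt1 by (auto simp: \<delta>_def field_simps)
  have Qd: "Q = \<delta> powr alpha" unfolding Q_def \<delta>_def by (rule b_power_powr_alpha[symmetric])
  have Q1: "h powr alpha \<le> Q" unfolding Qd using \<delta> h alpha_pos by (intro powr_mono2) auto
  have Q2: "Q \<le> real q * h powr alpha"
  proof -
    have "Q \<le> (real b * h) powr alpha" unfolding Qd using \<delta> h alpha_pos by (intro powr_mono2) auto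
    then show ?thesis using h b_gt1 by (simp add: powr_mult b_powr_alpha)
  qed
  have Q0: "0 < Q" using q_gt1 by (simp add: Q_def)
  have ha: "h powr alpha = \<nu> powr (alpha / (alpha + 2))" by (simp add: h_def powr_powr)
  have \<nu>h: "\<nu> = h powr alpha * h\<^sup>2"
  proof -
    have "h powr alpha * h\<^sup>2 = h powr (alpha + 2)" using h by (simp add: powr_add)
    also have "\<dots> = \<nu>" using \<nu> alpha_pos by (simp add: h_def powr_powr)
    finally show ?thesis by simp
  qed
  have A: "Q * \<delta>\<^sup>2 \<le> real q * (real b)\<^sup>2 * \<nu>"
  proof -
    have "Q * \<delta>\<^sup>2 \<le> (real q * h powr alpha) * (real b * h)\<^sup>2"
      using Q2 \<delta> h Q0 by (intro mult_mono power_mono) auto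
    then show ?thesis unfolding \<nu>h by (simp add: power_mult_distrib mult_ac)
  qed
  have B: "\<nu> \<le> Q * \<delta>\<^sup>2"
    unfolding \<nu>h using Q1 Q0 \<delta> h by (intro mult_mono power_mono) auto
  have D: "real b ^ Suc m = real b / \<delta>" by (simp add: \<delta>_def)
  define Q' where "Q' = (real q - 1) / real q * Q"
  have Q'eq: "(real q - 1) / real q / real q ^ m = Q'" by (simp add: Q'_def Q_def)
  have q23: "2 / 3 \<le> (real q - 1) / real q" using q3 by (simp add: field_simps)
  have Q'1: "2 / 3 * Q \<le> Q'" unfolding Q'_def using q23 Q0 by (intro mult_right_mono) auto
  have Q'2: "Q' \<le> Q" unfolding Q'_def using mult_right_mono[of "(real q - 1) / real q" 1 Q] q_gt1 Q0 by simp
  have Q'0: "0 \<le> Q'" using Q'1 Q0 by simp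
  have "(12 * \<kappa> * Q' * \<delta> + 2 * \<nu> * (real b / \<delta>))\<^sup>2 \<le> 2 * ((12 * \<kappa> * Q' * \<delta>)\<^sup>2 + (2 * \<nu> * (real b / \<delta>))\<^sup>2)"
  proof -
    have "(x + y)\<^sup>2 \<le> 2 * (x\<^sup>2 + y\<^sup>2)" for x y :: real
      using sum_squares_bound[of x y] by (simp add: power2_sum)
    then show ?thesis .
  qed
  also have "\<dots> = 288 * \<kappa>\<^sup>2 * Q' * (Q' * \<delta>\<^sup>2) + 8 * \<nu> * (real b)\<^sup>2 * (\<nu> / \<delta>\<^sup>2)"
    by (simp add: power_mult_distrib power_divide power2_eq_square algebra_simps)
  also have "\<dots> \<le> 288 * \<kappa>\<^sup>2 * Q * (real q * (real b)\<^sup>2 * \<nu>) + 8 * \<nu> * (real b)\<^sup>2 * (\<kappa>\<^sup>2 * (real q * Q))"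
  proof (rule add_mono)
    have "Q' * \<delta>\<^sup>2 \<le> real q * (real b)\<^sup>2 * \<nu>"
      using A mult_right_mono[OF Q'2, of "\<delta>\<^sup>2"] by simp
    then show "288 * \<kappa>\<^sup>2 * Q' * (Q' * \<delta>\<^sup>2) \<le> 288 * \<kappa>\<^sup>2 * Q * (real q * (real b)\<^sup>2 * \<nu>)"
      using Q'2 Q'0 Q0 by (intro mult_mono[of "288 * \<kappa>\<^sup>2 * Q'"] mult_left_mono) auto
    have "\<nu> / \<delta>\<^sup>2 \<le> Q" using B \<delta> by (simp add: field_simps)
    also have "Q \<le> \<kappa>\<^sup>2 * (real q * Q)"
    proof -
      have "1 * 1 \<le> \<kappa>\<^sup>2 * real q" using \<kappa> q_gt1 by (intro mult_mono one_le_power) auto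
      from mult_right_mono[OF this, of Q] show ?thesis using Q0 by (simp add: mult_ac)
    qed
    finally show "8 * \<nu> * (real b)\<^sup>2 * (\<nu> / \<delta>\<^sup>2) \<le> 8 * \<nu> * (real b)\<^sup>2 * (\<kappa>\<^sup>2 * (real q * Q))"
      using \<nu> by (intro mult_left_mono) auto
  qed
  also have "\<dots> = 296 * (\<kappa>\<^sup>2 * Q * real q * (real b)\<^sup>2 * \<nu>)" by simp
  finally have sq: "(12 * \<kappa> * Q' * \<delta> + 2 * \<nu> * (real b / \<delta>))\<^sup>2 \<le> 296 * (\<kappa>\<^sup>2 * Q * real q * (real b)\<^sup>2 * \<nu>)" .
  \<comment> \<open>Dividing by \<open>\<kappa>\<close> is forced, since the square grows like
    \<open>\<kappa>\<^sup>2\<close> and the right-hand side only like \<open>\<kappa>\<close>. It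
    also makes \<open>\<gamma> * \<kappa>\<close>, and with it the decay rate, independent of
    \<open>k\<close>.\<close>
  have "gamma0 / \<kappa> * (12 * \<kappa> * Q' * \<delta> + 2 * \<nu> * (real b / \<delta>))\<^sup>2 \<le> gamma0 / \<kappa> * (296 * (\<kappa>\<^sup>2 * Q * real q * (real b)\<^sup>2 * \<nu>))"
    using sq gamma0_pos \<kappa> by (intro mult_left_mono) auto
  also have "\<dots> = \<nu> * \<kappa> * (296 / 600 * Q) / real b"
    using \<kappa> q_gt1 b_gt1 by (simp add: gamma0_def power2_eq_square power3_eq_cube)
  also have "\<dots> \<le> \<nu> * \<kappa> * Q' / real b"
    using Q'1 Q0 \<nu> \<kappa> b_gt1 by (intro divide_right_mono mult_left_mono) auto
  finally have r1: "gamma0 / \<kappa> * (12 * \<kappa> * Q' * \<delta> + 2 * \<nu> * (real b / \<delta>))\<^sup>2 \<le> \<nu> * \<kappa> * Q' / real b" .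
  have r2: "2 * (rate * \<nu> powr (alpha / (alpha + 2))) \<le> gamma0 / \<kappa> * \<kappa> * Q' / (4 * real b)"
  proof -
    have "2 * (rate * \<nu> powr (alpha / (alpha + 2))) = gamma0 / (4 * real b) * (2 / 3 * h powr alpha)"
      unfolding ha[symmetric] rate_def by simp
    also have "\<dots> \<le> gamma0 / (4 * real b) * Q'"
      using Q1 Q'1 gamma0_pos b_gt1 by (intro mult_left_mono) auto
    finally show ?thesis using \<kappa> by simp
  qed
  have e: "12 * \<kappa> * Q' / real b ^ m = 12 * \<kappa> * Q' * \<delta>" by (simp add: \<delta>_def)
  show ?thesis
    by (rule that[of m]) (use r1 r2 in \<open>simp_all only: Q'eq \<kappa>_def[symmetric] D e\<close>)
qed

end

section \<open>From truncations to a full mode\<close>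

lemma sqrt_nsq_fc_le:
  assumes "g \<in> L2 torus"
  shows "sqrt (nsq N (fc g)) \<le> L2nrm torus g"
proof -
  have "nsq N (fc g) \<le> 2 * pi * nsq N (fc g)"
    using nsq_nonneg[of N "fc g"] pi_gt3 mult_right_mono[of 1 "2 * pi" "nsq N (fc g)"] by simp
  also have "\<dots> \<le> (L2nrm torus g)\<^sup>2" unfolding nsq_def by (rule Bessel[OF assms])
  finally show ?thesis by (metis L2nrm_nonneg real_le_lsqrt)
qed

lemma nsq_fc_tendsto:
  assumes "g \<in> L2 torus"
  shows "(\<lambda>N. nsq N (fc g)) \<longlonglongrightarrow> (L2nrm torus g)\<^sup>2 / (2 * pi)"
proof -
  have "(\<lambda>N. 2 * pi * nsq N (fc g) / (2 * pi)) \<longlonglongrightarrow> (L2nrm torus g)\<^sup>2 / (2 * pi)"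
    unfolding nsq_def by (intro tendsto_divide Parseval[OF assms] tendsto_const) simp
  then show ?thesis by simp
qed

lemma continuous_on_sqrt_nsq:
  assumes "\<And>n. continuous_on A (c n)"
  shows "continuous_on A (\<lambda>t. sqrt (nsq N (\<lambda>n. c n t - a n)))"
  unfolding nsq_def by (intro continuous_intros assms)

context zigzag begin

lemma L2nrm_u_mult_le:
  assumes "g \<in> L2 torus"
  shows "(\<lambda>y. of_real (u y) * g y) \<in> L2 torus" "L2nrm torus (\<lambda>y. of_real (u y) * g y) \<le> L2nrm torus g"
proof -
  have m: "(\<lambda>y. complex_of_real (u y)) \<in> borel_measurable torus"
    by (intro continuous_measurable_torus continuous_intros continuous_u)
  have b: "cmod (of_real (u y)) \<le> 1" for y using u_range[of y] by simp
  show L: "(\<lambda>y. of_real (u y) * g y) \<in> L2 torus" by (rule L2_bounded_mult[OF assms m b])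
  show "L2nrm torus (\<lambda>y. of_real (u y) * g y) \<le> L2nrm torus g"
    using b by (intro L2nrm_mono L assms) (simp only: norm_mult mult_left_le_one_le norm_ge_zero)
qed

text \<open>The defect is a seminorm of the pair \<open>(c, d)\<close>, and multiplication by
  \<open>u\<close> does not increase L2 norms because \<open>0 \<le> u \<le> 1\<close>. Continuity
  in time and the uniform bound \<open>defect_le\<close> both come from this.\<close>

lemma defect_perturb:
  "defect N c d \<le> defect N c' d' + sqrt (nsq N (\<lambda>n. d n - d' n)) + sqrt (nsq N (\<lambda>n. c n - c' n))"
proof -
  let ?e = "\<lambda>y. tp N d' y - of_real (u y) * tp N c' y"
  let ?x = "\<lambda>y. tp N (\<lambda>n. d n - d' n) y" and ?z = "\<lambda>y. of_real (u y) * tp N (\<lambda>n. c n - c' n) y"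
  have L: "?e \<in> L2 torus" "?x \<in> L2 torus" "?z \<in> L2 torus"
    by (intro L2_diff tp_L2 L2nrm_u_mult_le(1))+
  have "L2nrm torus (\<lambda>y. tp N d y - of_real (u y) * tp N c y) = L2nrm torus (\<lambda>y. (?e y + ?x y) - ?z y)"
    by (simp add: tp_diff[symmetric] algebra_simps)
  also have "\<dots> \<le> L2nrm torus (\<lambda>y. ?e y + ?x y) + L2nrm torus ?z"
    by (intro L2nrm_triangle_diff L2_add L)
  also have "\<dots> \<le> (L2nrm torus ?e + L2nrm torus ?x) + L2nrm torus (tp N (\<lambda>n. c n - c' n))"
    by (intro add_mono L2nrm_triangle L L2nrm_u_mult_le(2) tp_L2)
  finally have "defect N c d \<le> ((L2nrm torus ?e + L2nrm torus ?x) + L2nrm torus (tp N (\<lambda>n. c n - c' n))) / sqrt (2 * pi)"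
    unfolding defect_def by (intro divide_right_mono) auto
  then show ?thesis by (simp add: defect_def L2nrm_tp_nsq add_divide_distrib)
qed

lemma defect_le: "defect N c d \<le> sqrt (nsq N d) + sqrt (nsq N c)"
proof -
  have "defect N (\<lambda>_. 0) (\<lambda>_. 0) = 0" by (simp add: defect_def tp_def L2nrm_def)
  then show ?thesis using defect_perturb[of N c d "\<lambda>_. 0" "\<lambda>_. 0"] by simp
qed

lemma continuous_defect:
  assumes "\<And>n. continuous_on A (c n)" "\<And>n. continuous_on A (d n)"
  shows "continuous_on A (\<lambda>t. defect N (\<lambda>n. c n t) (\<lambda>n. d n t))"
  unfolding continuous_on_def
proof
  fix s assume s: "s \<in> A"
  let ?h = "\<lambda>t. sqrt (nsq N (\<lambda>n. d n t - d n s)) + sqrt (nsq N (\<lambda>n. c n t - c n s))"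
  have sym: "nsq N (\<lambda>n. x n - y n) = nsq N (\<lambda>n. y n - x n)" for x y
    by (simp add: nsq_def norm_minus_commute)
  have le: "\<bar>defect N (\<lambda>n. c n t) (\<lambda>n. d n t) - defect N (\<lambda>n. c n s) (\<lambda>n. d n s)\<bar> \<le> ?h t" for t
    using defect_perturb[of N "\<lambda>n. c n t" "\<lambda>n. d n t" "\<lambda>n. c n s" "\<lambda>n. d n s"]
      defect_perturb[of N "\<lambda>n. c n s" "\<lambda>n. d n s" "\<lambda>n. c n t" "\<lambda>n. d n t"]
    unfolding sym[of "\<lambda>n. d n s"] sym[of "\<lambda>n. c n s"] by linarith
  have "continuous_on A ?h" by (intro continuous_on_add continuous_on_sqrt_nsq assms)
  then have "(?h \<longlongrightarrow> ?h s) (at s within A)" using s unfolding continuous_on_def by blast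
  then have h0: "(?h \<longlongrightarrow> 0) (at s within A)" by (simp add: nsq_def)
  have "((\<lambda>t. defect N (\<lambda>n. c n t) (\<lambda>n. d n t) - defect N (\<lambda>n. c n s) (\<lambda>n. d n s)) \<longlongrightarrow> 0) (at s within A)"
    by (rule Lim_null_comparison[OF _ h0]) (use le in \<open>auto intro!: always_eventually\<close>)
  then show "((\<lambda>t. defect N (\<lambda>n. c n t) (\<lambda>n. d n t)) \<longlongrightarrow> defect N (\<lambda>n. c n s) (\<lambda>n. d n s)) (at s within A)"
    by (rule LIM_zero_cancel)
qed

lemma defect_fc_tendsto:
  assumes g: "g \<in> L2 torus"
  shows "(\<lambda>N. defect N (fc g) (fc (\<lambda>y. of_real (u y) * g y))) \<longlonglongrightarrow> 0"
proof -
  let ?v = "\<lambda>y. of_real (u y) * g y"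
  note v = L2nrm_u_mult_le[OF g]
  let ?R = "\<lambda>N. (L2nrm torus (\<lambda>y. ?v y - tp N (fc ?v) y) + L2nrm torus (\<lambda>y. g y - tp N (fc g) y)) / sqrt (2 * pi)"
  have le: "defect N (fc g) (fc ?v) \<le> ?R N" for N
    unfolding defect_def
  proof (rule divide_right_mono)
    have L: "(\<lambda>y. ?v y - tp N (fc ?v) y) \<in> L2 torus" "(\<lambda>y. g y - tp N (fc g) y) \<in> L2 torus"
      by (intro L2_diff tp_L2 g v(1))+
    have "L2nrm torus (\<lambda>y. tp N (fc ?v) y - of_real (u y) * tp N (fc g) y) =
        L2nrm torus (\<lambda>y. of_real (u y) * (g y - tp N (fc g) y) - (?v y - tp N (fc ?v) y))"
      by (simp add: algebra_simps)
    also have "\<dots> \<le> L2nrm torus (\<lambda>y. of_real (u y) * (g y - tp N (fc g) y)) + L2nrm torus (\<lambda>y. ?v y - tp N (fc ?v) y)"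
      by (intro L2nrm_triangle_diff L2nrm_u_mult_le(1) L)
    also have "\<dots> \<le> L2nrm torus (\<lambda>y. ?v y - tp N (fc ?v) y) + L2nrm torus (\<lambda>y. g y - tp N (fc g) y)"
      using L2nrm_u_mult_le(2)[OF L(2)] by simp
    finally show "L2nrm torus (\<lambda>y. tp N (fc ?v) y - of_real (u y) * tp N (fc g) y) \<le>
      L2nrm torus (\<lambda>y. ?v y - tp N (fc ?v) y) + L2nrm torus (\<lambda>y. g y - tp N (fc g) y)" .
  qed simp
  have lim: "?R \<longlonglongrightarrow> (0 + 0) / sqrt (2 * pi)"
    by (intro tendsto_intros L2_fourier_convergence g v(1)) simp
  show ?thesis
  proof (rule tendsto_sandwich)
    show "\<forall>\<^sub>F N in sequentially. 0 \<le> defect N (fc g) (fc ?v)" by (intro always_eventually allI defect_nonneg)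
    show "\<forall>\<^sub>F N in sequentially. defect N (fc g) (fc ?v) \<le> ?R N" by (intro always_eventually allI le)
    show "?R \<longlonglongrightarrow> 0" using lim by simp
  qed simp
qed

text \<open>Gronwall's argument for each truncation, with the time integral of the defect as error.
  That error vanishes as \<open>N\<close> grows by dominated convergence: the defect tends to 0 at
  every time and is at most \<open>2 * Bd\<close>.\<close>

lemma mode_decay:
  assumes \<nu>: "0 < \<nu>" "\<nu> \<le> 1" and k: "k \<noteq> 0" and tau: "0 \<le> \<tau>"
    and g: "\<And>t. t \<in> {0..\<tau>} \<Longrightarrow> g t \<in> L2 torus" "\<And>t. t \<in> {0..\<tau>} \<Longrightarrow> L2nrm torus (g t) \<le> Bd"
    and deriv: "\<And>n t. t \<in> {0..\<tau>} \<Longrightarrow> ((\<lambda>t. fc (g t) n) has_vector_derivative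
        mode_rhs \<nu> k (fc (g t)) (fc (\<lambda>y. of_real (u y) * g t y)) n) (at t within {0..\<tau>})"
    and cont: "\<And>n. continuous_on {0..\<tau>} (\<lambda>t. fc (\<lambda>y. of_real (u y) * g t y) n)"
  shows "(L2nrm torus (g \<tau>))\<^sup>2 \<le> 2 * exp (- (rate * \<nu> powr (alpha / (alpha + 2)) * \<tau>)) * (L2nrm torus (g 0))\<^sup>2"
proof -
  define \<mu> where "\<mu> = rate * \<nu> powr (alpha / (alpha + 2))"
  define \<gamma> where "\<gamma> = gamma0 / \<bar>of_int k\<bar>"
  have k1: "1 \<le> \<bar>real_of_int k\<bar>" using k by linarith
  have \<gamma>: "0 \<le> \<gamma>" "\<gamma> \<le> 1 / 3"
  proof -
    show "0 \<le> \<gamma>" using gamma0_pos by (simp add: \<gamma>_def)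
    have "\<gamma> \<le> gamma0 / 1" unfolding \<gamma>_def using gamma0_pos k1 by (intro divide_left_mono) auto
    then show "\<gamma> \<le> 1 / 3" using gamma0_le by simp
  qed
  have \<mu>0: "0 \<le> \<mu>" using rate_pos by (simp add: \<mu>_def)
  have Bd0: "0 \<le> Bd" using g(2)[of 0] tau L2nrm_nonneg[of torus "g 0"] by (simp del: L2nrm_nonneg)
  obtain m where m: "\<gamma> * (12 * \<bar>of_int k\<bar> * ((real q - 1) / real q / real q ^ m) / real b ^ m + 2 * \<nu> * real b ^ Suc m)\<^sup>2
       \<le> \<nu> * \<bar>of_int k\<bar> * ((real q - 1) / real q / real q ^ m) / real b"
    "2 * \<mu> \<le> \<gamma> * \<bar>of_int k\<bar> * ((real q - 1) / real q / real q ^ m) / (4 * real b)"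
    unfolding \<gamma>_def \<mu>_def by (rule exists_level[OF \<nu> k])
  define F where "F N t = functional m N (\<gamma> * sgn (of_int k)) (fc (g t))" for N t
  define \<rho> where "\<rho> N t = defect N (fc (g t)) (fc (\<lambda>y. of_real (u y) * g t y))" for N t
  define C where "C = exp (\<mu> * \<tau>) * (4 * \<bar>of_int k\<bar> * Bd)"
  have C0: "0 \<le> C" using Bd0 by (simp add: C_def)
  have c_cont: "continuous_on {0..\<tau>} (\<lambda>t. fc (g t) n)" for n
    using deriv by (intro continuous_on_vector_derivative) blast
  have \<rho>_cont: "continuous_on {0..\<tau>} (\<rho> N)" for N
    unfolding \<rho>_def using continuous_defect[of "{0..\<tau>}" "\<lambda>n t. fc (g t) n" "\<lambda>n t. fc (\<lambda>y. of_real (u y) * g t y) n" N] c_cont cont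
    by simp
  have step: "exp (\<mu> * \<tau>) * F N \<tau> \<le> F N 0 + C * integral {0..\<tau>} (\<rho> N)" for N
  proof -
    have "\<exists>D. (F N has_real_derivative D) (at t within {0..\<tau>}) \<and>
        D \<le> - \<mu> * F N t + 4 * \<bar>of_int k\<bar> * (\<rho> N t * sqrt (nsq N (fc (g t))))" if "t \<in> {0..\<tau>}" for t
    proof -
      have "\<gamma> \<le> 1 / 2" using \<gamma> by simp
      have FN: "F N = (\<lambda>t. functional m N (\<gamma> * sgn (of_int k)) (fc (g t)))"
        by (simp add: F_def fun_eq_iff)
      show ?thesis unfolding FN \<rho>_def
        by (rule functional_derivative[of "\<lambda>n t. fc (g t) n", OF deriv[OF that] k \<nu>(1) \<gamma>(1) \<open>\<gamma> \<le> 1 / 2\<close> m(1) \<mu>0 m(2), of N]) blast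
    qed
    then obtain D where D: "\<And>t. t \<in> {0..\<tau>} \<Longrightarrow> (F N has_real_derivative D t) (at t within {0..\<tau>})"
        "\<And>t. t \<in> {0..\<tau>} \<Longrightarrow> D t \<le> - \<mu> * F N t + 4 * \<bar>of_int k\<bar> * (\<rho> N t * sqrt (nsq N (fc (g t))))"
      by metis
    have "((\<lambda>t. exp (\<mu> * t) * D t + \<mu> * exp (\<mu> * t) * F N t) has_integral exp (\<mu> * \<tau>) * F N \<tau> - exp (\<mu> * 0) * F N 0) {0..\<tau>}"
    proof (rule fundamental_theorem_of_calculus[OF tau])
      fix t assume t: "t \<in> {0..\<tau>}"
      have "((\<lambda>t. exp (\<mu> * t)) has_real_derivative \<mu> * exp (\<mu> * t)) (at t within {0..\<tau>})"
        by (auto intro!: derivative_eq_intros)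
      from DERIV_mult[OF this D(1)[OF t]]
      show "((\<lambda>t. exp (\<mu> * t) * F N t) has_vector_derivative exp (\<mu> * t) * D t + \<mu> * exp (\<mu> * t) * F N t) (at t within {0..\<tau>})"
        by (simp add: has_real_derivative_iff_has_vector_derivative algebra_simps)
    qed
    moreover have "((\<lambda>t. C * \<rho> N t) has_integral C * integral {0..\<tau>} (\<rho> N)) {0..\<tau>}"
      by (intro has_integral_mult_right integrable_integral integrable_continuous_real \<rho>_cont)
    ultimately have "exp (\<mu> * \<tau>) * F N \<tau> - exp (\<mu> * 0) * F N 0 \<le> C * integral {0..\<tau>} (\<rho> N)"
    proof (rule has_integral_le)
      fix t assume t: "t \<in> {0..\<tau>}"
      have r0: "0 \<le> \<rho> N t" by (simp add: \<rho>_def defect_nonneg)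
      have "sqrt (nsq N (fc (g t))) \<le> Bd"
        using sqrt_nsq_fc_le[OF g(1)[OF t]] g(2)[OF t] by (rule order_trans)
      then have "4 * \<bar>of_int k\<bar> * (\<rho> N t * sqrt (nsq N (fc (g t)))) \<le> 4 * \<bar>of_int k\<bar> * (\<rho> N t * Bd)"
        using r0 by (intro mult_left_mono) auto
      then have "D t + \<mu> * F N t \<le> 4 * \<bar>of_int k\<bar> * (\<rho> N t * Bd)" using D(2)[OF t] by simp
      then have "exp (\<mu> * t) * (D t + \<mu> * F N t) \<le> exp (\<mu> * t) * (4 * \<bar>of_int k\<bar> * (\<rho> N t * Bd))"
        by (intro mult_left_mono) auto
      also have "\<dots> \<le> exp (\<mu> * \<tau>) * (4 * \<bar>of_int k\<bar> * (\<rho> N t * Bd))"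
        using t \<mu>0 r0 Bd0 by (intro mult_right_mono) (auto intro: mult_left_mono)
      finally show "exp (\<mu> * t) * D t + \<mu> * exp (\<mu> * t) * F N t \<le> C * \<rho> N t"
        by (simp add: C_def algebra_simps)
    qed
    then show ?thesis by simp
  qed
  have \<rho>_lim: "(\<lambda>N. integral {0..\<tau>} (\<rho> N)) \<longlonglongrightarrow> integral {0..\<tau>} (\<lambda>_. 0 :: real)"
  proof (rule dominated_convergence(2))
    show "\<rho> N integrable_on {0..\<tau>}" for N by (intro integrable_continuous_real \<rho>_cont)
    show "(\<lambda>_. 2 * Bd) integrable_on {0..\<tau>}" by (intro integrable_continuous_real continuous_intros)
    fix t assume t: "t \<in> {0..\<tau>}"
    show "(\<lambda>N. \<rho> N t) \<longlonglongrightarrow> 0" unfolding \<rho>_def by (rule defect_fc_tendsto[OF g(1)[OF t]])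
    show "norm (\<rho> N t) \<le> 2 * Bd" for N
    proof -
      note v = L2nrm_u_mult_le[OF g(1)[OF t]]
      have "\<rho> N t \<le> sqrt (nsq N (fc (\<lambda>y. of_real (u y) * g t y))) + sqrt (nsq N (fc (g t)))"
        unfolding \<rho>_def by (rule defect_le)
      also have "\<dots> \<le> Bd + Bd"
        using sqrt_nsq_fc_le[OF v(1), of N] v(2) sqrt_nsq_fc_le[OF g(1)[OF t], of N] g(2)[OF t] by linarith
      finally show ?thesis by (simp add: \<rho>_def defect_nonneg)
    qed
  qed
  have sg: "\<bar>\<gamma> * sgn (of_int k)\<bar> = \<gamma>" using k \<gamma> by (simp add: abs_mult abs_sgn_eq)
  have le: "exp (\<mu> * \<tau>) * ((1 - \<gamma>) * nsq N (fc (g \<tau>))) \<le> (1 + \<gamma>) * nsq N (fc (g 0)) + C * integral {0..\<tau>} (\<rho> N)" for N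
  proof -
    have "exp (\<mu> * \<tau>) * ((1 - \<gamma>) * nsq N (fc (g \<tau>))) \<le> exp (\<mu> * \<tau>) * F N \<tau>"
      using functional_bounds(1)[of "\<gamma> * sgn (of_int k)" N "fc (g \<tau>)" m] unfolding sg F_def by (intro mult_left_mono) auto
    also note step
    also have "F N 0 \<le> (1 + \<gamma>) * nsq N (fc (g 0))"
      using functional_bounds(2)[of m N "\<gamma> * sgn (of_int k)" "fc (g 0)"] unfolding sg F_def .
    finally show ?thesis by simp
  qed
  define A where "A = (L2nrm torus (g \<tau>))\<^sup>2 / (2 * pi)"
  define A0 where "A0 = (L2nrm torus (g 0))\<^sup>2 / (2 * pi)"
  have "exp (\<mu> * \<tau>) * ((1 - \<gamma>) * A) \<le> (1 + \<gamma>) * A0 + C * integral {0..\<tau>} (\<lambda>_. 0)"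
    unfolding A_def A0_def
  proof (rule LIMSEQ_le)
    show "(\<lambda>N. exp (\<mu> * \<tau>) * ((1 - \<gamma>) * nsq N (fc (g \<tau>)))) \<longlonglongrightarrow> exp (\<mu> * \<tau>) * ((1 - \<gamma>) * ((L2nrm torus (g \<tau>))\<^sup>2 / (2 * pi)))"
      using tau by (intro tendsto_mult tendsto_const nsq_fc_tendsto g(1)) auto
    show "(\<lambda>N. (1 + \<gamma>) * nsq N (fc (g 0)) + C * integral {0..\<tau>} (\<rho> N)) \<longlonglongrightarrow>
        (1 + \<gamma>) * ((L2nrm torus (g 0))\<^sup>2 / (2 * pi)) + C * integral {0..\<tau>} (\<lambda>_. 0)"
      using tau by (intro tendsto_add tendsto_mult tendsto_const nsq_fc_tendsto g(1) \<rho>_lim) auto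
  qed (use le in blast)
  then have 1: "exp (\<mu> * \<tau>) * ((1 - \<gamma>) * A) \<le> (1 + \<gamma>) * A0" by simp
  have A0: "0 \<le> A" "0 \<le> A0" by (auto simp: A_def A0_def)
  \<comment> \<open>As \<open>\<gamma> \<le> 1 / 3\<close>, the constants in the equivalence of
    functional and energy have a ratio of at most (4/3) / (2/3) = 2.\<close>
  have "exp (\<mu> * \<tau>) * (2 / 3 * A) \<le> exp (\<mu> * \<tau>) * ((1 - \<gamma>) * A)"
    using \<gamma> A0 by (intro mult_left_mono mult_right_mono) auto
  also note 1
  also have "(1 + \<gamma>) * A0 \<le> 4 / 3 * A0" using \<gamma> A0 by (intro mult_right_mono) auto
  finally have "exp (\<mu> * \<tau>) * A \<le> 2 * A0" by (simp add: mult.commute)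
  then have "exp (- (\<mu> * \<tau>)) * (exp (\<mu> * \<tau>) * A) \<le> exp (- (\<mu> * \<tau>)) * (2 * A0)"
    by (intro mult_left_mono) auto
  moreover have "exp (- (\<mu> * \<tau>)) * (exp (\<mu> * \<tau>) * A) = A" by (simp add: exp_minus)
  ultimately have "A \<le> 2 * exp (- (\<mu> * \<tau>)) * A0" by simp
  then show ?thesis unfolding A_def A0_def \<mu>_def by (simp add: field_simps)
qed

end

subsection \<open>Weak solutions and their Fourier modes\<close>

interpretation torus2: pair_sigma_finite torus torus
  by (intro pair_sigma_finite.intro torus.sigma_finite_measure_axioms)

lemma finite_measure_torus2: "finite_measure torus2"
  unfolding torus2_def
  by (rule finite_measure_pair_measure) (rule finite_measure_torus)+

interpretation torus2: finite_measure torus2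
  by (rule finite_measure_torus2)

lemma L2_torus2_eq: "L2_torus2 = L2 torus2"
  by (simp add: L2_torus2_def L2_def)

lemma L2_norm_eq: "L2_norm f = L2nrm torus2 f"
  by (simp add: L2_norm_def L2nrm_def)

section \<open>Fourier modes in x of functions of two variables\<close>

definition xmode :: "(real \<times> real \<Rightarrow> complex) \<Rightarrow> int \<Rightarrow> real \<Rightarrow> complex" where
  "xmode f k y = fc (\<lambda>x. f (x, y)) k"

text \<open>The conjugate character: pairing with it extracts the coefficient at
  \<open>(k, n)\<close>, and it is an admissible test function.\<close>

definition e2 :: "int \<Rightarrow> int \<Rightarrow> real \<times> real \<Rightarrow> complex" where
  "e2 k n z = cis (- (of_int k * fst z + of_int n * snd z))"

lemma e2_continuous: "continuous_on UNIV (e2 k n)"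
  unfolding e2_def[abs_def] by (intro continuous_intros)

lemma measurable_e2: "e2 k n \<in> borel_measurable torus2"
proof -
  have "fst \<in> borel_measurable torus2" "snd \<in> borel_measurable torus2"
    unfolding torus2_def by (auto intro!: measurable_compose[OF measurable_fst] measurable_compose[OF measurable_snd] measurable_torus)
  then show ?thesis unfolding e2_def[abs_def]
    by (intro measurable_compose[OF _ measurable_cis] borel_measurable_uminus borel_measurable_add
        borel_measurable_times borel_measurable_const)
qed

lemma measurable_snd_torus2: "w \<in> borel_measurable torus \<Longrightarrow> (\<lambda>z. w (snd z)) \<in> borel_measurable torus2"
  unfolding torus2_def by (rule measurable_compose[OF measurable_snd])

lemma L2_torus2_sections:
  assumes f: "f \<in> L2 torus2"
  shows "AE y in torus. (\<lambda>x. f (x, y)) \<in> L2 torus"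
    "integrable torus (\<lambda>y. (L2nrm torus (\<lambda>x. f (x, y)))\<^sup>2)"
    "(LINT y|torus. (L2nrm torus (\<lambda>x. f (x, y)))\<^sup>2) = (L2nrm torus2 f)\<^sup>2"
proof -
  have i: "integrable (torus \<Otimes>\<^sub>M torus) (\<lambda>(x, y). (cmod (f (x, y)))\<^sup>2)"
    using L2_integrable_square[OF f] by (simp add: torus2_def case_prod_unfold)
  have fm: "f \<in> borel_measurable (torus \<Otimes>\<^sub>M torus)" using f by (simp add: L2_def torus2_def)
  have "AE y in torus. integrable torus (\<lambda>x. (cmod (f (x, y)))\<^sup>2)"
    using torus2.AE_integrable_snd[OF i] by simp
  then show "AE y in torus. (\<lambda>x. f (x, y)) \<in> L2 torus"
  proof (rule AE_mp, intro AE_I2 impI)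
    fix y assume y: "y \<in> space torus" and iy: "integrable torus (\<lambda>x. (cmod (f (x, y)))\<^sup>2)"
    have "(\<lambda>x. f (x, y)) \<in> borel_measurable torus"
      by (rule measurable_compose[OF measurable_Pair2'[OF y] fm])
    with iy show "(\<lambda>x. f (x, y)) \<in> L2 torus" by (simp add: L2_def)
  qed
  show "integrable torus (\<lambda>y. (L2nrm torus (\<lambda>x. f (x, y)))\<^sup>2)"
    unfolding L2nrm_square using torus2.integrable_snd[OF i] by simp
  show "(LINT y|torus. (L2nrm torus (\<lambda>x. f (x, y)))\<^sup>2) = (L2nrm torus2 f)\<^sup>2"
    unfolding L2nrm_square using torus2.integral_snd[OF i] by (simp add: torus2_def case_prod_unfold)
qed

lemma xmode_measurable:
  assumes f: "f \<in> L2 torus2"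
  shows "xmode f k \<in> borel_measurable torus"
proof -
  have fm: "f \<in> borel_measurable (torus \<Otimes>\<^sub>M torus)" using f by (simp add: L2_def torus2_def)
  have "fst \<in> borel_measurable (torus \<Otimes>\<^sub>M torus)"
    by (auto intro!: measurable_compose[OF measurable_fst] measurable_torus)
  then have "(\<lambda>z. cis (- of_int k * fst z)) \<in> borel_measurable (torus \<Otimes>\<^sub>M torus)"
    by (intro measurable_compose[OF _ measurable_cis] borel_measurable_times borel_measurable_const)
  then have "(\<lambda>z. f z * cis (- of_int k * fst z)) \<in> borel_measurable (torus \<Otimes>\<^sub>M torus)"
    by (intro borel_measurable_times fm)
  from measurable_pair_swap[OF this]
  have "(\<lambda>(y, x). f (x, y) * cis (- of_int k * x)) \<in> borel_measurable (torus \<Otimes>\<^sub>M torus)"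
    by simp
  then have "(\<lambda>y. LINT x|torus. f (x, y) * cis (- of_int k * x)) \<in> borel_measurable torus"
    by (rule torus.borel_measurable_lebesgue_integral)
  then show ?thesis unfolding xmode_def[abs_def] fc_def by simp
qed

lemma xmode_bound:
  assumes "(\<lambda>x. f (x, y)) \<in> L2 torus"
  shows "2 * pi * (\<Sum>k\<in>{-int K..int K}. (cmod (xmode f k y))\<^sup>2) \<le> (L2nrm torus (\<lambda>x. f (x, y)))\<^sup>2"
  unfolding xmode_def by (rule Bessel[OF assms])

text \<open>For almost every \<open>y\<close>, Bessel's inequality in x bounds a single coefficient
  by the norm of the section, which is square-integrable in y.\<close>

lemma xmode_L2:
  assumes f: "f \<in> L2 torus2"
  shows "xmode f k \<in> L2 torus"
proof -
  note sec = L2_torus2_sections[OF f]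
  have "integrable torus (\<lambda>y. (cmod (xmode f k y))\<^sup>2)"
  proof (rule Bochner_Integration.integrable_bound[OF sec(2)])
    show "(\<lambda>y. (cmod (xmode f k y))\<^sup>2) \<in> borel_measurable torus" using xmode_measurable[OF f, of k] by simp
    show "AE y in torus. norm ((cmod (xmode f k y))\<^sup>2) \<le> norm ((L2nrm torus (\<lambda>x. f (x, y)))\<^sup>2)"
      using sec(1)
    proof eventually_elim
      case (elim y)
      define K where "K = nat \<bar>k\<bar>"
      have "(cmod (xmode f k y))\<^sup>2 \<le> (\<Sum>k\<in>{-int K..int K}. (cmod (xmode f k y))\<^sup>2)"
        by (rule member_le_sum) (auto simp: K_def)
      also have "\<dots> \<le> 2 * pi * \<dots>"
        using pi_gt3 mult_right_mono[of 1 "2 * pi" "\<Sum>k\<in>{-int K..int K}. (cmod (xmode f k y))\<^sup>2"] by (simp add: sum_nonneg)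
      also have "\<dots> \<le> (L2nrm torus (\<lambda>x. f (x, y)))\<^sup>2" by (rule xmode_bound[OF elim])
      finally show ?case by simp
    qed
  qed
  then show ?thesis using xmode_measurable[OF f] by (simp add: L2_def)
qed

text \<open>Parseval's identity in x for almost every \<open>y\<close>, integrated in y; Bessel's
  inequality supplies the majorant for dominated convergence.\<close>

theorem xmode_Parseval:
  assumes f: "f \<in> L2 torus2"
  shows "(\<lambda>K. 2 * pi * (\<Sum>k\<in>{-int K..int K}. (L2nrm torus (xmode f k))\<^sup>2)) \<longlonglongrightarrow> (L2nrm torus2 f)\<^sup>2"
proof -
  note sec = L2_torus2_sections[OF f]
  have i: "integrable torus (\<lambda>y. (cmod (xmode f k y))\<^sup>2)" for k
    by (rule L2_integrable_square[OF xmode_L2[OF f]])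
  have "(\<lambda>K. LINT y|torus. 2 * pi * (\<Sum>k\<in>{-int K..int K}. (cmod (xmode f k y))\<^sup>2))
      \<longlonglongrightarrow> (LINT y|torus. (L2nrm torus (\<lambda>x. f (x, y)))\<^sup>2)"
  proof (rule integral_dominated_convergence[where w = "\<lambda>y. (L2nrm torus (\<lambda>x. f (x, y)))\<^sup>2"])
    show "AE y in torus. (\<lambda>K. 2 * pi * (\<Sum>k\<in>{-int K..int K}. (cmod (xmode f k y))\<^sup>2)) \<longlonglongrightarrow> (L2nrm torus (\<lambda>x. f (x, y)))\<^sup>2"
      using sec(1) by eventually_elim (unfold xmode_def, rule Parseval)
    show "AE y in torus. norm (2 * pi * (\<Sum>k\<in>{-int K..int K}. (cmod (xmode f k y))\<^sup>2)) \<le> (L2nrm torus (\<lambda>x. f (x, y)))\<^sup>2" for K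
      using sec(1)
    proof eventually_elim
      case (elim y)
      then show ?case using xmode_bound[OF elim, of K] by (simp add: sum_nonneg)
    qed
    show "(\<lambda>y. (L2nrm torus (\<lambda>x. f (x, y)))\<^sup>2) \<in> borel_measurable torus" using sec(2) by simp
    show "(\<lambda>y. 2 * pi * (\<Sum>k\<in>{-int K..int K}. (cmod (xmode f k y))\<^sup>2)) \<in> borel_measurable torus" for K
      using i by (intro borel_measurable_times borel_measurable_const borel_measurable_sum borel_measurable_integrable)
  qed (rule sec(2))
  moreover have "(LINT y|torus. 2 * pi * (\<Sum>k\<in>{-int K..int K}. (cmod (xmode f k y))\<^sup>2)) =
      2 * pi * (\<Sum>k\<in>{-int K..int K}. (L2nrm torus (xmode f k))\<^sup>2)" for K
    using i unfolding L2nrm_square by simp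
  ultimately show ?thesis unfolding sec(3) by simp
qed

lemma xmode_le:
  assumes f: "f \<in> L2 torus2"
  shows "L2nrm torus (xmode f k) \<le> L2nrm torus2 f"
proof -
  define K0 where "K0 = nat \<bar>k\<bar>"
  have "(L2nrm torus (xmode f k))\<^sup>2 \<le> 2 * pi * (\<Sum>k\<in>{-int K..int K}. (L2nrm torus (xmode f k))\<^sup>2)" if "K \<ge> K0" for K
  proof -
    have "(L2nrm torus (xmode f k))\<^sup>2 \<le> (\<Sum>k\<in>{-int K..int K}. (L2nrm torus (xmode f k))\<^sup>2)"
      by (rule member_le_sum) (use that in \<open>auto simp: K0_def\<close>)
    also have "\<dots> \<le> 2 * pi * \<dots>"
      using pi_gt3 mult_right_mono[of 1 "2 * pi" "\<Sum>k\<in>{-int K..int K}. (L2nrm torus (xmode f k))\<^sup>2"] by (simp add: sum_nonneg)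
    finally show ?thesis .
  qed
  then have "(L2nrm torus (xmode f k))\<^sup>2 \<le> (L2nrm torus2 f)\<^sup>2"
    by (intro LIMSEQ_le_const[OF xmode_Parseval[OF f]]) blast
  then show ?thesis by (rule power2_le_imp_le) simp
qed

text \<open>The weight is there for the coefficients of \<open>u * g\<close>; \<open>w = 1\<close>
  gives the plain ones. The factor \<open>4 * pi\<^sup>2\<close> combines the normalisations in x
  and in y.\<close>

lemma fc_xmode:
  assumes f: "f \<in> L2 torus2" and w: "w \<in> borel_measurable torus" "\<And>y. cmod (w y) \<le> 1"
  shows "fc (\<lambda>y. w y * xmode f k y) n = (LINT z|torus2. f z * (w (snd z) * e2 k n z)) / of_real (4 * pi\<^sup>2)"
proof -
  have "(\<lambda>z. w (snd z) * e2 k n z) \<in> L2 torus2"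
  proof (rule torus2.bounded_L2[where B = 1])
    show "(\<lambda>z. w (snd z) * e2 k n z) \<in> borel_measurable torus2"
      by (intro borel_measurable_times measurable_snd_torus2 measurable_e2 w)
    show "cmod (w (snd z) * e2 k n z) \<le> 1" for z using w(2) by (simp add: norm_mult e2_def)
  qed
  then have i: "integrable torus2 (\<lambda>z. f z * (w (snd z) * e2 k n z))"
    by (rule L2_integrable_mult[OF f])
  then have i': "integrable (torus \<Otimes>\<^sub>M torus) (\<lambda>(x, y). f (x, y) * (w y * e2 k n (x, y)))"
    by (simp add: torus2_def case_prod_unfold)
  have "(LINT z|torus2. f z * (w (snd z) * e2 k n z)) = (LINT y|torus. LINT x|torus. f (x, y) * (w y * e2 k n (x, y)))"
    using torus2.integral_snd[OF i'] by (simp add: torus2_def case_prod_unfold)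
  also have "\<dots> = (LINT y|torus. of_real (2 * pi) * (w y * xmode f k y * cis (- of_int n * y)))"
  proof (intro Bochner_Integration.integral_cong refl)
    fix y
    have "f (x, y) * (w y * e2 k n (x, y)) = (w y * cis (- of_int n * y)) * (f (x, y) * cis (- of_int k * x))" for x
    proof -
      have "e2 k n (x, y) = cis (- of_int n * y) * cis (- of_int k * x)"
        by (simp add: e2_def cis_mult algebra_simps)
      then show ?thesis by (simp only: mult_ac)
    qed
    then have "(LINT x|torus. f (x, y) * (w y * e2 k n (x, y))) = (w y * cis (- of_int n * y)) * (LINT x|torus. f (x, y) * cis (- of_int k * x))"
      by (simp only: Bochner_Integration.integral_mult_right_zero)
    then show "(LINT x|torus. f (x, y) * (w y * e2 k n (x, y))) = of_real (2 * pi) * (w y * xmode f k y * cis (- of_int n * y))"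
      by (simp add: xmode_def fc_def)
  qed
  also have "\<dots> = of_real (2 * pi) * (LINT y|torus. w y * xmode f k y * cis (- of_int n * y))"
    by (rule Bochner_Integration.integral_mult_right_zero)
  finally show ?thesis by (simp add: fc_def power2_eq_square)
qed

lemma e2_partials:
  "((\<lambda>\<xi>. c * e2 k n (\<xi>, y)) has_vector_derivative (- \<i> * of_int k * c) * e2 k n (x, y)) (at x)"
  "((\<lambda>\<eta>. c * e2 k n (x, \<eta>)) has_vector_derivative (- \<i> * of_int n * c) * e2 k n (x, y)) (at y)"
proof -
  have 1: "e2 k n (\<xi>, y) = cis (- of_int n * y) * cis (of_int (-k) * \<xi>)" for \<xi> y
    by (simp add: e2_def cis_mult algebra_simps)
  have "((\<lambda>\<xi>. c * (cis (- of_int n * y) * cis (of_int (-k) * \<xi>))) has_vector_derivative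
      c * (cis (- of_int n * y) * (\<i> * of_real (of_int (-k)) * cis (of_int (-k) * x)))) (at x)"
    by (intro has_vector_derivative_mult_right has_vector_derivative_cis_mult)
  then show "((\<lambda>\<xi>. c * e2 k n (\<xi>, y)) has_vector_derivative (- \<i> * of_int k * c) * e2 k n (x, y)) (at x)"
    unfolding 1 by (simp add: mult_ac)
  have 2: "e2 k n (x, \<eta>) = cis (- of_int k * x) * cis (of_int (-n) * \<eta>)" for x \<eta>
    by (simp add: e2_def cis_mult algebra_simps)
  have "((\<lambda>\<eta>. c * (cis (- of_int k * x) * cis (of_int (-n) * \<eta>))) has_vector_derivative
      c * (cis (- of_int k * x) * (\<i> * of_real (of_int (-n)) * cis (of_int (-n) * y)))) (at y)"
    by (intro has_vector_derivative_mult_right has_vector_derivative_cis_mult)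
  then show "((\<lambda>\<eta>. c * e2 k n (x, \<eta>)) has_vector_derivative (- \<i> * of_int n * c) * e2 k n (x, y)) (at y)"
    unfolding 2 by (simp add: mult_ac)
qed

lemma partial_x_e2: "partial_x (\<lambda>z. c * e2 k n z) = (\<lambda>z. (- \<i> * of_int k * c) * e2 k n z)"
proof
  show "partial_x (\<lambda>z. c * e2 k n z) z = (- \<i> * of_int k * c) * e2 k n z" for z
    by (cases z) (simp only: partial_x_def prod.case vector_derivative_at[OF e2_partials(1)])
qed

lemma partial_y_e2: "partial_y (\<lambda>z. c * e2 k n z) = (\<lambda>z. (- \<i> * of_int n * c) * e2 k n z)"
proof
  show "partial_y (\<lambda>z. c * e2 k n z) z = (- \<i> * of_int n * c) * e2 k n z" for z
    by (cases z) (simp only: partial_y_def prod.case vector_derivative_at[OF e2_partials(2)])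
qed

lemma e2_periodic: "e2 k n (x + 2 * pi, y) = e2 k n (x, y)" "e2 k n (x, y + 2 * pi) = e2 k n (x, y)"
proof -
  have e: "e2 k n (x, y) = cis (of_int (-k) * x) * cis (of_int (-n) * y)" for x y
    by (simp add: e2_def cis_mult)
  show "e2 k n (x + 2 * pi, y) = e2 k n (x, y)" "e2 k n (x, y + 2 * pi) = e2 k n (x, y)"
    unfolding e cis_int_2pi by simp_all
qed

text \<open>Coinduction needs a class closed under both partial derivatives; the multiples of
  \<open>e2 k n\<close> form one, which explains the constant \<open>c\<close>.\<close>

lemma smooth_e2: "smooth_torus2 (\<lambda>z. c * e2 k n z)"
proof (coinduction arbitrary: c)
  case (smooth_torus2 c)
  show ?case
  proof (intro exI conjI allI)
    show "continuous_on UNIV (\<lambda>z. c * e2 k n z)" by (intro continuous_intros e2_continuous)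
    show "(\<lambda>\<xi>. c * e2 k n (\<xi>, y)) differentiable (at x)" for x y
      using e2_partials(1) by (rule differentiableI_vector)
    show "(\<lambda>\<eta>. c * e2 k n (x, \<eta>)) differentiable (at y)" for x y
      using e2_partials(2) by (rule differentiableI_vector)
    show "(\<exists>c'. partial_x (\<lambda>z. c * e2 k n z) = (\<lambda>z. c' * e2 k n z)) \<or> smooth_torus2 (partial_x (\<lambda>z. c * e2 k n z))"
      by (intro disjI1 exI) (rule partial_x_e2)
    show "(\<exists>c'. partial_y (\<lambda>z. c * e2 k n z) = (\<lambda>z. c' * e2 k n z)) \<or> smooth_torus2 (partial_y (\<lambda>z. c * e2 k n z))"
      by (intro disjI1 exI) (rule partial_y_e2)
  qed (simp_all add: e2_periodic)
qed

lemma e2_L2: "e2 k n \<in> L2 torus2"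
  by (rule torus2.bounded_L2[OF measurable_e2, of _ _ 1]) (simp add: e2_def)

lemma fc_xmode_plain: "g \<in> L2 torus2 \<Longrightarrow> fc (xmode g k) n = (LINT z|torus2. g z * e2 k n z) / of_real (4 * pi\<^sup>2)"
  using fc_xmode[of g "\<lambda>_. 1" k n] by simp

lemma laplacian_e2: "laplacian (e2 k n) z = - of_real ((of_int k)\<^sup>2 + (of_int n)\<^sup>2) * e2 k n z"
  using partial_x_e2[of 1 k n] partial_y_e2[of 1 k n] partial_x_e2[of "- \<i> * of_int k" k n] partial_y_e2[of "- \<i> * of_int n" k n]
  by (simp add: laplacian_def power2_eq_square algebra_simps)

section \<open>Weak solutions mode by mode\<close>

context zigzag begin

lemma measurable_u_torus: "(\<lambda>y. complex_of_real (u y)) \<in> borel_measurable torus"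
  by (intro continuous_measurable_torus continuous_intros continuous_u)

lemma norm_u_le: "cmod (of_real (u y)) \<le> 1"
  using u_range[of y] by simp

lemma u_e2_L2: "(\<lambda>z. of_real (u (snd z)) * e2 k n z) \<in> L2 torus2"
  by (rule L2_bounded_mult[OF e2_L2 measurable_snd_torus2[OF measurable_u_torus] norm_u_le])

lemma fc_xmode_u: "g \<in> L2 torus2 \<Longrightarrow>
    fc (\<lambda>y. of_real (u y) * xmode g k y) n = (LINT z|torus2. g z * (of_real (u (snd z)) * e2 k n z)) / of_real (4 * pi\<^sup>2)"
  by (rule fc_xmode[OF _ measurable_u_torus norm_u_le])

context
  fixes \<nu> :: real and f_in :: "real \<times> real \<Rightarrow> complex" and f :: "real \<Rightarrow> real \<times> real \<Rightarrow> complex"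
  assumes weak: "weak_solution \<nu> u f_in f" and data: "f_in \<in> L2_torus2"
begin

lemma solution_L2: "0 \<le> t \<Longrightarrow> f t \<in> L2 torus2"
  using weak by (simp add: weak_solution_def L2_torus2_eq)

lemma solution_continuous:
  "0 \<le> t \<Longrightarrow> ((\<lambda>s. L2nrm torus2 (\<lambda>z. f s z - f t z)) \<longlongrightarrow> 0) (at t within {0..})"
  using weak by (simp add: weak_solution_def L2_norm_eq)

lemma continuous_pairing:
  assumes h: "h \<in> L2 torus2"
  shows "continuous_on {0..} (\<lambda>t. LINT z|torus2. f t z * h z)"
  unfolding continuous_on_def
proof
  fix t :: real assume t: "t \<in> {0..}"
  have ev: "\<forall>\<^sub>F s in at t within {0..}. s \<in> {0::real..}"
    by (simp add: eventually_at_filter)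
  have "((\<lambda>s. (LINT z|torus2. f s z * h z) - (LINT z|torus2. f t z * h z)) \<longlongrightarrow> 0) (at t within {0..})"
  proof (rule Lim_null_comparison)
    show "\<forall>\<^sub>F s in at t within {0..}. norm ((LINT z|torus2. f s z * h z) - (LINT z|torus2. f t z * h z))
        \<le> L2nrm torus2 (\<lambda>z. f s z - f t z) * L2nrm torus2 h"
      using ev
    proof eventually_elim
      case (elim s)
      have L: "f s \<in> L2 torus2" "f t \<in> L2 torus2" using elim t solution_L2 by auto
      have "(LINT z|torus2. f s z * h z) - (LINT z|torus2. f t z * h z) = (LINT z|torus2. (f s z - f t z) * h z)"
        using L2_integrable_mult[OF L(1) h] L2_integrable_mult[OF L(2) h] by (simp add: left_diff_distrib)
      then show ?case using L2_Cauchy_Schwarz[OF L2_diff[OF L] h] by simp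
    qed
    have "((\<lambda>s. L2nrm torus2 (\<lambda>z. f s z - f t z) * L2nrm torus2 h) \<longlongrightarrow> 0 * L2nrm torus2 h) (at t within {0..})"
      using t by (intro tendsto_mult tendsto_const solution_continuous) auto
    then show "((\<lambda>s. L2nrm torus2 (\<lambda>z. f s z - f t z) * L2nrm torus2 h) \<longlongrightarrow> 0) (at t within {0..})" by simp
  qed
  then show "((\<lambda>t. LINT z|torus2. f t z * h z) \<longlongrightarrow> (LINT z|torus2. f t z * h z)) (at t within {0..})"
    by (rule LIM_zero_cancel)
qed

text \<open>Continuity in time on a compact interval. The bound is the \<open>Bd\<close> that
  \<open>mode_decay\<close> uses as majorant.\<close>

lemma norm_bounded:
  obtains Bd where "\<And>t. t \<in> {0..\<tau>} \<Longrightarrow> L2nrm torus2 (f t) \<le> Bd"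
proof -
  have "continuous_on {0..\<tau>} (\<lambda>t. L2nrm torus2 (f t))"
    unfolding continuous_on_def
  proof
    fix t assume t: "t \<in> {0..\<tau>}"
    have ev: "\<forall>\<^sub>F s in at t within {0..\<tau>}. s \<in> {0..\<tau>}"
      by (simp add: eventually_at_filter)
    have lim: "((\<lambda>s. L2nrm torus2 (\<lambda>z. f s z - f t z)) \<longlongrightarrow> 0) (at t within {0..\<tau>})"
      by (rule tendsto_within_subset[OF solution_continuous]) (use t in auto)
    have "((\<lambda>s. L2nrm torus2 (f s) - L2nrm torus2 (f t)) \<longlongrightarrow> 0) (at t within {0..\<tau>})"
    proof (rule Lim_null_comparison[OF _ lim])
      show "\<forall>\<^sub>F s in at t within {0..\<tau>}. norm (L2nrm torus2 (f s) - L2nrm torus2 (f t)) \<le> L2nrm torus2 (\<lambda>z. f s z - f t z)"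
        using ev
      proof eventually_elim
        case (elim s)
        have L: "f s \<in> L2 torus2" "f t \<in> L2 torus2" using elim t solution_L2 by auto
        have "L2nrm torus2 (f s) \<le> L2nrm torus2 (\<lambda>z. f s z - f t z) + L2nrm torus2 (f t)"
          using L2nrm_triangle[OF L2_diff[OF L] L(2)] by simp
        moreover have "L2nrm torus2 (f t) \<le> L2nrm torus2 (f s) + L2nrm torus2 (\<lambda>z. f s z - f t z)"
          using L2nrm_triangle_diff[OF L(1) L2_diff[OF L]] by simp
        ultimately show ?case by simp
      qed
    qed
    then show "((\<lambda>t. L2nrm torus2 (f t)) \<longlongrightarrow> L2nrm torus2 (f t)) (at t within {0..\<tau>})"
      by (rule LIM_zero_cancel)
  qed
  then have "bounded ((\<lambda>t. L2nrm torus2 (f t)) ` {0..\<tau>})"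
    by (intro compact_imp_bounded compact_continuous_image) auto
  then obtain Bd where "\<forall>t\<in>{0..\<tau>}. L2nrm torus2 (f t) \<le> Bd"
    unfolding bounded_iff by auto
  then show ?thesis by (intro that[of Bd]) blast
qed

lemma continuous_fc_xmode:
  "continuous_on {0..} (\<lambda>t. fc (xmode (f t) k) n)"
  "continuous_on {0..} (\<lambda>t. fc (\<lambda>y. of_real (u y) * xmode (f t) k y) n)"
proof -
  have "continuous_on {0..} (\<lambda>t. (LINT z|torus2. f t z * e2 k n z) / of_real (4 * pi\<^sup>2))"
    by (intro continuous_on_divide continuous_pairing e2_L2 continuous_on_const) simp
  then show "continuous_on {0..} (\<lambda>t. fc (xmode (f t) k) n)"
    by (rule continuous_on_eq) (simp add: fc_xmode_plain solution_L2)
  have "continuous_on {0..} (\<lambda>t. (LINT z|torus2. f t z * (of_real (u (snd z)) * e2 k n z)) / of_real (4 * pi\<^sup>2))"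
    by (intro continuous_on_divide continuous_pairing u_e2_L2 continuous_on_const) simp
  then show "continuous_on {0..} (\<lambda>t. fc (\<lambda>y. of_real (u y) * xmode (f t) k y) n)"
    by (rule continuous_on_eq) (simp add: fc_xmode_u solution_L2)
qed

text \<open>The test function \<open>e2 k n\<close> is an eigenfunction of the x-derivative and of
  the Laplacian, so the weak formulation becomes an integrated equation for one coefficient of
  \<open>f\<close> and one of \<open>u * f\<close>.\<close>

lemma mode_integral_equation:
  assumes "0 \<le> t"
  shows "((\<lambda>s. mode_rhs \<nu> k (fc (xmode (f s) k)) (fc (\<lambda>y. of_real (u y) * xmode (f s) k y)) n) has_integral
     (fc (xmode (f t) k) n - fc (xmode f_in k) n)) {0..t}"
proof -
  have "smooth_torus2 (e2 k n)" using smooth_e2[of 1 k n] by simp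
  then have "((\<lambda>s. LINT z|torus2. f s z * (of_real (u (snd z)) * partial_x (e2 k n) z + of_real \<nu> * laplacian (e2 k n) z))
     has_integral ((LINT z|torus2. f t z * e2 k n z) - (LINT z|torus2. f_in z * e2 k n z))) {0..t}"
    using weak assms unfolding weak_solution_def by blast
  then have "((\<lambda>s. (LINT z|torus2. f s z * (of_real (u (snd z)) * partial_x (e2 k n) z + of_real \<nu> * laplacian (e2 k n) z)) / of_real (4 * pi\<^sup>2))
     has_integral ((LINT z|torus2. f t z * e2 k n z) - (LINT z|torus2. f_in z * e2 k n z)) / of_real (4 * pi\<^sup>2)) {0..t}"
    by (rule has_integral_divide)
  moreover have "((LINT z|torus2. f t z * e2 k n z) - (LINT z|torus2. f_in z * e2 k n z)) / of_real (4 * pi\<^sup>2) =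
      fc (xmode (f t) k) n - fc (xmode f_in k) n"
    using data assms by (simp add: fc_xmode_plain solution_L2 L2_torus2_eq diff_divide_distrib)
  moreover have "(LINT z|torus2. f s z * (of_real (u (snd z)) * partial_x (e2 k n) z + of_real \<nu> * laplacian (e2 k n) z)) / of_real (4 * pi\<^sup>2) =
      mode_rhs \<nu> k (fc (xmode (f s) k)) (fc (\<lambda>y. of_real (u y) * xmode (f s) k y)) n" if "s \<in> {0..t}" for s
  proof -
    have s: "f s \<in> L2 torus2" using that by (intro solution_L2) auto
    have px: "partial_x (e2 k n) z = - \<i> * of_int k * e2 k n z" for z
      using partial_x_e2[of 1 k n] by simp
    have "(LINT z|torus2. f s z * (of_real (u (snd z)) * partial_x (e2 k n) z + of_real \<nu> * laplacian (e2 k n) z)) =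
      (LINT z|torus2. (- \<i> * of_int k) * (f s z * (of_real (u (snd z)) * e2 k n z)) -
         of_real (\<nu> * ((of_int k)\<^sup>2 + (of_int n)\<^sup>2)) * (f s z * e2 k n z))"
      unfolding px laplacian_e2 by (intro Bochner_Integration.integral_cong refl) (simp add: algebra_simps)
    also have "\<dots> = (- \<i> * of_int k) * (LINT z|torus2. f s z * (of_real (u (snd z)) * e2 k n z)) -
         of_real (\<nu> * ((of_int k)\<^sup>2 + (of_int n)\<^sup>2)) * (LINT z|torus2. f s z * e2 k n z)"
    proof -
      have "integrable torus2 (\<lambda>z. f s z * (of_real (u (snd z)) * e2 k n z))" "integrable torus2 (\<lambda>z. f s z * e2 k n z)"
        by (intro L2_integrable_mult s u_e2_L2 e2_L2)+
      then show ?thesis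
        by (subst Bochner_Integration.integral_diff) (simp_all only: integrable_mult_right Bochner_Integration.integral_mult_right_zero simp_thms)
    qed
    finally show ?thesis
      unfolding mode_rhs_def fc_xmode_plain[OF s] fc_xmode_u[OF s] by (simp add: diff_divide_distrib)
  qed
  ultimately show ?thesis by (auto elim: has_integral_eq[rotated])
qed

text \<open>The integrand of the integrated equation is continuous in time, so each coefficient is
  differentiable although the solution is only weak.\<close>

lemma mode_derivative:
  assumes "t \<in> {0..\<tau>}"
  shows "((\<lambda>t. fc (xmode (f t) k) n) has_vector_derivative
     mode_rhs \<nu> k (fc (xmode (f t) k)) (fc (\<lambda>y. of_real (u y) * xmode (f t) k y)) n) (at t within {0..\<tau>})"
proof -
  let ?r = "\<lambda>s. mode_rhs \<nu> k (fc (xmode (f s) k)) (fc (\<lambda>y. of_real (u y) * xmode (f s) k y)) n"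
  have "continuous_on {0..\<tau>} ?r"
    unfolding mode_rhs_def
    by (intro continuous_intros continuous_on_subset[OF continuous_fc_xmode(1)] continuous_on_subset[OF continuous_fc_xmode(2)]) auto
  from integral_has_vector_derivative[OF this assms]
  have "((\<lambda>t. fc (xmode f_in k) n + integral {0..t} ?r) has_vector_derivative 0 + ?r t) (at t within {0..\<tau>})"
    by (intro has_vector_derivative_add has_vector_derivative_const)
  then have "((\<lambda>t. fc (xmode f_in k) n + integral {0..t} ?r) has_vector_derivative ?r t) (at t within {0..\<tau>})" by simp
  then show ?thesis
  proof (rule has_vector_derivative_transform[OF assms, rotated])
    fix s assume "s \<in> {0..\<tau>}"
    then show "fc (xmode (f s) k) n = fc (xmode f_in k) n + integral {0..s} ?r"
      using integral_unique[OF mode_integral_equation[of s k n]] by simp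
  qed
qed

text \<open>For \<open>k = 0\<close> there is no transport: each coefficient solves a scalar linear
  equation with initial value 0, settled by the integrating factor
  \<open>exp (a * t)\<close>.\<close>

lemma zero_mode_vanishes:
  assumes "zero_xmean f_in" "0 \<le> \<tau>"
  shows "L2nrm torus (xmode (f \<tau>) 0) = 0"
proof -
  have "fc (xmode (f \<tau>) 0) n = 0" for n
  proof -
    have "AE y in torus. xmode f_in 0 y = 0"
      using assms(1) unfolding zero_xmean_def xmode_def fc_def by simp
    then have init: "fc (xmode f_in 0) n = 0" by (rule fc_zero_AE)
    \<comment> \<open>The integral equation over the degenerate interval \<open>{0..0}\<close>
      identifies the coefficients at time 0 with those of the datum.\<close>
    have "fc (xmode (f 0) 0) n = fc (xmode f_in 0) n"
      using integral_unique[OF mode_integral_equation[of 0 0 n]] by simp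
    define a where "a = \<nu> * (of_int n)\<^sup>2"
    have "((\<lambda>t. of_real (exp (a * t)) * fc (xmode (f t) 0) n) has_vector_derivative 0) (at t within {0..\<tau>})" if t: "t \<in> {0..\<tau>}" for t
    proof -
      have "((\<lambda>t. exp (a * t)) has_real_derivative a * exp (a * t)) (at t within {0..\<tau>})"
        by (auto intro!: derivative_eq_intros)
      then have "((\<lambda>t. complex_of_real (exp (a * t))) has_vector_derivative of_real (a * exp (a * t))) (at t within {0..\<tau>})"
        by (intro has_vector_derivative_of_real) (simp add: has_real_derivative_iff_has_vector_derivative)
      from has_vector_derivative_mult[OF this mode_derivative[OF t, of 0 n]]
      show ?thesis by (simp add: mode_rhs_def a_def algebra_simps)
    qed
    then obtain C where C: "\<And>t. t \<in> {0..\<tau>} \<Longrightarrow> of_real (exp (a * t)) * fc (xmode (f t) 0) n = C"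
      using has_vector_derivative_zero_constant[of "{0..\<tau>}"] by blast
    have "C = 0" using C[of 0] assms(2) init \<open>fc (xmode (f 0) 0) n = fc (xmode f_in 0) n\<close> by simp
    then show ?thesis using C[of \<tau>] assms(2) by simp
  qed
  then have "(\<lambda>N::nat. 0 :: real) \<longlonglongrightarrow> (L2nrm torus (xmode (f \<tau>) 0))\<^sup>2"
    using Parseval[OF xmode_L2[OF solution_L2[OF assms(2)]], of 0] by simp
  then have "(L2nrm torus (xmode (f \<tau>) 0))\<^sup>2 = 0"
    using LIMSEQ_unique tendsto_const by blast
  then show ?thesis by simp
qed

text \<open>The decay of the modes is uniform in \<open>k\<close> and is summed by
  \<open>xmode_Parseval\<close>. Taking roots halves the exponent; enlarging the factor 2 to 4
  beforehand gives the constant 2.\<close>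

lemma enhanced_dissipation:
  assumes \<nu>: "0 < \<nu>" "\<nu> \<le> 1" and z: "zero_xmean f_in" and \<tau>: "0 \<le> \<tau>"
  shows "L2_norm (f \<tau>) \<le> 2 * exp (- (rate / 2) * \<nu> powr (alpha / (alpha + 2)) * \<tau>) * L2_norm f_in"
proof -
  define \<mu> where "\<mu> = rate * \<nu> powr (alpha / (alpha + 2))"
  obtain Bd where Bd: "\<And>t. t \<in> {0..\<tau>} \<Longrightarrow> L2nrm torus2 (f t) \<le> Bd" using norm_bounded[of \<tau>] by blast
  have mode: "(L2nrm torus (xmode (f \<tau>) k))\<^sup>2 \<le> 2 * exp (- (\<mu> * \<tau>)) * (L2nrm torus (xmode (f 0) k))\<^sup>2" for k
  proof (cases "k = 0")
    case True
    then show ?thesis using zero_mode_vanishes[OF z \<tau>] by simp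
  next
    case False
    show ?thesis unfolding \<mu>_def
    proof (rule mode_decay[OF \<nu> False \<tau>])
      fix t assume t: "t \<in> {0..\<tau>}"
      then have ft: "f t \<in> L2 torus2" by (intro solution_L2) auto
      show "xmode (f t) k \<in> L2 torus" by (rule xmode_L2[OF ft])
      show "L2nrm torus (xmode (f t) k) \<le> Bd" using xmode_le[OF ft] Bd[OF t] by (rule order_trans)
      show "((\<lambda>t. fc (xmode (f t) k) n) has_vector_derivative
         mode_rhs \<nu> k (fc (xmode (f t) k)) (fc (\<lambda>y. of_real (u y) * xmode (f t) k y)) n) (at t within {0..\<tau>})" for n
        by (rule mode_derivative[OF t])
    next
      show "continuous_on {0..\<tau>} (\<lambda>t. fc (\<lambda>y. of_real (u y) * xmode (f t) k y) n)" for n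
        by (rule continuous_on_subset[OF continuous_fc_xmode(2)]) auto
    qed
  qed
  have "(L2nrm torus2 (f \<tau>))\<^sup>2 \<le> 2 * exp (- (\<mu> * \<tau>)) * (L2nrm torus2 (f 0))\<^sup>2"
  proof (rule LIMSEQ_le)
    show "(\<lambda>K. 2 * pi * (\<Sum>k\<in>{-int K..int K}. (L2nrm torus (xmode (f \<tau>) k))\<^sup>2)) \<longlonglongrightarrow> (L2nrm torus2 (f \<tau>))\<^sup>2"
      by (rule xmode_Parseval[OF solution_L2[OF \<tau>]])
    show "(\<lambda>K. 2 * exp (- (\<mu> * \<tau>)) * (2 * pi * (\<Sum>k\<in>{-int K..int K}. (L2nrm torus (xmode (f 0) k))\<^sup>2)))
        \<longlonglongrightarrow> 2 * exp (- (\<mu> * \<tau>)) * (L2nrm torus2 (f 0))\<^sup>2"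
      by (intro tendsto_mult[OF tendsto_const] xmode_Parseval solution_L2) simp
    have "2 * pi * (\<Sum>k\<in>{-int K..int K}. (L2nrm torus (xmode (f \<tau>) k))\<^sup>2) \<le>
        2 * pi * (\<Sum>k\<in>{-int K..int K}. 2 * exp (- (\<mu> * \<tau>)) * (L2nrm torus (xmode (f 0) k))\<^sup>2)" for K :: nat
      by (intro mult_left_mono sum_mono mode) simp
    then show "\<exists>N. \<forall>K\<ge>N. 2 * pi * (\<Sum>k\<in>{-int K..int K}. (L2nrm torus (xmode (f \<tau>) k))\<^sup>2) \<le>
        2 * exp (- (\<mu> * \<tau>)) * (2 * pi * (\<Sum>k\<in>{-int K..int K}. (L2nrm torus (xmode (f 0) k))\<^sup>2))"
      by (simp add: sum_distrib_left mult_ac)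
  qed
  also have "\<dots> \<le> 4 * exp (- (\<mu> * \<tau>)) * (L2nrm torus2 (f 0))\<^sup>2" by (intro mult_right_mono) auto
  also have "\<dots> = (2 * exp (- (\<mu> * \<tau>) / 2) * L2nrm torus2 (f 0))\<^sup>2"
    by (simp add: power_mult_distrib exp_double[symmetric])
  finally have "L2nrm torus2 (f \<tau>) \<le> 2 * exp (- (\<mu> * \<tau>) / 2) * L2nrm torus2 (f 0)"
    by (rule power2_le_imp_le) simp
  moreover have "L2nrm torus2 (f 0) = L2nrm torus2 f_in"
  proof -
    have "AE z in torus2. f 0 z = f_in z" using weak by (simp add: weak_solution_def)
    then have ae: "AE z in torus2. (cmod (f 0 z))\<^sup>2 = (cmod (f_in z))\<^sup>2" by eventually_elim simp
    have "(LINT z|torus2. (cmod (f 0 z))\<^sup>2) = (LINT z|torus2. (cmod (f_in z))\<^sup>2)"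
      by (rule integral_cong_AE[OF _ _ ae])
        (use solution_L2[of 0] data in \<open>auto simp: L2_torus2_eq intro!: borel_measurable_integrable L2_integrable_square\<close>)
    then show ?thesis by (simp add: L2nrm_def)
  qed
  ultimately show ?thesis unfolding L2_norm_eq \<mu>_def by (simp add: mult_ac)
qed

end

end

section \<open>Choice of the parameters and assembly\<close>

lemma zigzag_powers_of_3:
  assumes "1 \<le> t" "1 \<le> s"
  shows "zigzag (3 ^ t) (3 ^ s)" "zigzag.alpha (3 ^ t) (3 ^ s) = real t / real (t + s)"
proof -
  have "(3::nat) ^ 1 \<le> 3 ^ t" "(3::nat) ^ 1 \<le> 3 ^ s"
    using assms by (intro power_increasing; simp)+
  then show z: "zigzag (3 ^ t) (3 ^ s)" by unfold_locales simp_all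
  then show "zigzag.alpha (3 ^ t) (3 ^ s) = real t / real (t + s)"
    by (simp add: zigzag.alpha_def zigzag.b_def power_add[symmetric] ln_realpow)
qed

text \<open>With \<open>q = 3 ^ m\<close> and \<open>r = 3 ^ (n - m)\<close> one has
  \<open>b = 3 ^ n\<close>, and the quotient of logarithms is \<open>m / n\<close>. Base 3 meets
  both lower bounds and keeps \<open>r\<close> odd.\<close>

lemma rational_exponent:
  assumes "x \<in> \<rat>" "0 < x" "x < 1"
  obtains q r where "zigzag q r" "zigzag.alpha q r = x"
proof -
  obtain m n :: nat where mn: "n \<noteq> 0" "x = real m / real n"
    using Rats_abs_nat_div_natE[OF assms(1)] assms(2) by (metis abs_of_pos)
  have "0 < m" using mn assms(2) by (cases m) auto
  moreover have "m < n" using mn assms(3) by (simp add: divide_less_eq)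
  ultimately have "1 \<le> m" "1 \<le> n - m" "m + (n - m) = n" by auto
  from zigzag_powers_of_3[OF this(1,2)] this(3) show ?thesis
    using mn(2) by (intro that) auto
qed

theorem theorem1p1:
  shows "\<exists>A :: real set. A \<subseteq> {0<..<1} \<and> {0<..<1} \<subseteq> closure A \<and>
    (\<forall>\<alpha>\<in>A. \<exists>u :: real \<Rightarrow> real. holder_torus \<alpha> u \<and> sharply_holder \<alpha> u \<and>
      (\<exists>C>0. \<exists>c>0.
        (\<forall>f_in\<in>sobolev_space (-1) 1. zero_xmean_modes f_in \<longrightarrow>
          (\<forall>t>0. inviscid_solution u f_in t \<in> sobolev_space 0 (-1) \<and>
            sobolev_norm 0 (-1) (inviscid_solution u f_in t)
              \<le> C * t powr (-1) * sobolev_norm (-1) 1 f_in)) \<and>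
        (\<exists>\<tau> :: nat \<Rightarrow> real. mono \<tau> \<and> (\<forall>m. 0 < \<tau> m) \<and> filterlim \<tau> at_top sequentially \<and>
          (\<forall>f_in\<in>sobolev_space 0 1. zero_xmean_modes f_in \<longrightarrow>
            (\<forall>m. inviscid_solution u f_in (\<tau> m) \<in> sobolev_space 0 (-1) \<and>
              sobolev_norm 0 (-1) (inviscid_solution u f_in (\<tau> m))
                \<le> C * \<tau> m powr (- (1 / \<alpha>)) * sobolev_norm 0 1 f_in))) \<and>
        (\<exists>f_star\<in>sobolev_space 0 1. zero_xmean_modes f_star \<and>
          \<not> (\<forall>k. AE y in torus. f_star k y = 0) \<and>
          (\<exists>\<tau> :: nat \<Rightarrow> real. mono \<tau> \<and> (\<forall>m. 0 < \<tau> m) \<and> filterlim \<tau> at_top sequentially \<and>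
            (\<forall>m. inviscid_solution u f_star (\<tau> m) \<in> sobolev_space 0 (-1) \<and>
              sobolev_norm 0 (-1) (inviscid_solution u f_star (\<tau> m))
                \<ge> c * \<tau> m powr (-1) * sobolev_norm 0 1 f_star)))) \<and>
      (\<exists>\<epsilon>>0. \<exists>C>0. \<forall>\<nu>\<in>{0<..1}. \<forall>f_in\<in>L2_torus2. \<forall>f.
        zero_xmean f_in \<longrightarrow> weak_solution \<nu> u f_in f \<longrightarrow>
        (\<forall>t\<ge>0. L2_norm (f t)
          \<le> C * exp (- \<epsilon> * \<nu> powr (\<alpha> / (\<alpha> + 2)) * t) * L2_norm f_in)))"
    (is "\<exists>A. _ \<and> _ \<and> (\<forall>\<alpha>\<in>A. \<exists>u. ?P \<alpha> u)")
proof (intro exI[of _ "\<rat> \<inter> {0<..<1}"] conjI ballI)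
  show "{0<..<1} \<subseteq> closure (\<rat> \<inter> {0<..<1::real})"
  proof
    fix x :: real assume x: "x \<in> {0<..<1}"
    show "x \<in> closure (\<rat> \<inter> {0<..<1})"
      unfolding closure_approachable
    proof (intro allI impI)
      fix e :: real assume "0 < e"
      then have "x < min 1 (x + e)" using x by auto
      then obtain y where "y \<in> \<rat>" "x < y" "y < min 1 (x + e)" using Rats_dense_in_real by blast
      then show "\<exists>y\<in>\<rat> \<inter> {0<..<1}. dist y x < e" using x by (intro bexI[of _ y]) (auto simp: dist_real_def)
    qed
  qed
next
  fix \<alpha> :: real assume "\<alpha> \<in> \<rat> \<inter> {0<..<1}"
  then obtain q r where z: "zigzag q r" "zigzag.alpha q r = \<alpha>" using rational_exponent[of \<alpha>] by auto
  interpret zigzag q r by (rule z)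
  note alpha = z(2)
  \<comment> \<open>A single constant has to serve both upper bounds.\<close>
  define C where "C = max (180 * pi * real q) (15 * pi * (2 * pi) powr (1 / \<alpha>))"
  have C: "180 * pi * real q \<le> C" "15 * pi * (2 * pi) powr (1 / \<alpha>) \<le> C" by (auto simp: C_def)
  have "0 < C" using C(1) q_gt1 pi_gt_zero by (smt (verit) mult_pos_pos)
  have norm_nonneg: "0 \<le> sobolev_norm a c \<phi>" for a c \<phi>
    unfolding sobolev_norm_def by (intro real_sqrt_ge_zero infsum_nonneg sobolev_term_nonneg)
  \<comment> \<open>Times that are resonant for all modes at once, and below them times with
    \<open>cis (- t) = -1\<close> for the lower bound.\<close>
  define \<tau> where "\<tau> m = 2 * pi * real q ^ m" for m
  define \<tau>' where "\<tau>' m = (2 * real m + 1) * pi" for m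
  show "\<exists>u. ?P \<alpha> u"
  proof (intro exI[of _ u] conjI)
    show "holder_torus \<alpha> u" using holder_u[of \<alpha>] alpha_pos alpha by simp
    show "sharply_holder \<alpha> u" using sharply_holder_u alpha by simp
    show "\<exists>C>0. \<exists>c>0.
        (\<forall>f_in\<in>sobolev_space (-1) 1. zero_xmean_modes f_in \<longrightarrow>
          (\<forall>t>0. inviscid_solution u f_in t \<in> sobolev_space 0 (-1) \<and>
            sobolev_norm 0 (-1) (inviscid_solution u f_in t)
              \<le> C * t powr (-1) * sobolev_norm (-1) 1 f_in)) \<and>
        (\<exists>\<tau> :: nat \<Rightarrow> real. mono \<tau> \<and> (\<forall>m. 0 < \<tau> m) \<and> filterlim \<tau> at_top sequentially \<and>
          (\<forall>f_in\<in>sobolev_space 0 1. zero_xmean_modes f_in \<longrightarrow>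
            (\<forall>m. inviscid_solution u f_in (\<tau> m) \<in> sobolev_space 0 (-1) \<and>
              sobolev_norm 0 (-1) (inviscid_solution u f_in (\<tau> m))
                \<le> C * \<tau> m powr (- (1 / \<alpha>)) * sobolev_norm 0 1 f_in))) \<and>
        (\<exists>f_star\<in>sobolev_space 0 1. zero_xmean_modes f_star \<and>
          \<not> (\<forall>k. AE y in torus. f_star k y = 0) \<and>
          (\<exists>\<tau> :: nat \<Rightarrow> real. mono \<tau> \<and> (\<forall>m. 0 < \<tau> m) \<and> filterlim \<tau> at_top sequentially \<and>
            (\<forall>m. inviscid_solution u f_star (\<tau> m) \<in> sobolev_space 0 (-1) \<and>
              sobolev_norm 0 (-1) (inviscid_solution u f_star (\<tau> m))
                \<ge> c * \<tau> m powr (-1) * sobolev_norm 0 1 f_star)))"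
    proof (rule exI[of _ C], rule conjI[OF \<open>0 < C\<close>], rule exI[of _ 2], intro conjI)
      show "\<forall>f_in\<in>sobolev_space (-1) 1. zero_xmean_modes f_in \<longrightarrow>
          (\<forall>t>0. inviscid_solution u f_in t \<in> sobolev_space 0 (-1) \<and>
            sobolev_norm 0 (-1) (inviscid_solution u f_in t) \<le> C * t powr (-1) * sobolev_norm (-1) 1 f_in)"
      proof (intro ballI impI allI conjI)
        fix f_in and t :: real assume a: "f_in \<in> sobolev_space (-1) 1" "zero_xmean_modes f_in" "0 < t"
        note b = inviscid_mixing_all_times[OF a]
        show "inviscid_solution u f_in t \<in> sobolev_space 0 (-1)" by (rule b)
        show "sobolev_norm 0 (-1) (inviscid_solution u f_in t) \<le> C * t powr (-1) * sobolev_norm (-1) 1 f_in"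
          using C(1) by (intro order_trans[OF b(2)] mult_right_mono norm_nonneg) auto
      qed
      show "\<exists>\<tau> :: nat \<Rightarrow> real. mono \<tau> \<and> (\<forall>m. 0 < \<tau> m) \<and> filterlim \<tau> at_top sequentially \<and>
          (\<forall>f_in\<in>sobolev_space 0 1. zero_xmean_modes f_in \<longrightarrow>
            (\<forall>m. inviscid_solution u f_in (\<tau> m) \<in> sobolev_space 0 (-1) \<and>
              sobolev_norm 0 (-1) (inviscid_solution u f_in (\<tau> m))
                \<le> C * \<tau> m powr (- (1 / \<alpha>)) * sobolev_norm 0 1 f_in))"
      proof (intro exI[of _ \<tau>] conjI ballI impI allI)
        show "mono \<tau>" unfolding \<tau>_def using q_gt1 by (intro monoI mult_left_mono power_increasing) auto
        show "0 < \<tau> m" for m unfolding \<tau>_def using q_gt1 by simp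
        have "filterlim (\<lambda>m. real q ^ m) at_infinity sequentially"
          using q_gt1 by (intro filterlim_realpow_sequentially_gt1) simp
        then have "filterlim (\<lambda>m. real q ^ m) at_top sequentially"
          by (rule filterlim_at_infinity_imp_filterlim_at_top) (use q_gt1 in auto)
        then show "filterlim \<tau> at_top sequentially" unfolding \<tau>_def
          by (intro filterlim_tendsto_pos_mult_at_top[OF tendsto_const]) auto
        fix f_in m assume a: "f_in \<in> sobolev_space 0 1" "zero_xmean_modes f_in"
        note b = inviscid_mixing_resonant_times[OF a, of m, folded \<tau>_def, unfolded alpha]
        show "inviscid_solution u f_in (\<tau> m) \<in> sobolev_space 0 (-1)" by (rule b)
        show "sobolev_norm 0 (-1) (inviscid_solution u f_in (\<tau> m)) \<le> C * \<tau> m powr (- (1 / \<alpha>)) * sobolev_norm 0 1 f_in"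
          using C(2) by (intro order_trans[OF b(2)] mult_right_mono norm_nonneg) auto
      qed
      show "\<exists>f_star\<in>sobolev_space 0 1. zero_xmean_modes f_star \<and>
          \<not> (\<forall>k. AE y in torus. f_star k y = 0) \<and>
          (\<exists>\<tau> :: nat \<Rightarrow> real. mono \<tau> \<and> (\<forall>m. 0 < \<tau> m) \<and> filterlim \<tau> at_top sequentially \<and>
            (\<forall>m. inviscid_solution u f_star (\<tau> m) \<in> sobolev_space 0 (-1) \<and>
              sobolev_norm 0 (-1) (inviscid_solution u f_star (\<tau> m))
                \<ge> 2 * \<tau> m powr (-1) * sobolev_norm 0 1 f_star))"
      proof (rule bexI[OF _ single_mode(1)], intro conjI single_mode exI[of _ \<tau>'] allI)
        show "mono \<tau>'" unfolding \<tau>'_def by (intro monoI mult_right_mono) auto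
        show "0 < \<tau>' m" for m unfolding \<tau>'_def by (simp add: add_nonneg_pos)
        have "real m \<le> \<tau>' m" for m
        proof -
          have "real m \<le> (2 * real m + 1) * 1" by simp
          also have "\<dots> \<le> (2 * real m + 1) * pi"
            using pi_gt3 by (intro mult_left_mono) auto
          finally show ?thesis unfolding \<tau>'_def .
        qed
        then show "filterlim \<tau>' at_top sequentially"
          by (intro filterlim_at_top_mono[OF filterlim_real_sequentially] always_eventually allI)
        fix m
        note b = single_mode_lower_bound[of m, folded \<tau>'_def]
        show "inviscid_solution u single_mode (\<tau>' m) \<in> sobolev_space 0 (-1)" by (rule b)
        show "sobolev_norm 0 (-1) (inviscid_solution u single_mode (\<tau>' m)) \<ge> 2 * \<tau>' m powr (-1) * sobolev_norm 0 1 single_mode"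
          using b(2) by (simp add: single_mode(2))
      qed
    qed simp
    show "\<exists>\<epsilon>>0. \<exists>C>0. \<forall>\<nu>\<in>{0<..1}. \<forall>f_in\<in>L2_torus2. \<forall>f.
        zero_xmean f_in \<longrightarrow> weak_solution \<nu> u f_in f \<longrightarrow>
        (\<forall>t\<ge>0. L2_norm (f t) \<le> C * exp (- \<epsilon> * \<nu> powr (\<alpha> / (\<alpha> + 2)) * t) * L2_norm f_in)"
    proof (rule exI[of _ "rate / 2"], rule conjI, use rate_pos in simp, rule exI[of _ 2], intro conjI ballI allI impI)
      fix \<nu> f_in f and t :: real
      assume "\<nu> \<in> {0<..1}" "f_in \<in> L2_torus2" "zero_xmean f_in" "weak_solution \<nu> u f_in f" "0 \<le> t"
      then show "L2_norm (f t) \<le> 2 * exp (- (rate / 2) * \<nu> powr (\<alpha> / (\<alpha> + 2)) * t) * L2_norm f_in"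
        using enhanced_dissipation[of \<nu> f_in f t] alpha by simp
    qed simp
  qed
qed auto

end
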